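(* Assume that there is a countable transitive model of $\mathsf{ZFC}$. Let $T \subseteq \mathsf{IKP}^+ + \mathsf{MP} + \mathsf{AC}$ be a set theory. Then the first-order logic of $T$ is $\mathbf{IQC}$, i.e., $\mathbf{QL}(T) = \mathbf{IQC}$. In particular, $\mathbf{QL}(\mathsf{IKP}) = \mathbf{IQC}$.
   Context: Set theories. $\mathcal{L}_\in$ is the first-order language with $\in$ and $=$; a set theory is a theory in $\mathcal{L}_\in$ based on intuitionistic first-order logic. A $\Delta_0$-formula (bounded formula) is one all of whose quantifiers are of the form $\forall x \in a$ or $\exists x \in a$. $\mathsf{IKP}$ consists of intuitionistic first-order logic for $\mathcal{L}_\in$ plus: Empty Set $\exists a\, \forall x \in a\, \bot$; Pairing $\forall a \forall b \exists y \forall x (x \in y \leftrightarrow (x = a \vee x = b))$; Union $\forall a \exists y \forall x (x \in y \leftrightarrow \exists u (u \in a \wedge x \in u))$; Extensionality $\forall a \forall b (\forall x (x \in a \leftrightarrow x \in b) \rightarrow a = b)$; Infinity $\exists x (\emptyset \in x \wedge \forall y (y \in x \rightarrow y \cup \{y\} \in x) \wedge \forall y (y \in x \rightarrow (y = \emptyset \vee \exists z \in y\; y = z \cup \{z\})))$; Set Induction $(\forall a (\forall x \in a\, \varphi(x) \rightarrow \varphi(a))) \rightarrow \forall a\, \varphi(a)$ for all formulas $\varphi$; $\Delta_0$-Separation $\forall a \exists y \forall x (x \in y \leftrightarrow x \in a \wedge \varphi(x))$ and $\Delta_0$-Collection $\forall a (\forall x \in a \exists y\, \varphi(x,y) \rightarrow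 \exists b \forall x \in a \exists y \in b\, \varphi(x,y))$ for $\Delta_0$-formulas $\varphi$. $\mathsf{IKP}^+$ is $\mathsf{IKP}$ plus Bounded Strong Collection, $\forall a (\forall x \in a \exists y\, \varphi(x,y) \rightarrow \exists b (\forall x \in a \exists y \in b\, \varphi(x,y) \wedge \forall y \in b \exists x \in a\, \varphi(x,y)))$ for $\Delta_0$-formulas $\varphi$, and Set-bounded Subset Collection, $\forall a \forall b \exists c \forall z (\forall x \in a \exists y \in b\, \psi(x,y,z) \rightarrow \exists d \in c (\forall x \in a \exists y \in d\, \psi(x,y,z) \wedge \forall y \in d \exists x \in a\, \psi(x,y,z)))$ for $\Delta_0$-formulas $\psi$ in which $z$ is set-bounded (i.e. from $\psi(x,y,z)$ one can intuitionistically derive $z \in t$ for some term $t$ appearing in $\psi$). $\mathsf{MP}$ (Markov's principle) is $\forall \alpha : \mathbb{N} \to 2\, (\neg \forall n \in \mathbb{N}\; \alpha(n) = 0 \rightarrow \exists n \in \mathbb{N}\; \alpha(n) = 1)$. $\mathsf{AC}$ is $\forall a ((\forall x \in a \forall y \in a\, (x \neq y \rightarrow x \cap y = \emptyset)) \rightarrow \exists b \forall x \in a \exists! z \in b\; z \in x)$. First-order logic. $\mathbf{IQC}$ is intuitionistic first-order logic in a language without equality, identified with its set of theorems; only languages with relation symbols are considered (function symbols being eliminated in favour of relation symbols). A first-order translation $\sigma$ maps each $n$-ary relation symbol to a formula of the language of $T$ with $n$ free variables and is extended to all formulas by commuting with connectives and quantifiers. $\mathbf{QL}(T)$ is the set of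 first-order formulas $\varphi$ (without equality) such that $T \vdash \varphi^\sigma$ for all first-order translations $\sigma$.
   Formalization: AC is stated for families of pairwise disjoint inhabited sets; as printed, without inhabitedness, the family {∅} refutes AC, so IKP + AC would be inconsistent and the claim would fail for T = {⊥}. *)

theory Defs
  imports Main "HOL-Library.Countable_Set_Type"
begin

section \<open>Relational first-order formulas\<close>

text \<open>De Bruijn indices; variables are the only terms. A language is given by a type \<open>'r\<close> of
  relation symbols and an arity function \<open>'r \<Rightarrow> nat\<close>. Equality is not part of the logical syntax.\<close>

datatype 'r fm =
    Rel 'r "nat list"
  | Falsum ("\<^bold>\<bottom>")
  | Conj "'r fm" "'r fm" (infixr "\<^bold>\<and>" 35)
  | Disj "'r fm" "'r fm" (infixr "\<^bold>\<or>" 30)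
  | Impl "'r fm" "'r fm" (infixr "\<^bold>\<longrightarrow>" 25)
  | Forall "'r fm"
  | Exists "'r fm"

abbreviation Neg :: "'r fm \<Rightarrow> 'r fm" ("\<^bold>\<not> _" [40] 40) where
  "\<^bold>\<not> \<phi> \<equiv> \<phi> \<^bold>\<longrightarrow> \<^bold>\<bottom>"

abbreviation Iff :: "'r fm \<Rightarrow> 'r fm \<Rightarrow> 'r fm" (infix "\<^bold>\<longleftrightarrow>" 25) where
  "\<phi> \<^bold>\<longleftrightarrow> \<psi> \<equiv> (\<phi> \<^bold>\<longrightarrow> \<psi>) \<^bold>\<and> (\<psi> \<^bold>\<longrightarrow> \<phi>)"

primrec well_formed :: "('r \<Rightarrow> nat) \<Rightarrow> 'r fm \<Rightarrow> bool" where
  "well_formed ar (Rel R xs) \<longleftrightarrow> length xs = ar R"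
| "well_formed ar \<^bold>\<bottom> \<longleftrightarrow> True"
| "well_formed ar (\<phi> \<^bold>\<and> \<psi>) \<longleftrightarrow> well_formed ar \<phi> \<and> well_formed ar \<psi>"
| "well_formed ar (\<phi> \<^bold>\<or> \<psi>) \<longleftrightarrow> well_formed ar \<phi> \<and> well_formed ar \<psi>"
| "well_formed ar (\<phi> \<^bold>\<longrightarrow> \<psi>) \<longleftrightarrow> well_formed ar \<phi> \<and> well_formed ar \<psi>"
| "well_formed ar (Forall \<phi>) \<longleftrightarrow> well_formed ar \<phi>"
| "well_formed ar (Exists \<phi>) \<longleftrightarrow> well_formed ar \<phi>"

primrec fv :: "'r fm \<Rightarrow> nat set" where
  "fv (Rel R xs) = set xs"
| "fv \<^bold>\<bottom> = {}"
| "fv (\<phi> \<^bold>\<and> \<psi>) = fv \<phi> \<union> fv \<psi>"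
| "fv (\<phi> \<^bold>\<or> \<psi>) = fv \<phi> \<union> fv \<psi>"
| "fv (\<phi> \<^bold>\<longrightarrow> \<psi>) = fv \<phi> \<union> fv \<psi>"
| "fv (Forall \<phi>) = {i. Suc i \<in> fv \<phi>}"
| "fv (Exists \<phi>) = {i. Suc i \<in> fv \<phi>}"

definition sentence :: "('r \<Rightarrow> nat) \<Rightarrow> 'r fm \<Rightarrow> bool" where
  "sentence ar \<phi> \<longleftrightarrow> well_formed ar \<phi> \<and> fv \<phi> = {}"

text \<open>Capture-free simultaneous renaming of the free variables.\<close>

primrec rename :: "(nat \<Rightarrow> nat) \<Rightarrow> 'r fm \<Rightarrow> 'r fm" where
  "rename f (Rel R xs) = Rel R (map f xs)"
| "rename f \<^bold>\<bottom> = \<^bold>\<bottom>"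
| "rename f (\<phi> \<^bold>\<and> \<psi>) = (rename f \<phi> \<^bold>\<and> rename f \<psi>)"
| "rename f (\<phi> \<^bold>\<or> \<psi>) = (rename f \<phi> \<^bold>\<or> rename f \<psi>)"
| "rename f (\<phi> \<^bold>\<longrightarrow> \<psi>) = (rename f \<phi> \<^bold>\<longrightarrow> rename f \<psi>)"
| "rename f (Forall \<phi>) = Forall (rename (case_nat 0 (Suc \<circ> f)) \<phi>)"
| "rename f (Exists \<phi>) = Exists (rename (case_nat 0 (Suc \<circ> f)) \<phi>)"

text \<open>\<open>inst xs k \<phi>\<close> puts the variables \<open>xs\<close> for the first \<open>length xs\<close> variables of \<open>\<phi>\<close>; the
  remaining variables of \<open>\<phi>\<close> are parameters and become the variables \<open>k, k + 1, \<dots>\<close>. So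
  \<open>inst xs k \<phi>\<close> is \<open>\<phi>(xs)\<close> written below \<open>k\<close> quantifiers, none of which binds a parameter.\<close>

definition inst :: "nat list \<Rightarrow> nat \<Rightarrow> 'r fm \<Rightarrow> 'r fm" where
  "inst xs k = rename (\<lambda>i. if i < length xs then xs ! i else i - length xs + k)"

definition universal_closures :: "('r \<Rightarrow> nat) \<Rightarrow> 'r fm set \<Rightarrow> 'r fm set" where
  "universal_closures ar S =
     {(Forall ^^ n) \<phi> |n \<phi>. \<phi> \<in> S \<and> sentence ar ((Forall ^^ n) \<phi>)}"


section \<open>Intuitionistic first-order logic\<close>

text \<open>Natural deduction, restricted to the well-formed formulas of the language.\<close>

inductive proves :: "('r \<Rightarrow> nat) \<Rightarrow> 'r fm set \<Rightarrow> 'r fm \<Rightarrow> bool" for ar :: "'r \<Rightarrow> nat" where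
  Assumption: "\<phi> \<in> \<Gamma> \<Longrightarrow> well_formed ar \<phi> \<Longrightarrow> proves ar \<Gamma> \<phi>"
| FalsumE: "proves ar \<Gamma> \<^bold>\<bottom> \<Longrightarrow> well_formed ar \<phi> \<Longrightarrow> proves ar \<Gamma> \<phi>"
| ConjI: "proves ar \<Gamma> \<phi> \<Longrightarrow> proves ar \<Gamma> \<psi> \<Longrightarrow> proves ar \<Gamma> (\<phi> \<^bold>\<and> \<psi>)"
| ConjE1: "proves ar \<Gamma> (\<phi> \<^bold>\<and> \<psi>) \<Longrightarrow> proves ar \<Gamma> \<phi>"
| ConjE2: "proves ar \<Gamma> (\<phi> \<^bold>\<and> \<psi>) \<Longrightarrow> proves ar \<Gamma> \<psi>"
| DisjI1: "proves ar \<Gamma> \<phi> \<Longrightarrow> well_formed ar \<psi> \<Longrightarrow> proves ar \<Gamma> (\<phi> \<^bold>\<or> \<psi>)"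
| DisjI2: "proves ar \<Gamma> \<psi> \<Longrightarrow> well_formed ar \<phi> \<Longrightarrow> proves ar \<Gamma> (\<phi> \<^bold>\<or> \<psi>)"
| DisjE: "proves ar \<Gamma> (\<phi> \<^bold>\<or> \<psi>) \<Longrightarrow> proves ar (insert \<phi> \<Gamma>) \<chi> \<Longrightarrow> proves ar (insert \<psi> \<Gamma>) \<chi>
    \<Longrightarrow> proves ar \<Gamma> \<chi>"
| ImplI: "proves ar (insert \<phi> \<Gamma>) \<psi> \<Longrightarrow> well_formed ar \<phi> \<Longrightarrow> proves ar \<Gamma> (\<phi> \<^bold>\<longrightarrow> \<psi>)"
| ImplE: "proves ar \<Gamma> (\<phi> \<^bold>\<longrightarrow> \<psi>) \<Longrightarrow> proves ar \<Gamma> \<phi> \<Longrightarrow> proves ar \<Gamma> \<psi>"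
| ForallI: "proves ar (inst [] 1 ` \<Gamma>) \<phi> \<Longrightarrow> proves ar \<Gamma> (Forall \<phi>)"
| ForallE: "proves ar \<Gamma> (Forall \<phi>) \<Longrightarrow> proves ar \<Gamma> (inst [t] 0 \<phi>)"
| ExistsI: "proves ar \<Gamma> (inst [t] 0 \<phi>) \<Longrightarrow> proves ar \<Gamma> (Exists \<phi>)"
| ExistsE: "proves ar \<Gamma> (Exists \<phi>) \<Longrightarrow> proves ar (insert \<phi> (inst [] 1 ` \<Gamma>)) (inst [] 1 \<psi>)
    \<Longrightarrow> proves ar \<Gamma> \<psi>"

definition IQC :: "('r \<Rightarrow> nat) \<Rightarrow> 'r fm set" where
  "IQC ar = {\<phi>. well_formed ar \<phi> \<and> proves ar {} \<phi>}"


section \<open>The language of set theory\<close>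

datatype set_sym = In | Eq

definition set_ar :: "set_sym \<Rightarrow> nat" where
  "set_ar R = 2"

abbreviation Mem :: "nat \<Rightarrow> nat \<Rightarrow> set_sym fm" (infix "\<^bold>\<in>" 50) where
  "x \<^bold>\<in> y \<equiv> Rel In [x, y]"

abbreviation Equal :: "nat \<Rightarrow> nat \<Rightarrow> set_sym fm" (infix "\<^bold>=" 50) where
  "x \<^bold>= y \<equiv> Rel Eq [x, y]"

text \<open>In \<open>ForallIn a \<phi>\<close> and \<open>ExistsIn a \<phi>\<close> the bound \<open>a\<close> is an index outside the quantifier.\<close>

definition ForallIn :: "nat \<Rightarrow> set_sym fm \<Rightarrow> set_sym fm" where
  "ForallIn a \<phi> = Forall (0 \<^bold>\<in> Suc a \<^bold>\<longrightarrow> \<phi>)"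

definition ExistsIn :: "nat \<Rightarrow> set_sym fm \<Rightarrow> set_sym fm" where
  "ExistsIn a \<phi> = Exists (0 \<^bold>\<in> Suc a \<^bold>\<and> \<phi>)"

inductive delta0 :: "set_sym fm \<Rightarrow> bool" where
  "delta0 (x \<^bold>\<in> y)"
| "delta0 (x \<^bold>= y)"
| "delta0 \<^bold>\<bottom>"
| "delta0 \<phi> \<Longrightarrow> delta0 \<psi> \<Longrightarrow> delta0 (\<phi> \<^bold>\<and> \<psi>)"
| "delta0 \<phi> \<Longrightarrow> delta0 \<psi> \<Longrightarrow> delta0 (\<phi> \<^bold>\<or> \<psi>)"
| "delta0 \<phi> \<Longrightarrow> delta0 \<psi> \<Longrightarrow> delta0 (\<phi> \<^bold>\<longrightarrow> \<psi>)"
| "delta0 \<phi> \<Longrightarrow> delta0 (ForallIn a \<phi>)"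
| "delta0 \<phi> \<Longrightarrow> delta0 (ExistsIn a \<phi>)"

definition equality_axioms :: "set_sym fm set" where
  "equality_axioms = insert (Forall (0 \<^bold>= 0)) (universal_closures set_ar
     {x \<^bold>= y \<^bold>\<longrightarrow> inst [x] 0 \<phi> \<^bold>\<longrightarrow> inst [y] 0 \<phi> |x y \<phi>. well_formed set_ar \<phi>})"

definition proves_eq :: "set_sym fm set \<Rightarrow> set_sym fm \<Rightarrow> bool" (infix "\<turnstile>" 45) where
  "T \<turnstile> \<phi> \<longleftrightarrow> proves set_ar (equality_axioms \<union> T) \<phi>"

definition set_theory :: "set_sym fm set \<Rightarrow> bool" where
  "set_theory T \<longleftrightarrow> (\<forall>\<phi>\<in>T. sentence set_ar \<phi>)"

definition theorems :: "set_sym fm set \<Rightarrow> set_sym fm set" where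
  "theorems T = {\<phi>. sentence set_ar \<phi> \<and> T \<turnstile> \<phi>}"


section \<open>Intuitionistic set theories\<close>

subsection \<open>IKP\<close>

text \<open>\<open>x = \<emptyset>\<close> and \<open>s = x \<union> {x}\<close>\<close>

definition is_empty :: "nat \<Rightarrow> set_sym fm" where
  "is_empty x = ForallIn x \<^bold>\<bottom>"

definition is_succ :: "nat \<Rightarrow> nat \<Rightarrow> set_sym fm" where
  "is_succ s x = Forall (0 \<^bold>\<in> Suc s \<^bold>\<longleftrightarrow> (0 \<^bold>\<in> Suc x \<^bold>\<or> 0 \<^bold>= Suc x))"

definition is_inductive :: "nat \<Rightarrow> set_sym fm" where
  "is_inductive x =
     (Exists (is_empty 0 \<^bold>\<and> 0 \<^bold>\<in> Suc x) \<^bold>\<and>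
      ForallIn x (Exists (is_succ 0 1 \<^bold>\<and> 0 \<^bold>\<in> Suc (Suc x))))"

definition Empty_Set :: "set_sym fm" where
  "Empty_Set = Exists (ForallIn 0 \<^bold>\<bottom>)"

definition Pairing :: "set_sym fm" where
  "Pairing = Forall (Forall (Exists (Forall (0 \<^bold>\<in> 1 \<^bold>\<longleftrightarrow> (0 \<^bold>= 3 \<^bold>\<or> 0 \<^bold>= 2)))))"

definition Union_Axiom :: "set_sym fm" where
  "Union_Axiom = Forall (Exists (Forall (0 \<^bold>\<in> 1 \<^bold>\<longleftrightarrow> Exists (0 \<^bold>\<in> 3 \<^bold>\<and> 1 \<^bold>\<in> 0))))"

definition Extensionality :: "set_sym fm" where
  "Extensionality = Forall (Forall (Forall (0 \<^bold>\<in> 2 \<^bold>\<longleftrightarrow> 0 \<^bold>\<in> 1) \<^bold>\<longrightarrow> 1 \<^bold>= 0))"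

definition Infinity :: "set_sym fm" where
  "Infinity = Exists (is_inductive 0 \<^bold>\<and>
     ForallIn 0 (is_empty 0 \<^bold>\<or> ExistsIn 0 (is_succ 1 0)))"

text \<open>In the schemata below, the schematic formula has the variables listed in brackets and
  parameters, the latter being universally closed. The set whose existence is asserted does not
  occur in it; sets bounded by an outermost universal quantifier may.\<close>

text \<open>\<open>\<phi>(x)\<close>\<close>

definition Set_Induction :: "set_sym fm \<Rightarrow> set_sym fm" where
  "Set_Induction \<phi> = (Forall (ForallIn 0 (inst [0] 2 \<phi>) \<^bold>\<longrightarrow> inst [0] 1 \<phi>)
     \<^bold>\<longrightarrow> Forall (inst [0] 1 \<phi>))"

text \<open>\<open>\<phi>(x, a)\<close>\<close>

definition Separation :: "set_sym fm \<Rightarrow> set_sym fm" where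
  "Separation \<phi> = Forall (Exists (Forall (0 \<^bold>\<in> 1 \<^bold>\<longleftrightarrow> (0 \<^bold>\<in> 2 \<^bold>\<and> inst [0, 2] 3 \<phi>))))"

text \<open>\<open>\<phi>(x, y, a)\<close>\<close>

definition Collection :: "set_sym fm \<Rightarrow> set_sym fm" where
  "Collection \<phi> = Forall
     (ForallIn 0 (Exists (inst [1, 0, 2] 3 \<phi>)) \<^bold>\<longrightarrow>
      Exists (ForallIn 1 (ExistsIn 1 (inst [1, 0, 3] 4 \<phi>))))"

definition IKP :: "set_sym fm set" where
  "IKP = {Empty_Set, Pairing, Union_Axiom, Extensionality, Infinity} \<union>
     universal_closures set_ar
       ({Set_Induction \<phi> |\<phi>. well_formed set_ar \<phi>} \<union>
        {Separation \<phi> |\<phi>. delta0 \<phi>} \<union>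
        {Collection \<phi> |\<phi>. delta0 \<phi>})"


subsection \<open>Extensions of IKP\<close>

text \<open>\<open>\<phi>(x, y, a)\<close>\<close>

definition Strong_Collection :: "set_sym fm \<Rightarrow> set_sym fm" where
  "Strong_Collection \<phi> = Forall
     (ForallIn 0 (Exists (inst [1, 0, 2] 3 \<phi>)) \<^bold>\<longrightarrow>
      Exists (ForallIn 1 (ExistsIn 1 (inst [1, 0, 3] 4 \<phi>)) \<^bold>\<and>
              ForallIn 0 (ExistsIn 2 (inst [0, 1, 3] 4 \<phi>))))"

text \<open>\<open>\<psi>(x, y, z, a, b)\<close>\<close>

definition Subset_Collection :: "set_sym fm \<Rightarrow> set_sym fm" where
  "Subset_Collection \<psi> = Forall (Forall (Exists (Forall
     (ForallIn 3 (ExistsIn 3 (inst [1, 0, 2, 5, 4] 6 \<psi>)) \<^bold>\<longrightarrow>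
      ExistsIn 1 (ForallIn 4 (ExistsIn 1 (inst [1, 0, 3, 6, 5] 7 \<psi>)) \<^bold>\<and>
                  ForallIn 0 (ExistsIn 5 (inst [0, 1, 3, 6, 5] 7 \<psi>)))))))"

definition set_bounded :: "nat \<Rightarrow> set_sym fm \<Rightarrow> bool" where
  "set_bounded z \<psi> \<longleftrightarrow> (\<exists>t\<in>fv \<psi>. {\<psi>} \<turnstile> z \<^bold>\<in> t)"

definition IKP_plus :: "set_sym fm set" where
  "IKP_plus = IKP \<union> universal_closures set_ar
     ({Strong_Collection \<phi> |\<phi>. delta0 \<phi>} \<union>
      {Subset_Collection \<psi> |\<psi>. delta0 \<psi> \<and> set_bounded 2 \<psi>})"

text \<open>\<open>x\<close> is the least inductive set\<close>

definition is_omega :: "nat \<Rightarrow> set_sym fm" where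
  "is_omega x = (is_inductive x \<^bold>\<and>
     Forall (is_inductive 0 \<^bold>\<longrightarrow> ForallIn (Suc x) (0 \<^bold>\<in> 1)))"

text \<open>\<open>x = {\<emptyset>}\<close>, \<open>w = {x, y}\<close>, \<open>p = {{x}, {x, y}}\<close> and \<open>(x, y) \<in> f\<close>\<close>

definition is_one :: "nat \<Rightarrow> set_sym fm" where
  "is_one x = Forall (0 \<^bold>\<in> Suc x \<^bold>\<longleftrightarrow> is_empty 0)"

definition is_upair :: "nat \<Rightarrow> nat \<Rightarrow> nat \<Rightarrow> set_sym fm" where
  "is_upair w x y = Forall (0 \<^bold>\<in> Suc w \<^bold>\<longleftrightarrow> (0 \<^bold>= Suc x \<^bold>\<or> 0 \<^bold>= Suc y))"

definition is_pair :: "nat \<Rightarrow> nat \<Rightarrow> nat \<Rightarrow> set_sym fm" where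
  "is_pair p x y = Forall (0 \<^bold>\<in> Suc p \<^bold>\<longleftrightarrow>
     (is_upair 0 (Suc x) (Suc x) \<^bold>\<or> is_upair 0 (Suc x) (Suc y)))"

definition maps_to :: "nat \<Rightarrow> nat \<Rightarrow> nat \<Rightarrow> set_sym fm" where
  "maps_to f x y = ExistsIn f (is_pair 0 (Suc x) (Suc y))"

text \<open>\<open>f : d \<rightarrow> 2\<close>, where \<open>2 = {\<emptyset>, {\<emptyset>}}\<close>\<close>

definition is_binary_function :: "nat \<Rightarrow> nat \<Rightarrow> set_sym fm" where
  "is_binary_function f d =
     (ForallIn f (ExistsIn (Suc d) (Exists ((is_empty 0 \<^bold>\<or> is_one 0) \<^bold>\<and> is_pair 2 1 0))) \<^bold>\<and>
      ForallIn d (Exists (maps_to (f + 2) 1 0 \<^bold>\<and>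
        Forall (maps_to (f + 3) 2 0 \<^bold>\<longrightarrow> 0 \<^bold>= 1))))"

definition MP :: "set_sym fm" where
  "MP = Forall (is_omega 0 \<^bold>\<longrightarrow> Forall (is_binary_function 0 1 \<^bold>\<longrightarrow>
     (\<^bold>\<not> ForallIn 1 (Exists (is_empty 0 \<^bold>\<and> maps_to 2 1 0))) \<^bold>\<longrightarrow>
     ExistsIn 1 (Exists (is_one 0 \<^bold>\<and> maps_to 2 1 0))))"

text \<open>The members of the family must be required to be inhabited: without this premise, the
  family \<open>{\<emptyset>}\<close> would refute the axiom.\<close>

definition AC :: "set_sym fm" where
  "AC = Forall
     (ForallIn 0 (Exists (0 \<^bold>\<in> 1)) \<^bold>\<and>
      ForallIn 0 (ForallIn 1 ((\<^bold>\<not> 1 \<^bold>= 0) \<^bold>\<longrightarrow> Forall (\<^bold>\<not> (0 \<^bold>\<in> 2 \<^bold>\<and> 0 \<^bold>\<in> 1))))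
      \<^bold>\<longrightarrow>
      Exists (ForallIn 1 (ExistsIn 1 (0 \<^bold>\<in> 1 \<^bold>\<and> ForallIn 2 (0 \<^bold>\<in> 2 \<^bold>\<longrightarrow> 0 \<^bold>= 1)))))"


section \<open>First-order translations\<close>

text \<open>The argument places of \<open>R\<close> are the variables \<open>0, \<dots>, ar R - 1\<close> of \<open>\<sigma> R\<close>.\<close>

definition translation :: "('r \<Rightarrow> nat) \<Rightarrow> ('r \<Rightarrow> set_sym fm) \<Rightarrow> bool" where
  "translation ar \<sigma> \<longleftrightarrow> (\<forall>R. well_formed set_ar (\<sigma> R) \<and> fv (\<sigma> R) \<subseteq> {..<ar R})"

primrec translate :: "('r \<Rightarrow> set_sym fm) \<Rightarrow> 'r fm \<Rightarrow> set_sym fm" where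
  "translate \<sigma> (Rel R xs) = inst xs 0 (\<sigma> R)"
| "translate \<sigma> \<^bold>\<bottom> = \<^bold>\<bottom>"
| "translate \<sigma> (\<phi> \<^bold>\<and> \<psi>) = (translate \<sigma> \<phi> \<^bold>\<and> translate \<sigma> \<psi>)"
| "translate \<sigma> (\<phi> \<^bold>\<or> \<psi>) = (translate \<sigma> \<phi> \<^bold>\<or> translate \<sigma> \<psi>)"
| "translate \<sigma> (\<phi> \<^bold>\<longrightarrow> \<psi>) = (translate \<sigma> \<phi> \<^bold>\<longrightarrow> translate \<sigma> \<psi>)"
| "translate \<sigma> (Forall \<phi>) = Forall (translate \<sigma> \<phi>)"
| "translate \<sigma> (Exists \<phi>) = Exists (translate \<sigma> \<phi>)"

definition QL :: "('r \<Rightarrow> nat) \<Rightarrow> set_sym fm set \<Rightarrow> 'r fm set" where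
  "QL ar T = {\<phi>. well_formed ar \<phi> \<and> (\<forall>\<sigma>. translation ar \<sigma> \<longrightarrow> T \<turnstile> translate \<sigma> \<phi>)}"


section \<open>Countable transitive models of ZFC\<close>

definition Powerset :: "set_sym fm" where
  "Powerset = Forall (Exists (Forall (0 \<^bold>\<in> 1 \<^bold>\<longleftrightarrow> ForallIn 0 (0 \<^bold>\<in> 3))))"

definition Foundation :: "set_sym fm" where
  "Foundation = Forall (Exists (0 \<^bold>\<in> 1) \<^bold>\<longrightarrow> ExistsIn 0 (ForallIn 0 (\<^bold>\<not> 0 \<^bold>\<in> 2)))"

text \<open>\<open>\<phi>(x, y, a)\<close>\<close>

definition Replacement :: "set_sym fm \<Rightarrow> set_sym fm" where
  "Replacement \<phi> = Forall
     (ForallIn 0 (Exists (inst [1, 0, 2] 3 \<phi> \<^bold>\<and> Forall (inst [2, 0, 3] 4 \<phi> \<^bold>\<longrightarrow> 0 \<^bold>= 1))) \<^bold>\<longrightarrow>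
      Exists (Forall (0 \<^bold>\<in> 1 \<^bold>\<longleftrightarrow> ExistsIn 2 (inst [0, 1, 3] 4 \<phi>))))"

definition ZFC :: "set_sym fm set" where
  "ZFC = {Empty_Set, Pairing, Union_Axiom, Extensionality, Infinity, Powerset, Foundation, AC} \<union>
     universal_closures set_ar
       ({Separation \<phi> |\<phi>. well_formed set_ar \<phi>} \<union>
        {Replacement \<phi> |\<phi>. well_formed set_ar \<phi>})"

text \<open>The hereditarily countable sets. Every element of a countable transitive set is hereditarily
  countable, so the countable transitive sets are exactly the countable transitive subsets of
  this type.\<close>

datatype hc = HC (elems: "hc cset")

definition hc_mem :: "hc \<Rightarrow> hc \<Rightarrow> bool" where
  "hc_mem x y \<longleftrightarrow> cin x (elems y)"

text \<open>Classical (Tarskian) satisfaction in the structure \<open>(M, hc_mem, =)\<close>.\<close>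

primrec satisfies :: "hc set \<Rightarrow> (nat \<Rightarrow> hc) \<Rightarrow> set_sym fm \<Rightarrow> bool" where
  "satisfies M e (Rel R xs) \<longleftrightarrow>
     (case R of In \<Rightarrow> hc_mem (e (xs ! 0)) (e (xs ! 1)) | Eq \<Rightarrow> e (xs ! 0) = e (xs ! 1))"
| "satisfies M e \<^bold>\<bottom> \<longleftrightarrow> False"
| "satisfies M e (\<phi> \<^bold>\<and> \<psi>) \<longleftrightarrow> satisfies M e \<phi> \<and> satisfies M e \<psi>"
| "satisfies M e (\<phi> \<^bold>\<or> \<psi>) \<longleftrightarrow> satisfies M e \<phi> \<or> satisfies M e \<psi>"
| "satisfies M e (\<phi> \<^bold>\<longrightarrow> \<psi>) \<longleftrightarrow> (satisfies M e \<phi> \<longrightarrow> satisfies M e \<psi>)"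
| "satisfies M e (Forall \<phi>) \<longleftrightarrow> (\<forall>a\<in>M. satisfies M (case_nat a e) \<phi>)"
| "satisfies M e (Exists \<phi>) \<longleftrightarrow> (\<exists>a\<in>M. satisfies M (case_nat a e) \<phi>)"

definition ctm_of_ZFC :: "hc set \<Rightarrow> bool" where
  "ctm_of_ZFC M \<longleftrightarrow> M \<noteq> {} \<and> countable M \<and> (\<forall>y\<in>M. \<forall>x. hc_mem x y \<longrightarrow> x \<in> M) \<and>
     (\<forall>\<phi>\<in>ZFC. \<forall>e. range e \<subseteq> M \<longrightarrow> satisfies M e \<phi>)"

end

theory Submission
  imports Defs "HOL-Library.Nat_Bijection"
begin

text \<open>In a Kripke model whose worlds are transitive sets, ordered by inclusion, a bounded formula is
  forced iff it is true. Hence the axioms of \<open>IKP\<^sup>+ + MP + AC\<close> are forced as soon as every world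
  satisfies KP and choice, and forcing extensions can be avoided: a single chain of worlds suffices,
  because the frame may still branch. Inside the model \<open>M\<close> of ZFC, let \<open>\<kappa>\<^sub>h\<close> be the \<open>h\<close>-th iterated
  power set of \<open>V\<^sub>\<omega>\<close> and \<open>N\<^sub>h\<close> the collection of all sets hereditarily of size at most \<open>\<kappa>\<^sub>h\<close>. Each
  \<open>N\<^sub>h\<close> satisfies KP and choice, and by Cantor's theorem it contains \<open>\<kappa>\<^sub>a\<close> iff \<open>a \<le> h\<close>.

  Given an underivable \<open>\<phi>\<close>, the nodes of the frame are saturated theories together with the list of
  heights passed through, and the domain at a node of height \<open>h\<close> is \<open>N\<^sub>h\<close>. The pairs \<open>(\<kappa>\<^sub>a, b)\<close> name
  the variables of these theories; new variables receive names with a new \<open>\<kappa>\<^sub>a\<close>. An atom \<open>R(x)\<close> is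
  translated as ``no later node has a height coding \<open>R\<close> and \<open>x\<close>'', where the height of a node is
  the \<open>h\<close> for which \<open>\<kappa>\<^sub>h\<close> exists but its power set does not. A node lying in a theory that omits an
  atom has an extension of such a height, still omitting it, and no node above a theory containing
  the atom has one. So a translated formula is forced at a node iff it belongs to its theory.\<close>

section \<open>Renaming and derivability\<close>

text \<open>The obstacle: a translated atom must be a parameter-free formula of set theory whose
  truth varies between nodes, while membership, equality and all bounded formulas are decided by the
  sets alone. Two nodes of equal height have the same domain, so they can differ only in what lies
  above them, and what a formula can detect of a later node is its height. Atoms are therefore
  expressed by forbidding later heights, a condition that persists automatically.

  This dictates the coding. A height carries a symbol, the names of its arguments and a padding
  number, so that a code exists above any given height; some heights must code nothing, for
  extensions that refute no atom. Different branches pass through different heights, so a name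
  cannot denote a fixed variable: the block of variables named through \<open>kap a\<close> is given
  by the number of heights below \<open>a\<close> passed so far, which is constant once
  \<open>kap a\<close> has entered the domain. Quantifiers range over the whole domain, so sets that
  are not names need a default variable. Finally all this must be definable inside every
  \<open>NN h\<close>, whence the recursion along finite traces.\<close>

lemma lift_comp: "case_nat 0 (Suc \<circ> f) \<circ> case_nat 0 (Suc \<circ> g) = case_nat 0 (Suc \<circ> (f \<circ> g))"
  by (auto split: nat.splits)

lemma rename_rename: "rename f (rename g \<phi>) = rename (f \<circ> g) \<phi>"
  by (induction \<phi> arbitrary: f g) (simp_all add: lift_comp)

lemma rename_cong: "(\<And>i. i \<in> fv \<phi> \<Longrightarrow> f i = g i) \<Longrightarrow> rename f \<phi> = rename g \<phi>"
proof (induction \<phi> arbitrary: f g)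
  case (Forall \<phi>)
  have "rename (case_nat 0 (Suc \<circ> f)) \<phi> = rename (case_nat 0 (Suc \<circ> g)) \<phi>"
    by (rule Forall.IH) (use Forall.prems in \<open>auto split: nat.split\<close>)
  then show ?case by simp
next
  case (Exists \<phi>)
  have "rename (case_nat 0 (Suc \<circ> f)) \<phi> = rename (case_nat 0 (Suc \<circ> g)) \<phi>"
    by (rule Exists.IH) (use Exists.prems in \<open>auto split: nat.split\<close>)
  then show ?case by simp
next
  case (Conj \<phi> \<psi>)
  show ?case using Conj.IH[of f g] Conj.prems by simp
next
  case (Disj \<phi> \<psi>)
  show ?case using Disj.IH[of f g] Disj.prems by simp
next
  case (Impl \<phi> \<psi>)
  show ?case using Impl.IH[of f g] Impl.prems by simp
qed simp_all

lemma lift_id: "case_nat 0 (Suc \<circ> (\<lambda>i. i)) = (\<lambda>i. i)"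
  by (auto split: nat.splits)

lemma rename_id: "rename (\<lambda>i. i) \<phi> = \<phi>"
  by (induction \<phi>) (simp_all only: rename.simps lift_id list.map_ident)

lemma well_formed_rename [simp]: "well_formed ar (rename f \<phi>) = well_formed ar \<phi>"
  by (induction \<phi> arbitrary: f) auto

lemma set_fm_rename [simp]: "set_fm (rename f \<phi>) = set_fm \<phi>"
  by (induction \<phi> arbitrary: f) auto

lemma Suc_in_lift_image: "Suc i \<in> case_nat 0 (Suc \<circ> f) ` A \<longleftrightarrow> (\<exists>j. Suc j \<in> A \<and> i = f j)"
proof
  assume "Suc i \<in> case_nat 0 (Suc \<circ> f) ` A"
  then obtain k where "k \<in> A" "Suc i = case_nat 0 (Suc \<circ> f) k" by blast
  then show "\<exists>j. Suc j \<in> A \<and> i = f j" by (cases k) auto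
next
  assume "\<exists>j. Suc j \<in> A \<and> i = f j"
  then obtain j where "Suc j \<in> A" "i = f j" by blast
  then show "Suc i \<in> case_nat 0 (Suc \<circ> f) ` A" by (intro image_eqI[of _ _ "Suc j"]) simp_all
qed

lemma fv_rename: "fv (rename f \<phi>) = f ` fv \<phi>"
proof (induction \<phi> arbitrary: f)
  case (Forall \<phi>)
  then show ?case by (simp add: Suc_in_lift_image) blast
next
  case (Exists \<phi>)
  then show ?case by (simp add: Suc_in_lift_image) blast
qed auto

lemma finite_fv: "finite (fv \<phi>)"
proof (induction \<phi>)
  case (Forall \<phi>)
  have "{i. Suc i \<in> fv \<phi>} \<subseteq> (\<lambda>i. i - 1) ` fv \<phi>" by force
  then show ?case using Forall by (simp add: finite_subset)
next
  case (Exists \<phi>)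
  have "{i. Suc i \<in> fv \<phi>} \<subseteq> (\<lambda>i. i - 1) ` fv \<phi>" by force
  then show ?case using Exists by (simp add: finite_subset)
qed auto

lemma inst_weaken: "inst [] 1 = rename Suc"
  by (simp add: inst_def)

lemma inst_one: "inst [t] 0 = rename (case_nat t (\<lambda>i. i))"
  unfolding inst_def by (rule arg_cong[where f = rename]) (auto split: nat.splits)

lemma well_formed_inst [simp]: "well_formed ar (inst xs k \<phi>) = well_formed ar \<phi>"
  by (simp add: inst_def)

lemma proves_well_formed: "proves ar \<Gamma> \<phi> \<Longrightarrow> well_formed ar \<phi>"
  by (induction rule: proves.induct) auto

lemma proves_mono: "proves ar \<Gamma> \<phi> \<Longrightarrow> \<Gamma> \<subseteq> \<Delta> \<Longrightarrow> proves ar \<Delta> \<phi>"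
proof (induction arbitrary: \<Delta> rule: proves.induct)
  case (DisjE \<Gamma> \<phi> \<psi> \<chi>)
  then show ?case by (meson insert_mono proves.DisjE)
next
  case (ImplI \<phi> \<Gamma> \<psi>)
  then show ?case by (meson insert_mono proves.ImplI)
next
  case (ForallI \<Gamma> \<phi>)
  then show ?case by (meson image_mono proves.ForallI)
next
  case (ExistsE \<Gamma> \<phi> \<psi>)
  then show ?case by (meson image_mono insert_mono proves.ExistsE)
qed (blast intro: proves.intros)+

lemma rename_lift_weaken: "rename (case_nat 0 (Suc \<circ> f)) (inst [] 1 \<phi>) = inst [] 1 (rename f \<phi>)"
  unfolding inst_weaken rename_rename by (rule rename_cong) simp

lemma rename_lift_weaken_image:
  "rename (case_nat 0 (Suc \<circ> f)) ` inst [] 1 ` \<Gamma> = inst [] 1 ` rename f ` \<Gamma>"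
  by (simp only: image_image rename_lift_weaken)

lemma rename_inst_one:
  "rename f (inst [t] 0 \<phi>) = inst [f t] 0 (rename (case_nat 0 (Suc \<circ> f)) \<phi>)"
  unfolding inst_one rename_rename by (rule rename_cong) (auto split: nat.splits)

lemma proves_rename: "proves ar \<Gamma> \<phi> \<Longrightarrow> proves ar (rename f ` \<Gamma>) (rename f \<phi>)"
proof (induction arbitrary: f rule: proves.induct)
  case (ForallI \<Gamma> \<phi>)
  show ?case
    using ForallI.IH[of "case_nat 0 (Suc \<circ> f)"]
    unfolding rename_lift_weaken_image rename.simps by (rule proves.ForallI)
next
  case (ForallE \<Gamma> \<phi> t)
  then show ?case by (simp add: rename_inst_one proves.ForallE del: One_nat_def)
next
  case (ExistsI \<Gamma> t \<phi>)
  then show ?case by (auto simp: rename_inst_one intro: proves.ExistsI)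
next
  case (ExistsE \<Gamma> \<phi> \<psi>)
  have "proves ar (insert (rename (case_nat 0 (Suc \<circ> f)) \<phi>) (inst [] 1 ` rename f ` \<Gamma>)) (inst [] 1 (rename f \<psi>))"
    using ExistsE.IH(2)[of "case_nat 0 (Suc \<circ> f)"]
    unfolding image_insert rename_lift_weaken rename_lift_weaken_image .
  then show ?case using ExistsE.IH(1)[of f] by (auto intro: proves.ExistsE)
next
  case (DisjE \<Gamma> \<phi> \<psi> \<chi>)
  show ?case using DisjE.IH[of f] unfolding image_insert rename.simps by (rule proves.DisjE)
qed (auto intro: proves.intros)

lemma proves_compact: "proves ar \<Gamma> \<phi> \<Longrightarrow> \<exists>\<Delta>\<subseteq>\<Gamma>. finite \<Delta> \<and> proves ar \<Delta> \<phi>"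
proof (induction rule: proves.induct)
  case (Assumption \<phi> \<Gamma>)
  then show ?case by (intro exI[of _ "{\<phi>}"]) (auto intro: proves.Assumption)
next
  case (FalsumE \<Gamma> \<phi>)
  then show ?case using proves.FalsumE[of ar _ \<phi>] by blast
next
  case (ConjI \<Gamma> \<phi> \<psi>)
  then obtain D E where "D \<subseteq> \<Gamma>" "E \<subseteq> \<Gamma>" "finite D" "finite E" "proves ar D \<phi>" "proves ar E \<psi>" by auto
  then show ?case
    by (intro exI[of _ "D \<union> E"])
      (auto intro: proves.ConjI[OF proves_mono[of _ D] proves_mono[of _ E]])
next
  case (ConjE1 \<Gamma> \<phi> \<psi>)
  then show ?case using proves.ConjE1[of ar _ \<phi> \<psi>] by blast
next
  case (ConjE2 \<Gamma> \<phi> \<psi>)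
  then show ?case using proves.ConjE2[of ar _ \<phi> \<psi>] by blast
next
  case (DisjI1 \<Gamma> \<phi> \<psi>)
  then show ?case using proves.DisjI1[of ar _ \<phi> \<psi>] by blast
next
  case (DisjI2 \<Gamma> \<psi> \<phi>)
  then show ?case using proves.DisjI2[of ar _ \<psi> \<phi>] by blast
next
  case (DisjE \<Gamma> \<phi> \<psi> \<chi>)
  then obtain D E F where D: "D \<subseteq> \<Gamma>" "finite D" "proves ar D (\<phi> \<^bold>\<or> \<psi>)"
    and E: "E \<subseteq> insert \<phi> \<Gamma>" "finite E" "proves ar E \<chi>"
    and F: "F \<subseteq> insert \<psi> \<Gamma>" "finite F" "proves ar F \<chi>" by auto
  let ?X = "D \<union> (E - {\<phi>}) \<union> (F - {\<psi>})"
  have "proves ar ?X (\<phi> \<^bold>\<or> \<psi>)" "proves ar (insert \<phi> ?X) \<chi>" "proves ar (insert \<psi> ?X) \<chi>"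
    by (rule proves_mono[OF D(3)], blast, rule proves_mono[OF E(3)], blast,
        rule proves_mono[OF F(3)], blast)
  then have "proves ar ?X \<chi>" by (rule proves.DisjE)
  then show ?case using D E F by (intro exI[of _ ?X]) auto
next
  case (ImplI \<phi> \<Gamma> \<psi>)
  then obtain E where E: "E \<subseteq> insert \<phi> \<Gamma>" "finite E" "proves ar E \<psi>" by auto
  have "proves ar (insert \<phi> (E - {\<phi>})) \<psi>" by (rule proves_mono[OF E(3)]) blast
  then show ?case using E ImplI
    by (intro exI[of _ "E - {\<phi>}"]) (auto intro: proves.ImplI)
next
  case (ImplE \<Gamma> \<phi> \<psi>)
  then obtain D E where "D \<subseteq> \<Gamma>" "E \<subseteq> \<Gamma>" "finite D" "finite E"
    "proves ar D (\<phi> \<^bold>\<longrightarrow> \<psi>)" "proves ar E \<phi>" by auto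
  then show ?case
    by (intro exI[of _ "D \<union> E"])
      (auto intro: proves.ImplE[OF proves_mono[of _ D] proves_mono[of _ E]])
next
  case (ForallI \<Gamma> \<phi>)
  then obtain D where "D \<subseteq> inst [] 1 ` \<Gamma>" "finite D" and D: "proves ar D \<phi>" by auto
  then obtain E where E: "E \<subseteq> \<Gamma>" "finite E" "D = inst [] 1 ` E"
    by (meson finite_subset_image)
  then show ?case using proves.ForallI[of ar E \<phi>] D by blast
next
  case (ForallE \<Gamma> \<phi> t)
  then show ?case using proves.ForallE[of ar _ \<phi> t] by blast
next
  case (ExistsI \<Gamma> t \<phi>)
  then show ?case using proves.ExistsI[of ar _ t \<phi>] by blast
next
  case (ExistsE \<Gamma> \<phi> \<psi>)
  then obtain D E where D: "D \<subseteq> \<Gamma>" "finite D" "proves ar D (Exists \<phi>)"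
    and E: "E \<subseteq> insert \<phi> (inst [] 1 ` \<Gamma>)" "finite E" "proves ar E (inst [] 1 \<psi>)" by auto
  \<comment> \<open>The hypotheses used below the eigenvariable are shifted formulas; pulling them
    back along the shift gives the finite \<open>F\<close> in the original context.\<close>
  obtain F where F: "F \<subseteq> \<Gamma>" "finite F" "E - {\<phi>} = inst [] 1 ` F"
    using E by (metis Diff_subset_conv finite_Diff finite_subset_image insert_is_Un)
  let ?X = "D \<union> F"
  have "proves ar ?X (Exists \<phi>)" by (rule proves_mono[OF D(3)]) blast
  moreover have "proves ar (insert \<phi> (inst [] 1 ` ?X)) (inst [] 1 \<psi>)"
    by (rule proves_mono[OF E(3)]) (use F(3) in blast)
  ultimately have "proves ar ?X \<psi>" by (rule proves.ExistsE)
  then show ?case using D F by (intro exI[of _ ?X]) auto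
qed

lemma proves_cut: "proves ar \<Gamma> \<phi> \<Longrightarrow> proves ar (insert \<phi> \<Gamma>) \<chi> \<Longrightarrow> proves ar \<Gamma> \<chi>"
  by (meson proves.ImplE proves.ImplI proves_well_formed)

text \<open>Renaming the fresh variable \<open>d\<close> to \<open>0\<close> and shifting all others turns an eigenvariable
  argument with named variables into the de Bruijn rules.\<close>

definition abstract_var :: "nat \<Rightarrow> nat \<Rightarrow> nat" where
  "abstract_var d i = (if i = d then 0 else Suc i)"

lemma rename_abstract_var:
  assumes "d \<notin> fv \<phi>" shows "rename (abstract_var d) \<phi> = inst [] 1 \<phi>"
  unfolding inst_weaken by (rule rename_cong) (use assms in \<open>auto simp: abstract_var_def\<close>)

lemma rename_abstract_var_inst:
  assumes "d \<notin> fv (Exists \<phi>)" shows "rename (abstract_var d) (inst [d] 0 \<phi>) = \<phi>"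
proof -
  have "rename (abstract_var d) (inst [d] 0 \<phi>) = rename (\<lambda>i. i) \<phi>"
    unfolding inst_one rename_rename
    by (rule rename_cong) (use assms in \<open>auto simp: abstract_var_def split: nat.splits\<close>)
  then show ?thesis by (simp add: rename_id)
qed

lemma abstract_var_image:
  "d \<notin> (\<Union>\<gamma>\<in>\<Gamma>. fv \<gamma>) \<Longrightarrow> rename (abstract_var d) ` \<Gamma> = inst [] 1 ` \<Gamma>"
  by (rule image_cong) (auto simp: rename_abstract_var)

lemma proves_Forall_fresh:
  assumes "proves ar \<Gamma> (inst [d] 0 \<phi>)" "d \<notin> (\<Union>\<gamma>\<in>\<Gamma>. fv \<gamma>)" "d \<notin> fv (Forall \<phi>)"
  shows "proves ar \<Gamma> (Forall \<phi>)"
proof (rule proves.ForallI)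
  show "proves ar (inst [] 1 ` \<Gamma>) \<phi>"
    using proves_rename[OF assms(1), of "abstract_var d"] assms(2,3)
    by (simp add: abstract_var_image rename_abstract_var_inst)
qed

lemma proves_Exists_fresh:
  assumes "proves ar (insert (inst [d] 0 \<phi>) \<Gamma>) \<chi>" "proves ar \<Gamma> (Exists \<phi>)"
    and "d \<notin> (\<Union>\<gamma>\<in>\<Gamma>. fv \<gamma>)" "d \<notin> fv (Exists \<phi>)" "d \<notin> fv \<chi>"
  shows "proves ar \<Gamma> \<chi>"
proof (rule proves.ExistsE)
  show "proves ar (insert \<phi> (inst [] 1 ` \<Gamma>)) (inst [] 1 \<chi>)"
    using proves_rename[OF assms(1), of "abstract_var d"] assms(3-5)
    by (simp add: abstract_var_image rename_abstract_var_inst rename_abstract_var)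
qed (rule assms)


section \<open>Translations preserve derivability\<close>

lemma well_formed_translate:
  "translation ar \<sigma> \<Longrightarrow> well_formed set_ar (translate \<sigma> \<phi>)"
  by (induction \<phi>) (auto simp: translation_def)

text \<open>Well-formedness matters: if \<open>xs\<close> were shorter than the arity,
  \<open>inst xs 0\<close> would treat surplus variables of \<open>\<sigma> R\<close> as parameters
  and shift them, which does not commute with renaming.\<close>

lemma translate_rename:
  assumes "translation ar \<sigma>"
  shows "well_formed ar \<phi> \<Longrightarrow> translate \<sigma> (rename f \<phi>) = rename f (translate \<sigma> \<phi>)"
proof (induction \<phi> arbitrary: f)
  case (Rel R xs)
  have "i < length xs" if "i \<in> fv (\<sigma> R)" for i
    using assms Rel that by (auto simp: translation_def)
  then show ?case
    unfolding translate.simps rename.simps inst_def rename_rename by (auto intro!: rename_cong)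
qed auto

lemma translate_inst:
  "translation ar \<sigma> \<Longrightarrow> well_formed ar \<phi> \<Longrightarrow> translate \<sigma> (inst xs k \<phi>) = inst xs k (translate \<sigma> \<phi>)"
  by (simp add: inst_def translate_rename)

lemma translate_weaken_image:
  assumes "translation ar \<sigma>"
  shows "translate \<sigma> ` {\<gamma> \<in> inst [] 1 ` \<Gamma>. well_formed ar \<gamma>}
    = inst [] 1 ` translate \<sigma> ` {\<gamma>\<in>\<Gamma>. well_formed ar \<gamma>}"
proof -
  have "{\<gamma> \<in> inst [] 1 ` \<Gamma>. well_formed ar \<gamma>} = inst [] 1 ` {\<gamma>\<in>\<Gamma>. well_formed ar \<gamma>}" by auto
  then show ?thesis by (auto simp: image_image translate_inst[OF assms] simp del: One_nat_def)
qed

text \<open>Ill-formed hypotheses are filtered out because renaming commutes with the translation on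
  well-formed formulas only; nothing is lost, as \<open>Assumption\<close> admits no other
  formulas.\<close>

lemma proves_translate:
  assumes \<sigma>: "translation ar \<sigma>"
  shows "proves ar \<Gamma> \<phi> \<Longrightarrow>
    proves set_ar (translate \<sigma> ` {\<gamma>\<in>\<Gamma>. well_formed ar \<gamma>}) (translate \<sigma> \<phi>)"
proof (induction rule: proves.induct)
  case (Assumption \<phi> \<Gamma>)
  then show ?case using \<sigma> by (auto intro!: proves.Assumption well_formed_translate)
next
  case (FalsumE \<Gamma> \<phi>)
  then show ?case using \<sigma> by (auto intro!: proves.FalsumE well_formed_translate)
next
  case (DisjI1 \<Gamma> \<phi> \<psi>)
  then show ?case using \<sigma> by (auto intro!: proves.DisjI1 well_formed_translate)
next
  case (DisjI2 \<Gamma> \<psi> \<phi>)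
  then show ?case using \<sigma> by (auto intro!: proves.DisjI2 well_formed_translate)
next
  case (DisjE \<Gamma> \<phi> \<psi> \<chi>)
  have wf: "well_formed ar \<phi>" "well_formed ar \<psi>"
    using DisjE.hyps(1) by (auto dest: proves_well_formed)
  have "{\<gamma> \<in> insert \<phi> \<Gamma>. well_formed ar \<gamma>} = insert \<phi> {\<gamma>\<in>\<Gamma>. well_formed ar \<gamma>}"
    "{\<gamma> \<in> insert \<psi> \<Gamma>. well_formed ar \<gamma>} = insert \<psi> {\<gamma>\<in>\<Gamma>. well_formed ar \<gamma>}"
    using wf by auto
  then show ?case using DisjE.IH by (auto intro: proves.DisjE)
next
  case (ImplI \<phi> \<Gamma> \<psi>)
  have "{\<gamma> \<in> insert \<phi> \<Gamma>. well_formed ar \<gamma>} = insert \<phi> {\<gamma>\<in>\<Gamma>. well_formed ar \<gamma>}"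
    using ImplI by auto
  then show ?case using ImplI \<sigma> by (auto intro!: proves.ImplI well_formed_translate)
next
  case (ForallI \<Gamma> \<phi>)
  then show ?case
    unfolding translate_weaken_image[OF \<sigma>] translate.simps by (intro proves.ForallI)
next
  case (ForallE \<Gamma> \<phi> t)
  then have "well_formed ar \<phi>" by (auto dest: proves_well_formed)
  then show ?case using ForallE by (auto simp: translate_inst[OF \<sigma>] intro: proves.ForallE)
next
  case (ExistsI \<Gamma> t \<phi>)
  then have "well_formed ar \<phi>" by (auto dest: proves_well_formed)
  then show ?case using ExistsI by (auto simp: translate_inst[OF \<sigma>] intro: proves.ExistsI)
next
  case (ExistsE \<Gamma> \<phi> \<psi>)
  then have wf: "well_formed ar \<phi>" "well_formed ar \<psi>" by (auto dest: proves_well_formed)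
  have "{\<gamma> \<in> insert \<phi> (inst [] 1 ` \<Gamma>). well_formed ar \<gamma>}
      = insert \<phi> {\<gamma> \<in> inst [] 1 ` \<Gamma>. well_formed ar \<gamma>}"
    using wf by auto
  then show ?case
    using ExistsE.IH translate_inst[OF \<sigma> wf(2)]
    by (auto simp only: image_insert translate_weaken_image[OF \<sigma>] translate.simps
        intro: proves.ExistsE)
qed (auto intro: proves.intros)

lemma IQC_subset_QL: "IQC ar \<subseteq> QL ar T"
proof
  fix \<phi> :: "'a fm" assume "\<phi> \<in> IQC ar"
  then have \<phi>: "well_formed ar \<phi>" "proves ar {} \<phi>" by (auto simp: IQC_def)
  have "T \<turnstile> translate \<sigma> \<phi>" if "translation ar \<sigma>" for \<sigma>
    using proves_translate[OF that \<phi>(2)] unfolding proves_eq_def by (auto elim: proves_mono)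
  then show "\<phi> \<in> QL ar T" using \<phi> by (simp add: QL_def)
qed


section \<open>Saturated theories\<close>

instance fm :: (countable) countable
  by countable_datatype

text \<open>Free variables from \<open>V\<close> play the role of Henkin constants.
  \<open>Sy\<close> bounds the symbols, so that the language stays countable even when the type
  \<open>'r\<close> is not.\<close>

definition lang :: "('r \<Rightarrow> nat) \<Rightarrow> 'r set \<Rightarrow> nat set \<Rightarrow> 'r fm set" where
  "lang ar Sy V = {\<phi>. well_formed ar \<phi> \<and> set_fm \<phi> \<subseteq> Sy \<and> fv \<phi> \<subseteq> V}"

text \<open>Numbering the symbols in \<open>Sy\<close> embeds the language into the countable type
  \<open>nat fm\<close>.\<close>

lemma countable_lang:
  assumes "countable Sy" shows "countable (lang ar Sy V)"
proof -
  have "inj_on (map_fm (to_nat_on Sy)) (lang ar Sy V)"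
  proof (rule inj_onI)
    fix \<phi> \<psi> assume "\<phi> \<in> lang ar Sy V" "\<psi> \<in> lang ar Sy V"
      and "map_fm (to_nat_on Sy) \<phi> = map_fm (to_nat_on Sy) \<psi>"
    then show "\<phi> = \<psi>"
      using inj_on_to_nat_on[OF assms]
      by (intro fm.inj_map_strong[of \<phi> \<psi>]) (auto simp: lang_def inj_on_def subset_iff)
  qed
  then show ?thesis by (rule countableI')
qed

definition saturated :: "('r \<Rightarrow> nat) \<Rightarrow> 'r set \<Rightarrow> nat set \<Rightarrow> 'r fm set \<Rightarrow> bool" where
  "saturated ar Sy V \<Gamma> \<longleftrightarrow> \<Gamma> \<subseteq> lang ar Sy V \<and> \<^bold>\<bottom> \<notin> \<Gamma> \<and>
     (\<forall>\<phi>\<in>lang ar Sy V. proves ar \<Gamma> \<phi> \<longrightarrow> \<phi> \<in> \<Gamma>) \<and>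
     (\<forall>\<phi> \<psi>. (\<phi> \<^bold>\<or> \<psi>) \<in> \<Gamma> \<longrightarrow> \<phi> \<in> \<Gamma> \<or> \<psi> \<in> \<Gamma>) \<and>
     (\<forall>\<phi>. Exists \<phi> \<in> \<Gamma> \<longrightarrow> (\<exists>d\<in>V. inst [d] 0 \<phi> \<in> \<Gamma>))"

lemma lindenbaum_step:
  assumes S: "S \<subseteq> lang ar Sy V" "\<not> proves ar S \<chi>" "infinite (V - (\<Union>\<gamma>\<in>S. fv \<gamma>))"
    and \<phi>: "\<phi> \<in> lang ar Sy V"
  shows "\<exists>S'. S \<subseteq> S' \<and> S' \<subseteq> lang ar Sy V \<and> \<not> proves ar S' \<chi> \<and> infinite (V - (\<Union>\<gamma>\<in>S'. fv \<gamma>)) \<and>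
    (\<phi> \<in> S' \<or> proves ar (insert \<phi> S) \<chi>) \<and>
    (\<forall>\<psi>. \<phi> = Exists \<psi> \<and> \<phi> \<in> S' \<longrightarrow> (\<exists>d\<in>V. inst [d] 0 \<psi> \<in> S'))"
proof -
  consider (out) "proves ar (insert \<phi> S) \<chi>" | (ex) \<psi> where "\<not> proves ar (insert \<phi> S) \<chi>" "\<phi> = Exists \<psi>"
    | (other) "\<not> proves ar (insert \<phi> S) \<chi>" "\<nexists>\<psi>. \<phi> = Exists \<psi>" by blast
  then show ?thesis
  proof cases
    case out
    \<comment> \<open>Hence the clause on witnesses is vacuous when \<open>S\<close> is left
      unchanged.\<close>
    then have "\<phi> \<notin> S" using S(2) by (metis insert_absorb)
    then show ?thesis using out S by (intro exI[of _ S]) auto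
  next
    case ex
    have fin: "finite (fv \<phi> \<union> fv \<chi>)" by (simp add: finite_fv)
    have "infinite (V - (\<Union>\<gamma>\<in>S. fv \<gamma>) - (fv \<phi> \<union> fv \<chi>))"
      by (rule Diff_infinite_finite[OF fin S(3)])
    then obtain d where d: "d \<in> V" "d \<notin> (\<Union>\<gamma>\<in>S. fv \<gamma>)" "d \<notin> fv \<phi>" "d \<notin> fv \<chi>"
      by (metis Diff_iff UnCI finite.emptyI ex_in_conv)
    let ?\<alpha> = "inst [d] 0 \<psi>"
    let ?S = "insert ?\<alpha> (insert \<phi> S)"
    have "\<not> proves ar ?S \<chi>"
    proof
      assume "proves ar ?S \<chi>"
      then have "proves ar (insert \<phi> S) \<chi>"
        by (rule proves_Exists_fresh[where d = d])
          (use ex d \<phi> in \<open>auto intro: proves.Assumption simp: lang_def\<close>)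
      then show False using ex by simp
    qed
    moreover have "?\<alpha> \<in> lang ar Sy V"
    proof -
      have "fv ?\<alpha> \<subseteq> insert d (fv \<phi>)"
        unfolding inst_one fv_rename using ex by (auto split: nat.splits)
      then show ?thesis using \<phi> ex d by (auto simp: lang_def inst_def)
    qed
    moreover have "infinite (V - (\<Union>\<gamma>\<in>?S. fv \<gamma>))"
    proof -
      have eq: "V - (\<Union>\<gamma>\<in>?S. fv \<gamma>) = V - (\<Union>\<gamma>\<in>S. fv \<gamma>) - (fv \<phi> \<union> fv ?\<alpha>)" by auto
      show ?thesis unfolding eq by (rule Diff_infinite_finite[OF _ S(3)]) (simp add: finite_fv)
    qed
    ultimately show ?thesis using ex d S \<phi> by (intro exI[of _ ?S]) auto
  next
    case other
    have eq: "V - (\<Union>\<gamma>\<in>insert \<phi> S. fv \<gamma>) = V - (\<Union>\<gamma>\<in>S. fv \<gamma>) - fv \<phi>" by auto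
    have "infinite (V - (\<Union>\<gamma>\<in>insert \<phi> S. fv \<gamma>))"
      unfolding eq by (rule Diff_infinite_finite[OF _ S(3)]) (simp add: finite_fv)
    then show ?thesis using other S \<phi> by (intro exI[of _ "insert \<phi> S"]) auto
  qed
qed

text \<open>Every formula is tried at some stage, so the limit is maximal among the theories not
  deriving \<open>\<chi>\<close>; closure and primeness follow from maximality, and witnesses are
  supplied on the way.\<close>

lemma lindenbaum:
  assumes Sy: "countable Sy" and \<Gamma>: "\<Gamma> \<subseteq> lang ar Sy V" "\<not> proves ar \<Gamma> \<chi>"
    and inf: "infinite (V - (\<Union>\<gamma>\<in>\<Gamma>. fv \<gamma>))" and \<chi>: "\<chi> \<in> lang ar Sy V"
  obtains \<Delta> where "\<Gamma> \<subseteq> \<Delta>" "saturated ar Sy V \<Delta>" "\<chi> \<notin> \<Delta>"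
proof -
  let ?L = "lang ar Sy V"
  define \<phi> where "\<phi> = from_nat_into ?L"
  have ne: "?L \<noteq> {}" using \<chi> by auto
  have \<phi>: "\<phi> n \<in> ?L" for n unfolding \<phi>_def by (rule from_nat_into[OF ne])
  have \<phi>_surj: "\<exists>n. \<psi> = \<phi> n" if "\<psi> \<in> ?L" for \<psi>
    using from_nat_into_surj[OF countable_lang[OF Sy] that] unfolding \<phi>_def by metis
  define P where "P S \<longleftrightarrow> \<Gamma> \<subseteq> S \<and> S \<subseteq> ?L \<and> \<not> proves ar S \<chi> \<and> infinite (V - (\<Union>\<gamma>\<in>S. fv \<gamma>))" for S
  define Q where "Q n S S' \<longleftrightarrow> S \<subseteq> S' \<and> (\<phi> n \<in> S' \<or> proves ar (insert (\<phi> n) S) \<chi>) \<and>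
    (\<forall>\<psi>. \<phi> n = Exists \<psi> \<and> \<phi> n \<in> S' \<longrightarrow> (\<exists>d\<in>V. inst [d] 0 \<psi> \<in> S'))" for n S S'
  have "\<exists>f. \<forall>n. P (f n) \<and> Q n (f n) (f (Suc n))"
  proof (rule dependent_nat_choice)
    show "\<exists>x. P x" using \<Gamma> inf by (auto simp: P_def)
    fix S n assume "P S"
    then have "S \<subseteq> ?L" "\<not> proves ar S \<chi>" "infinite (V - (\<Union>\<gamma>\<in>S. fv \<gamma>))" "\<Gamma> \<subseteq> S"
      by (auto simp: P_def)
    with lindenbaum_step[OF this(1-3) \<phi>[of n]] obtain S' where "P S'" "Q n S S'"
      unfolding P_def Q_def by (meson subset_trans)
    then show "\<exists>S'. P S' \<and> Q n S S'" by (intro exI[of _ S'] conjI)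
  qed
  then obtain f where P: "P (f n)" and Q: "Q n (f n) (f (Suc n))" for n by blast
  have mono: "f m \<subseteq> f n" if "m \<le> n" for m n
    using that by (rule lift_Suc_mono_le[of f, rotated]) (use Q in \<open>simp add: Q_def\<close>)
  define \<Delta> where "\<Delta> = (\<Union>n. f n)"
  have chain: "\<exists>n. F \<subseteq> f n" if "finite F" "F \<subseteq> \<Delta>" for F
    using that
  proof (induction F rule: finite_induct)
    case (insert x F)
    then obtain m n where "F \<subseteq> f n" "x \<in> f m" by (auto simp: \<Delta>_def)
    then show ?case using mono[of n "max m n"] mono[of m "max m n"] by (intro exI[of _ "max m n"]) auto
  qed simp
  have con: "\<not> proves ar \<Delta> \<chi>"
  proof
    assume "proves ar \<Delta> \<chi>"
    then obtain F where F: "F \<subseteq> \<Delta>" "finite F" "proves ar F \<chi>" by (blast dest: proves_compact)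
    then obtain n where "F \<subseteq> f n" using chain by blast
    then show False using P[of n] proves_mono[OF F(3)] by (auto simp: P_def)
  qed
  \<comment> \<open>Maximality: the stage of \<open>\<psi>\<close> rejects it only if it would
    derive \<open>\<chi>\<close>, and \<open>\<Delta>\<close> is at least as strong as that
    stage.\<close>
  have mem: "\<psi> \<in> \<Delta>" if L: "\<psi> \<in> ?L" and np: "\<not> proves ar (insert \<psi> \<Delta>) \<chi>" for \<psi>
  proof -
    obtain n where n: "\<psi> = \<phi> n" using \<phi>_surj[OF L] by blast
    have "\<not> proves ar (insert \<psi> (f n)) \<chi>"
      using np by (auto simp: \<Delta>_def elim: contrapos_nn intro: proves_mono)
    then show ?thesis using Q[of n] n by (auto simp: Q_def \<Delta>_def)
  qed
  have sub: "\<Delta> \<subseteq> ?L" using P by (auto simp: \<Delta>_def P_def)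
  have "saturated ar Sy V \<Delta>"
    unfolding saturated_def
  proof (intro conjI ballI allI impI)
    show "\<^bold>\<bottom> \<notin> \<Delta>"
    proof
      assume "\<^bold>\<bottom> \<in> \<Delta>"
      then have "proves ar \<Delta> \<chi>"
        using \<chi> by (intro proves.FalsumE[OF proves.Assumption]) (auto simp: lang_def)
      then show False using con by simp
    qed
  next
    fix \<psi> assume "\<psi> \<in> ?L" "proves ar \<Delta> \<psi>"
    then show "\<psi> \<in> \<Delta>" using mem con proves_cut by blast
  next
    fix \<alpha> \<beta> assume ab: "(\<alpha> \<^bold>\<or> \<beta>) \<in> \<Delta>"
    then have abL: "(\<alpha> \<^bold>\<or> \<beta>) \<in> ?L" using sub by blast
    then have L: "\<alpha> \<in> ?L" "\<beta> \<in> ?L" by (auto simp: lang_def)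
    show "\<alpha> \<in> \<Delta> \<or> \<beta> \<in> \<Delta>"
    proof (rule ccontr)
      assume "\<not> (\<alpha> \<in> \<Delta> \<or> \<beta> \<in> \<Delta>)"
      then have "proves ar (insert \<alpha> \<Delta>) \<chi>" "proves ar (insert \<beta> \<Delta>) \<chi>" using mem L by auto
      moreover have "proves ar \<Delta> (\<alpha> \<^bold>\<or> \<beta>)"
        using ab abL by (intro proves.Assumption) (auto simp: lang_def)
      ultimately show False using con proves.DisjE by blast
    qed
  next
    fix \<psi> assume ex: "Exists \<psi> \<in> \<Delta>"
    then have "Exists \<psi> \<in> ?L" using sub by blast
    then obtain n where n: "Exists \<psi> = \<phi> n" using \<phi>_surj[of "Exists \<psi>"] by blast
    \<comment> \<open>The formula may have entered before stage \<open>n\<close>, which supplies its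
      witness; that stage does not reject it, since \<open>\<chi>\<close> is not derivable.\<close>
    have "\<not> proves ar (insert (\<phi> n) (f n)) \<chi>"
    proof
      assume "proves ar (insert (\<phi> n) (f n)) \<chi>"
      then have "proves ar \<Delta> \<chi>" by (rule proves_mono) (use ex n in \<open>auto simp: \<Delta>_def\<close>)
      then show False using con by simp
    qed
    then have "\<exists>d\<in>V. inst [d] 0 \<psi> \<in> f (Suc n)" using Q[of n] n by (auto simp: Q_def)
    then show "\<exists>d\<in>V. inst [d] 0 \<psi> \<in> \<Delta>" by (auto simp: \<Delta>_def)
  qed (rule sub)
  moreover have "\<chi> \<notin> \<Delta>"
    using con \<chi> by (auto simp: lang_def intro: proves.Assumption)
  moreover have "\<Gamma> \<subseteq> \<Delta>" using P[of 0] by (auto simp: P_def \<Delta>_def)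
  ultimately show ?thesis using that by blast
qed


section \<open>Hereditarily countable sets\<close>

definition el :: "hc \<Rightarrow> hc set" where
  "el x = {y. hc_mem y x}"

text \<open>Meaningful for countable \<open>S\<close> only; later this mostly comes from
  \<open>S\<close> being a subset of the countable model or of some \<open>el x\<close>.\<close>

definition mk :: "hc set \<Rightarrow> hc" where
  "mk S = HC (acset S)"

lemma hc_mem_iff: "hc_mem x y \<longleftrightarrow> x \<in> el y"
  by (simp add: el_def)

lemma el_eq_rcset: "el x = rcset (elems x)"
  by (auto simp: el_def hc_mem_def cin.rep_eq)

lemma countable_el [simp]: "countable (el x)"
  using rcset by (simp add: el_eq_rcset)

lemma el_mk [simp]: "countable S \<Longrightarrow> el (mk S) = S"
  by (simp add: el_eq_rcset mk_def acset_inverse)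

lemma el_inject: "el x = el y \<longleftrightarrow> x = y"
  by (metis el_eq_rcset hc.expand rcset_inject)

lemma hc_eqI: "(\<And>z. z \<in> el x \<longleftrightarrow> z \<in> el y) \<Longrightarrow> x = y"
  using el_inject by blast

text \<open>Membership is well-founded because \<open>hc\<close> is a datatype.\<close>

lemma hc_induct [case_names mem]: "(\<And>x. (\<And>y. y \<in> el x \<Longrightarrow> P y) \<Longrightarrow> P x) \<Longrightarrow> P x"
proof (induction x rule: hc.induct)
  case (HC A)
  have "P y" if "y \<in> el (HC A)" for y
  proof (rule HC.IH)
    show "y \<in> rcset A" using that by (simp add: el_eq_rcset)
  qed (rule HC.prems)
  then show ?case by (rule HC.prems)
qed

lemma mem_irrefl: "x \<notin> el x"
  by (induction x rule: hc_induct) blast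

lemma mem_asym: "x \<in> el y \<Longrightarrow> y \<notin> el x"
  by (induction x arbitrary: y rule: hc_induct) blast

definition emp :: hc where "emp = mk {}"
definition upair :: "hc \<Rightarrow> hc \<Rightarrow> hc" where "upair x y = mk {x, y}"
definition opair :: "hc \<Rightarrow> hc \<Rightarrow> hc" where "opair x y = upair (upair x x) (upair x y)"
definition succ :: "hc \<Rightarrow> hc" where "succ x = mk (insert x (el x))"

primrec num :: "nat \<Rightarrow> hc" where
  "num 0 = emp"
| "num (Suc n) = succ (num n)"

definition omega :: hc where "omega = mk (range num)"

lemma el_emp [simp]: "el emp = {}" by (simp add: emp_def)
lemma el_upair [simp]: "el (upair x y) = {x, y}" by (simp add: upair_def)
lemma el_succ [simp]: "el (succ x) = insert x (el x)" by (simp add: succ_def)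
lemma el_omega [simp]: "el omega = range num" by (simp add: omega_def)
lemma el_opair: "el (opair x y) = {upair x x, upair x y}" by (simp add: opair_def)

lemma upair_eq_iff: "upair x y = upair x' y' \<longleftrightarrow> x = x' \<and> y = y' \<or> x = y' \<and> y = x'"
  unfolding el_inject[symmetric] el_upair doubleton_eq_iff by simp

lemma opair_inject [simp]: "opair x y = opair x' y' \<longleftrightarrow> x = x' \<and> y = y'"
  unfolding opair_def upair_eq_iff by auto

lemma succ_not_emp [simp]: "succ x \<noteq> emp" "emp \<noteq> succ x"
  by (metis el_emp el_succ insert_not_empty)+

lemma succ_inject [simp]: "succ x = succ y \<longleftrightarrow> x = y"
proof
  assume eq: "succ x = succ y"
  then have "insert x (el x) = insert y (el y)" by (metis el_succ)
  then have "x = y \<or> x \<in> el y" "y = x \<or> y \<in> el x" by auto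
  then show "x = y" using mem_asym[of x y] by auto
qed simp

lemma el_num: "el (num n) = num ` {..<n}"
  by (induction n) (auto simp: lessThan_Suc)

lemma num_inject [simp]: "num m = num n \<longleftrightarrow> m = n"
proof (induction m arbitrary: n)
  case 0 then show ?case by (cases n) auto
next
  case (Suc m) then show ?case by (cases n) auto
qed


text \<open>The quantifiers on the right are bounded, so the condition means the same in every
  transitive domain. Well-foundedness turns the predecessor clause into minimality.\<close>

lemma eq_omega_iff: "x = omega \<longleftrightarrow> emp \<in> el x \<and> (\<forall>y\<in>el x. succ y \<in> el x) \<and>
    (\<forall>y\<in>el x. y = emp \<or> (\<exists>z\<in>el x. y = succ z))"
proof
  assume "x = omega"
  then show "emp \<in> el x \<and> (\<forall>y\<in>el x. succ y \<in> el x) \<and> (\<forall>y\<in>el x. y = emp \<or> (\<exists>z\<in>el x. y = succ z))"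
    by (auto simp: image_iff intro: exI[of _ 0] exI[of _ "Suc n" for n])
       (metis num.simps not0_implies_Suc)+
next
  assume x: "emp \<in> el x \<and> (\<forall>y\<in>el x. succ y \<in> el x) \<and> (\<forall>y\<in>el x. y = emp \<or> (\<exists>z\<in>el x. y = succ z))"
  have "num n \<in> el x" for n using x by (induction n) auto
  moreover have "y \<in> el x \<Longrightarrow> y \<in> range num" for y
  proof (induction y rule: hc_induct)
    case (mem y)
    then consider "y = emp" | z where "z \<in> el x" "y = succ z" using x by blast
    then show ?case
    proof cases
      case 2
      then obtain n where "z = num n" using mem by auto
      then show ?thesis using 2 by (intro range_eqI[of _ _ "Suc n"]) simp
    qed (auto intro: range_eqI[of _ _ 0])
  qed
  ultimately show "x = omega" by (intro hc_eqI) auto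
qed

text \<open>A bounded condition for being a numeral that does not mention \<open>omega\<close>; it
  serves to cut \<open>omega\<close> out of an inductive set.\<close>

lemma range_num_iff: "y \<in> range num \<longleftrightarrow> (\<forall>u\<in>el (succ y). u = emp \<or> (\<exists>z\<in>el u. u = succ z))"
proof
  assume "y \<in> range num"
  then obtain n where "y = num n" by blast
  then have "el (succ y) = num ` {..n}" using el_num[of "Suc n"] by (simp add: lessThan_Suc_atMost)
  moreover have "num k = emp \<or> (\<exists>z\<in>el (num k). num k = succ z)" for k by (cases k) auto
  ultimately show "\<forall>u\<in>el (succ y). u = emp \<or> (\<exists>z\<in>el u. u = succ z)" by auto
next
  show "\<forall>u\<in>el (succ y). u = emp \<or> (\<exists>z\<in>el u. u = succ z) \<Longrightarrow> y \<in> range num"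
  proof (induction y rule: hc_induct)
    case (mem y)
    then consider "y = emp" | z where "z \<in> el y" "y = succ z" by auto
    then show ?case
    proof cases
      case 2
      have "\<forall>u\<in>el (succ z). u = emp \<or> (\<exists>z\<in>el u. u = succ z)" using mem.prems 2(2) by simp
      then obtain n where "z = num n" using mem.IH[OF 2(1)] by blast
      then show ?thesis using 2 by (intro range_eqI[of _ _ "Suc n"]) simp
    qed (auto intro: range_eqI[of _ _ 0])
  qed
qed

text \<open>A record of stages and values in a run of the recursion
  \<open>i \<mapsto> (G ^^ i) x\<close>. Justification of each pair by an earlier one already
  determines the value at every numeral.\<close>

definition trace :: "(hc \<Rightarrow> hc) \<Rightarrow> hc \<Rightarrow> hc \<Rightarrow> bool" where
  "trace G x s \<longleftrightarrow>
     (\<forall>u\<in>el s. u = opair emp x \<or> (\<exists>i y. opair i y \<in> el s \<and> u = opair (succ i) (G y)))"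

lemma trace_value: "trace G x s \<Longrightarrow> opair (num n) z \<in> el s \<Longrightarrow> z = (G ^^ n) x"
proof (induction n arbitrary: z)
  case 0
  then show ?case by (auto simp: trace_def)
next
  case (Suc n)
  then obtain y where "opair (num n) y \<in> el s" "z = G y" by (fastforce simp: trace_def)
  then show ?case using Suc by simp
qed

lemma trace_of_iterates: "trace G x (mk ((\<lambda>i. opair (num i) ((G ^^ i) x)) ` {..n}))"
proof -
  have "opair (num i) ((G ^^ i) x) = opair emp x \<or>
    (\<exists>j y. (\<exists>k\<le>n. opair j y = opair (num k) ((G ^^ k) x)) \<and>
       opair (num i) ((G ^^ i) x) = opair (succ j) (G y))" if "i \<le> n" for i
  proof (cases i)
    case (Suc k)
    then show ?thesis using that by (intro disjI2 exI[of _ "num k"] exI[of _ "(G ^^ k) x"]) auto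
  qed simp
  then show ?thesis by (auto simp: trace_def image_iff countable_finite)
qed


section \<open>Kripke models of set theory with decidable membership\<close>

primrec forces :: "'w set \<Rightarrow> ('w \<Rightarrow> 'w \<Rightarrow> bool) \<Rightarrow> ('w \<Rightarrow> hc set) \<Rightarrow> 'w \<Rightarrow> (nat \<Rightarrow> hc) \<Rightarrow> set_sym fm \<Rightarrow> bool"
  where
  "forces W le D v e (Rel R xs) \<longleftrightarrow>
     (case R of In \<Rightarrow> e (xs ! 0) \<in> el (e (xs ! 1)) | Eq \<Rightarrow> e (xs ! 0) = e (xs ! 1))"
| "forces W le D v e \<^bold>\<bottom> \<longleftrightarrow> False"
| "forces W le D v e (\<phi> \<^bold>\<and> \<psi>) \<longleftrightarrow> forces W le D v e \<phi> \<and> forces W le D v e \<psi>"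
| "forces W le D v e (\<phi> \<^bold>\<or> \<psi>) \<longleftrightarrow> forces W le D v e \<phi> \<or> forces W le D v e \<psi>"
| "forces W le D v e (\<phi> \<^bold>\<longrightarrow> \<psi>) \<longleftrightarrow>
     (\<forall>w\<in>W. le v w \<longrightarrow> forces W le D w e \<phi> \<longrightarrow> forces W le D w e \<psi>)"
| "forces W le D v e (Forall \<phi>) \<longleftrightarrow>
     (\<forall>w\<in>W. le v w \<longrightarrow> (\<forall>a\<in>D w. forces W le D w (case_nat a e) \<phi>))"
| "forces W le D v e (Exists \<phi>) \<longleftrightarrow> (\<exists>a\<in>D v. forces W le D v (case_nat a e) \<phi>)"

text \<open>With satisfaction as the one-world case of forcing, soundness and the calculus of
  absolute predicates serve for \<open>M\<close> and for the frame alike.\<close>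

lemma forces_single: "forces {()} (\<lambda>_ _. True) (\<lambda>_. M) v e \<phi> = satisfies M e \<phi>"
  by (induction \<phi> arbitrary: e) (auto simp: hc_mem_iff split: set_sym.split)

lemma lift_env: "case_nat a e \<circ> case_nat 0 (Suc \<circ> f) = case_nat a (e \<circ> f)"
  by (auto split: nat.splits)

lemma length_2D: "length xs = 2 \<Longrightarrow> \<exists>x y. xs = [x, y]"
  by (auto simp: numeral_2_eq_2 length_Suc_conv)

lemma forces_rename:
  "well_formed set_ar \<phi> \<Longrightarrow> forces W le D v e (rename f \<phi>) = forces W le D v (e \<circ> f) \<phi>"
proof (induction \<phi> arbitrary: v e f)
  case (Rel R xs)
  then show ?case by (auto simp: set_ar_def dest!: length_2D split: set_sym.split)
qed (simp_all add: lift_env)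

lemma satisfies_rename:
  "well_formed set_ar \<phi> \<Longrightarrow> satisfies M e (rename f \<phi>) = satisfies M (e \<circ> f) \<phi>"
  using forces_rename[of \<phi> "{()}" "\<lambda>_ _. True" "\<lambda>_. M"] by (simp add: forces_single)

definition append_env :: "hc list \<Rightarrow> (nat \<Rightarrow> hc) \<Rightarrow> nat \<Rightarrow> hc" (infixr "@@" 65) where
  "(cs @@ e) n = (if n < length cs then cs ! n else e (n - length cs))"

lemma append_env_simps [simp]:
  "[] @@ e = e" "(c # cs) @@ e = case_nat c (cs @@ e)"
  by (auto simp: append_env_def fun_eq_iff split: nat.split)

lemma append_env_inst:
  "(\<lambda>i. if i < length xs then e (xs ! i) else e (i - length xs + k)) = map e xs @@ (\<lambda>i. e (i + k))"
  by (auto simp: append_env_def)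

locale kripke =
  fixes W :: "'w set" and le :: "'w \<Rightarrow> 'w \<Rightarrow> bool" and D :: "'w \<Rightarrow> hc set"
  assumes le_refl: "v \<in> W \<Longrightarrow> le v v"
    and le_trans: "u \<in> W \<Longrightarrow> v \<in> W \<Longrightarrow> w \<in> W \<Longrightarrow> le u v \<Longrightarrow> le v w \<Longrightarrow> le u w"
    and D_mono: "v \<in> W \<Longrightarrow> w \<in> W \<Longrightarrow> le v w \<Longrightarrow> D v \<subseteq> D w"
begin

abbreviation frc ("_,_ \<tturnstile> _" [60, 60, 60] 50) where
  "frc v e \<phi> \<equiv> forces W le D v e \<phi>"

definition env :: "'w \<Rightarrow> (nat \<Rightarrow> hc) \<Rightarrow> bool" where
  "env v e \<longleftrightarrow> v \<in> W \<and> range e \<subseteq> D v"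

lemma env_mono: "env v e \<Longrightarrow> w \<in> W \<Longrightarrow> le v w \<Longrightarrow> env w e"
  unfolding env_def using D_mono by blast

lemma env_case: "env v e \<Longrightarrow> a \<in> D v \<Longrightarrow> env v (case_nat a e)"
  unfolding env_def by (auto simp: image_subset_iff split: nat.split)

lemma env_nth: "env v e \<Longrightarrow> e i \<in> D v"
  by (auto simp: env_def)

lemma env_comp: "env v e \<Longrightarrow> env v (\<lambda>i. e (f i))"
  by (auto simp: env_def)

lemma frc_mono: "v, e \<tturnstile> \<phi> \<Longrightarrow> v \<in> W \<Longrightarrow> w \<in> W \<Longrightarrow> le v w \<Longrightarrow> w, e \<tturnstile> \<phi>"
proof (induction \<phi> arbitrary: v w e)
  case (Impl \<phi> \<psi>)
  then show ?case using le_trans[of v w] by (simp only: forces.simps) blast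
next
  case (Forall \<phi>)
  then show ?case using le_trans[of v w] by (simp only: forces.simps) blast
next
  case (Exists \<phi>)
  then show ?case using D_mono[of v w] by (simp only: forces.simps) blast
qed auto

lemma frc_inst:
  assumes "well_formed set_ar \<phi>"
  shows "v, e \<tturnstile> inst xs k \<phi> \<longleftrightarrow> v, (map e xs @@ (\<lambda>i. e (i + k))) \<tturnstile> \<phi>"
  unfolding inst_def forces_rename[OF assms] append_env_inst[symmetric] comp_def
  by (rule arg_cong[where f = "\<lambda>e. v, e \<tturnstile> \<phi>"]) auto

lemma frc_weaken: "well_formed set_ar \<phi> \<Longrightarrow> v, case_nat a e \<tturnstile> inst [] 1 \<phi> \<longleftrightarrow> v, e \<tturnstile> \<phi>"
  by (simp add: frc_inst)

lemma frc_inst_one: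
  "well_formed set_ar \<phi> \<Longrightarrow> v, e \<tturnstile> inst [t] 0 \<phi> \<longleftrightarrow> v, case_nat (e t) e \<tturnstile> \<phi>"
  by (simp add: frc_inst)

text \<open>Only well-formed hypotheses have to be forced: \<open>Assumption\<close> uses no others,
  and forcing respects renaming on these.\<close>

lemma soundness:
  assumes "proves set_ar \<Gamma> \<phi>"
  shows "env v e \<Longrightarrow> \<forall>\<gamma>\<in>\<Gamma>. well_formed set_ar \<gamma> \<longrightarrow> v, e \<tturnstile> \<gamma> \<Longrightarrow> v, e \<tturnstile> \<phi>"
  using assms
proof (induction arbitrary: v e rule: proves.induct)
  case (DisjE \<Gamma> \<phi> \<psi> \<chi>)
  show ?case using DisjE.IH(1)[OF DisjE.prems] DisjE.IH(2,3)[OF DisjE.prems(1)] DisjE.prems(2) by auto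
next
  case (ImplI \<phi> \<Gamma> \<psi>)
  show ?case
    unfolding forces.simps
  proof (intro ballI impI)
    fix w assume w: "w \<in> W" "le v w" "w, e \<tturnstile> \<phi>"
    have "v \<in> W" using ImplI.prems by (simp add: env_def)
    then show "w, e \<tturnstile> \<psi>"
      using ImplI.prems(2) w by (intro ImplI.IH env_mono[OF ImplI.prems(1)]) (auto intro: frc_mono)
  qed
next
  case (ImplE \<Gamma> \<phi> \<psi>)
  then have "v \<in> W" "le v v" by (auto simp: env_def le_refl)
  then show ?case using ImplE.IH[OF ImplE.prems] by auto
next
  case (ForallI \<Gamma> \<phi>)
  show ?case
    unfolding forces.simps
  proof (intro ballI impI)
    fix w a assume w: "w \<in> W" "le v w" "a \<in> D w"
    have v: "v \<in> W" using ForallI.prems by (simp add: env_def)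
    have "w, case_nat a e \<tturnstile> inst [] 1 \<gamma>" if "\<gamma> \<in> \<Gamma>" "well_formed set_ar \<gamma>" for \<gamma>
      using frc_mono[of v e \<gamma> w] ForallI.prems(2) that v w unfolding frc_weaken[OF that(2)] by blast
    then show "w, case_nat a e \<tturnstile> \<phi>"
      by (intro ForallI.IH env_case[OF env_mono[OF ForallI.prems(1)]] w) auto
  qed
next
  case (ForallE \<Gamma> \<phi> t)
  then have v: "v \<in> W" "le v v" "e t \<in> D v" by (auto simp: env_def le_refl)
  have wf: "well_formed set_ar \<phi>" using proves_well_formed[OF ForallE.hyps] by simp
  show ?case using ForallE.IH[OF ForallE.prems] v by (simp add: frc_inst_one[OF wf])
next
  case (ExistsI \<Gamma> t \<phi>)
  then have v: "e t \<in> D v" by (auto simp: env_def)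
  have wf: "well_formed set_ar \<phi>" using proves_well_formed[OF ExistsI.hyps] by simp
  show ?case using ExistsI.IH[OF ExistsI.prems] v by (auto simp: frc_inst_one[OF wf])
next
  case (ExistsE \<Gamma> \<phi> \<psi>)
  have wf: "well_formed set_ar \<psi>" using proves_well_formed[OF ExistsE.hyps(2)] by simp
  obtain a where a: "a \<in> D v" "v, case_nat a e \<tturnstile> \<phi>"
    using ExistsE.IH(1)[OF ExistsE.prems] by auto
  have "v, case_nat a e \<tturnstile> inst [] 1 \<gamma>" if "\<gamma> \<in> \<Gamma>" "well_formed set_ar \<gamma>" for \<gamma>
    using ExistsE.prems(2) that unfolding frc_weaken[OF that(2)] by blast
  then have "v, case_nat a e \<tturnstile> inst [] 1 \<psi>"
    using a by (intro ExistsE.IH(2) env_case[OF ExistsE.prems(1)]) auto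
  then show ?case by (simp only: frc_weaken[OF wf])
qed auto

end


section \<open>Absolute predicates\<close>

text \<open>In a one-world model, the absolute predicates are the predicates definable with parameters
  from \<open>C\<close>.\<close>

locale absoluteness = kripke W le D
  for W :: "'w set" and le :: "'w \<Rightarrow> 'w \<Rightarrow> bool" and D :: "'w \<Rightarrow> hc set" +
  fixes C :: "hc set"
  assumes C_sub: "v \<in> W \<Longrightarrow> C \<subseteq> D v"
    and D_trans: "v \<in> W \<Longrightarrow> y \<in> D v \<Longrightarrow> x \<in> el y \<Longrightarrow> x \<in> D v"
    and D_emp: "v \<in> W \<Longrightarrow> emp \<in> D v"
    and D_adj: "v \<in> W \<Longrightarrow> x \<in> D v \<Longrightarrow> y \<in> D v \<Longrightarrow> mk (insert x (el y)) \<in> D v"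
begin

text \<open>One formula works at all worlds, and \<open>P e\<close> does not depend on the world.
  Absolute predicates are therefore decided, and implication and negation act on them
  classically.\<close>

definition absolute :: "((nat \<Rightarrow> hc) \<Rightarrow> bool) \<Rightarrow> bool" where
  "absolute P \<longleftrightarrow> (\<exists>\<phi> cs. well_formed set_ar \<phi> \<and> set cs \<subseteq> C \<and>
     (\<forall>v e. env v e \<longrightarrow> (v, (cs @@ e) \<tturnstile> \<phi> \<longleftrightarrow> P e)))"

text \<open>The value has to lie in every domain that contains the arguments. Where this fails, as
  for \<open>pw\<close> later on, only the graph can be absolute.\<close>

definition absolute_fun :: "((nat \<Rightarrow> hc) \<Rightarrow> hc) \<Rightarrow> bool" where
  "absolute_fun t \<longleftrightarrow> (\<forall>v e. env v e \<longrightarrow> t e \<in> D v) \<and> absolute (\<lambda>e. e 0 = t (\<lambda>i. e (Suc i)))"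

lemma absoluteI:
  assumes "well_formed set_ar \<phi>" "set cs \<subseteq> C" "\<And>v e. env v e \<Longrightarrow> (v, (cs @@ e) \<tturnstile> \<phi>) = P e"
  shows "absolute P"
  using assms unfolding absolute_def by blast

lemma absoluteE:
  assumes "absolute P"
  obtains \<phi> cs where "well_formed set_ar \<phi>" "set cs \<subseteq> C"
    "\<And>v e. env v e \<Longrightarrow> (v, (cs @@ e) \<tturnstile> \<phi>) = P e"
  using assms unfolding absolute_def by blast

lemma absolute_cong:
  assumes "absolute P" "\<And>v e. env v e \<Longrightarrow> Q e = P e" shows "absolute Q"
  using assms(1) by (rule absoluteE) (use assms(2) in \<open>auto intro: absoluteI\<close>)

lemma append_env_left: "(cs @@ e) = ((cs @ ds) @@ e) \<circ> (\<lambda>i. if i < length cs then i else i + length ds)"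
  by (auto simp: append_env_def nth_append)

lemma append_env_right: "(ds @@ e) = ((cs @ ds) @@ e) \<circ> (\<lambda>i. i + length cs)"
  by (auto simp: append_env_def nth_append)

lemma absolute_pairE:
  assumes "absolute P" "absolute Q"
  obtains \<phi> \<psi> cs where "well_formed set_ar \<phi>" "well_formed set_ar \<psi>" "set cs \<subseteq> C"
    "\<And>v e. env v e \<Longrightarrow> (v, (cs @@ e) \<tturnstile> \<phi>) = P e"
    "\<And>v e. env v e \<Longrightarrow> (v, (cs @@ e) \<tturnstile> \<psi>) = Q e"
proof -
  obtain \<phi> cs where \<phi>: "well_formed set_ar \<phi>" "set cs \<subseteq> C"
    "\<And>v e. env v e \<Longrightarrow> (v, (cs @@ e) \<tturnstile> \<phi>) = P e" using absoluteE[OF assms(1)] by metis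
  obtain \<psi> ds where \<psi>: "well_formed set_ar \<psi>" "set ds \<subseteq> C"
    "\<And>v e. env v e \<Longrightarrow> (v, (ds @@ e) \<tturnstile> \<psi>) = Q e" using absoluteE[OF assms(2)] by metis
  show ?thesis
  proof (rule that)
    show "(v, ((cs @ ds) @@ e) \<tturnstile> rename (\<lambda>i. if i < length cs then i else i + length ds) \<phi>) = P e"
      if "env v e" for v e
      using \<phi>(3)[OF that] by (simp only: forces_rename[OF \<phi>(1)] append_env_left[symmetric])
    show "(v, ((cs @ ds) @@ e) \<tturnstile> rename (\<lambda>i. i + length cs) \<psi>) = Q e" if "env v e" for v e
      using \<psi>(3)[OF that] by (simp only: forces_rename[OF \<psi>(1)] append_env_right[symmetric])
  qed (use \<phi> \<psi> in auto)
qed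

lemma absolute_conj: "absolute P \<Longrightarrow> absolute Q \<Longrightarrow> absolute (\<lambda>e. P e \<and> Q e)"
  by (erule (1) absolute_pairE, rule_tac \<phi> = "\<phi> \<^bold>\<and> \<psi>" in absoluteI) auto

lemma absolute_disj: "absolute P \<Longrightarrow> absolute Q \<Longrightarrow> absolute (\<lambda>e. P e \<or> Q e)"
  by (erule (1) absolute_pairE, rule_tac \<phi> = "\<phi> \<^bold>\<or> \<psi>" in absoluteI) auto

lemma absolute_imp:
  assumes "absolute P" "absolute Q" shows "absolute (\<lambda>e. P e \<longrightarrow> Q e)"
proof -
  obtain \<phi> \<psi> cs where *: "well_formed set_ar \<phi>" "well_formed set_ar \<psi>" "set cs \<subseteq> C"
    "\<And>v e. env v e \<Longrightarrow> (v, (cs @@ e) \<tturnstile> \<phi>) = P e"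
    "\<And>v e. env v e \<Longrightarrow> (v, (cs @@ e) \<tturnstile> \<psi>) = Q e" using absolute_pairE[OF assms] by metis
  show ?thesis
  proof (rule absoluteI)
    show "(v, (cs @@ e) \<tturnstile> (\<phi> \<^bold>\<longrightarrow> \<psi>)) = (P e \<longrightarrow> Q e)" if "env v e" for v e
      using *(4,5)[OF env_mono[OF that]] le_refl[of v] that by (auto simp: env_def)
  qed (use * in auto)
qed

lemma absolute_const: "absolute (\<lambda>_. b)"
  using absoluteI[of "\<^bold>\<bottom> \<^bold>\<longrightarrow> \<^bold>\<bottom>" "[]" "\<lambda>_. True"] absoluteI[of "\<^bold>\<bottom>" "[]" "\<lambda>_. False"]
  by (cases b) auto

lemma absolute_not: "absolute P \<Longrightarrow> absolute (\<lambda>e. \<not> P e)"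
  using absolute_imp[OF _ absolute_const[of False]] by simp

lemma absolute_iff: "absolute P \<Longrightarrow> absolute Q \<Longrightarrow> absolute (\<lambda>e. P e \<longleftrightarrow> Q e)"
  using absolute_conj[OF absolute_imp absolute_imp, of P Q Q P] by (rule absolute_cong) blast+

lemma absolute_rename:
  assumes "absolute P" shows "absolute (\<lambda>e. P (\<lambda>i. e (f i)))"
proof -
  obtain \<phi> cs where \<phi>: "well_formed set_ar \<phi>" "set cs \<subseteq> C"
    "\<And>v e. env v e \<Longrightarrow> (v, (cs @@ e) \<tturnstile> \<phi>) = P e" using absoluteE[OF assms] by metis
  let ?g = "\<lambda>i. if i < length cs then i else f (i - length cs) + length cs"
  have "(cs @@ e) \<circ> ?g = cs @@ (\<lambda>i. e (f i))" for e by (auto simp: append_env_def)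
  then show ?thesis
    using \<phi>(2,3) by (intro absoluteI[of "rename ?g \<phi>" cs]) (auto simp: forces_rename \<phi>(1) env_comp)
qed

lemma absolute_body:
  assumes "absolute (\<lambda>e. P (e 0) (\<lambda>i. e (Suc i)))"
  obtains \<phi> cs where "well_formed set_ar \<phi>" "set cs \<subseteq> C"
    "\<And>v e a. env v e \<Longrightarrow> a \<in> D v \<Longrightarrow> (v, case_nat a (cs @@ e) \<tturnstile> \<phi>) = P a e"
proof -
  obtain \<phi> cs where \<phi>: "well_formed set_ar \<phi>" "set cs \<subseteq> C"
    "\<And>v e. env v e \<Longrightarrow> (v, (cs @@ e) \<tturnstile> \<phi>) = P (e 0) (\<lambda>i. e (Suc i))"
    using absoluteE[OF assms] by metis
  \<comment> \<open>\<open>cs\<close> occupies the first places, so the variable to be quantified is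
    moved from place \<open>length cs\<close> to the front.\<close>
  let ?g = "\<lambda>i. if i < length cs then Suc i else if i = length cs then 0 else i"
  have "case_nat a (cs @@ e) \<circ> ?g = cs @@ case_nat a e" for a e
  proof
    fix i show "(case_nat a (cs @@ e) \<circ> ?g) i = (cs @@ case_nat a e) i"
    proof (cases "i < length cs")
      case False
      then obtain k where "i = length cs + k" using le_Suc_ex not_less by blast
      then show ?thesis by (cases k) (simp_all add: append_env_def)
    qed (simp add: append_env_def)
  qed
  then have "(v, case_nat a (cs @@ e) \<tturnstile> rename ?g \<phi>) = P a e" if "env v e" "a \<in> D v" for v e a
    using \<phi>(3)[OF env_case[OF that]] by (simp add: forces_rename \<phi>(1))
  with \<phi>(1,2) show ?thesis by (intro that[of "rename ?g \<phi>" cs]) auto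
qed

lemma absolute_exI:
  assumes "absolute (\<lambda>e. P (e 0) (\<lambda>i. e (Suc i)))"
    and "\<And>v e. env v e \<Longrightarrow> Q e \<longleftrightarrow> (\<exists>x\<in>D v. P x e)"
  shows "absolute Q"
proof -
  obtain \<phi> cs where "well_formed set_ar \<phi>" "set cs \<subseteq> C"
    "\<And>v e a. env v e \<Longrightarrow> a \<in> D v \<Longrightarrow> (v, case_nat a (cs @@ e) \<tturnstile> \<phi>) = P a e"
    using absolute_body[OF assms(1)] by metis
  then show ?thesis using assms(2) by (intro absoluteI[of "Exists \<phi>" cs]) auto
qed

text \<open>The second hypothesis speaks of every world in which \<open>e\<close> lives, so passing
  to larger domains does not change \<open>Q e\<close>. Bounded quantifiers meet it because the
  members of a set are fixed.\<close>

lemma absolute_allI: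
  assumes "absolute (\<lambda>e. P (e 0) (\<lambda>i. e (Suc i)))"
    and "\<And>v e. env v e \<Longrightarrow> Q e \<longleftrightarrow> (\<forall>x\<in>D v. P x e)"
  shows "absolute Q"
proof -
  obtain \<phi> cs where \<phi>: "well_formed set_ar \<phi>" "set cs \<subseteq> C"
    "\<And>v e a. env v e \<Longrightarrow> a \<in> D v \<Longrightarrow> (v, case_nat a (cs @@ e) \<tturnstile> \<phi>) = P a e"
    using absolute_body[OF assms(1)] by metis
  have "(v, (cs @@ e) \<tturnstile> Forall \<phi>) = Q e" if e: "env v e" for v e
  proof -
    have "v \<in> W" using e by (simp add: env_def)
    moreover have "(w, case_nat a (cs @@ e) \<tturnstile> \<phi>) = P a e" if "w \<in> W" "le v w" "a \<in> D w" for w a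
      using \<phi>(3) env_mono[OF e] that by blast
    moreover have "Q e \<longleftrightarrow> (\<forall>x\<in>D w. P x e)" if "w \<in> W" "le v w" for w
      using assms(2)[OF env_mono[OF e that]] .
    moreover have "le v v" using le_refl \<open>v \<in> W\<close> .
    ultimately show ?thesis by (metis forces.simps(6))
  qed
  then show ?thesis using \<phi> by (intro absoluteI[of "Forall \<phi>" cs]) auto
qed

lemma absolute_var_mem: "absolute (\<lambda>e. e i \<in> el (e j))"
  by (rule absoluteI[of "i \<^bold>\<in> j" "[]"]) (auto simp: append_env_def set_ar_def)

lemma absolute_var_eq: "absolute (\<lambda>e. e i = e j)"
  by (rule absoluteI[of "i \<^bold>= j" "[]"]) (auto simp: append_env_def set_ar_def)

lemma absolute_fun_in: "absolute_fun t \<Longrightarrow> env v e \<Longrightarrow> t e \<in> D v"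
  by (simp add: absolute_fun_def)

lemma absolute_fun_rename:
  assumes "absolute_fun t" shows "absolute_fun (\<lambda>e. t (\<lambda>i. e (f i)))"
  using assms absolute_rename[of "\<lambda>e. e 0 = t (\<lambda>i. e (Suc i))" "case_nat 0 (\<lambda>i. Suc (f i))"]
  by (simp add: absolute_fun_def env_comp)

text \<open>The term is named by an existential quantifier, which the domain can witness because
  \<open>t e\<close> lies in it.\<close>

lemma absolute_subst:
  assumes "absolute_fun t" "absolute (\<lambda>e. P (e 0) (\<lambda>i. e (Suc i)))"
  shows "absolute (\<lambda>e. P (t e) e)"
proof (rule absolute_exI)
  show "absolute (\<lambda>e. e 0 = t (\<lambda>i. e (Suc i)) \<and> P (e 0) (\<lambda>i. e (Suc i)))"
    using assms by (intro absolute_conj) (auto simp: absolute_fun_def)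
qed (use absolute_fun_in[OF assms(1)] in auto)

lemma absolute_subst2:
  assumes "absolute_fun s" "absolute_fun t" "absolute (\<lambda>e. P (e 0) (e 1))"
  shows "absolute (\<lambda>e. P (s e) (t e))"
proof (rule absolute_subst[OF assms(1), where P = "\<lambda>x e. P x (t e)"])
  show "absolute (\<lambda>e. P (e 0) (t (\<lambda>i. e (Suc i))))"
  proof (rule absolute_subst[OF absolute_fun_rename[OF assms(2)], where P = "\<lambda>y e. P (e 0) y"])
    show "absolute (\<lambda>e. P (e (Suc 0)) (e 0))"
      using absolute_rename[OF assms(3), of "case_nat 1 (\<lambda>_. 0)"] by simp
  qed
qed

lemma absolute_mem: "absolute_fun s \<Longrightarrow> absolute_fun t \<Longrightarrow> absolute (\<lambda>e. s e \<in> el (t e))"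
  by (rule absolute_subst2[where P = "\<lambda>x y. x \<in> el y"]) (rule absolute_var_mem | assumption)+

lemma absolute_eq: "absolute_fun s \<Longrightarrow> absolute_fun t \<Longrightarrow> absolute (\<lambda>e. s e = t e)"
  by (rule absolute_subst2[where P = "(=)"]) (rule absolute_var_eq | assumption)+

lemma absolute_fun_var: "absolute_fun (\<lambda>e. e i)"
  unfolding absolute_fun_def by (auto intro: absolute_var_eq env_nth)

lemma absolute_fun_const:
  assumes "c \<in> C" shows "absolute_fun (\<lambda>_. c)"
  unfolding absolute_fun_def
proof
  show "absolute (\<lambda>e. e 0 = c)"
    by (rule absoluteI[of "1 \<^bold>= 0" "[c]"]) (use assms in \<open>auto simp: append_env_def set_ar_def\<close>)
qed (use assms C_sub in \<open>auto simp: env_def\<close>)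

lemma absolute_fun_el:
  assumes "absolute_fun t" "env v e" shows "el (t e) \<subseteq> D v"
  using absolute_fun_in[OF assms] D_trans assms(2) by (auto simp: env_def)

lemma absolute_ball:
  assumes "absolute_fun t" "absolute (\<lambda>e. P (e 0) (\<lambda>i. e (Suc i)))"
  shows "absolute (\<lambda>e. \<forall>x\<in>el (t e). P x e)"
proof (rule absolute_allI)
  show "absolute (\<lambda>e. e 0 \<in> el (t (\<lambda>i. e (Suc i))) \<longrightarrow> P (e 0) (\<lambda>i. e (Suc i)))"
    using assms(2)
    by (rule absolute_imp[OF absolute_mem[OF absolute_fun_var absolute_fun_rename[OF assms(1)]]])
qed (use absolute_fun_el[OF assms(1)] in blast)

lemma absolute_bex:
  assumes "absolute_fun t" "absolute (\<lambda>e. P (e 0) (\<lambda>i. e (Suc i)))"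
  shows "absolute (\<lambda>e. \<exists>x\<in>el (t e). P x e)"
proof (rule absolute_exI)
  show "absolute (\<lambda>e. e 0 \<in> el (t (\<lambda>i. e (Suc i))) \<and> P (e 0) (\<lambda>i. e (Suc i)))"
    using assms(2)
    by (rule absolute_conj[OF absolute_mem[OF absolute_fun_var absolute_fun_rename[OF assms(1)]]])
qed (use absolute_fun_el[OF assms(1)] in blast)

lemma absolute_ex:
  assumes "absolute (\<lambda>e. P (e 0) (\<lambda>i. e (Suc i)))"
    and "\<And>v e x. env v e \<Longrightarrow> P x e \<Longrightarrow> x \<in> D v"
  shows "absolute (\<lambda>e. \<exists>x. P x e)"
  by (rule absolute_exI[OF assms(1)]) (use assms(2) in blast)

lemma absolute_fun_comp:
  assumes "absolute_fun (\<lambda>e. g (e 0))" "absolute_fun t"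
  shows "absolute_fun (\<lambda>e. g (t e))"
  unfolding absolute_fun_def
proof (intro conjI allI impI)
  fix v e assume "env v e"
  then have "env v (\<lambda>_. t e)" using absolute_fun_in[OF assms(2)] by (auto simp: env_def)
  from absolute_fun_in[OF assms(1) this] show "g (t e) \<in> D v" by simp
next
  have "absolute (\<lambda>e. e (Suc 0) = g (e 0))"
    using absolute_rename[of "\<lambda>e. e 0 = g (e 1)" "case_nat 1 (\<lambda>_. 0)"] assms(1)
    by (simp add: absolute_fun_def)
  then show "absolute (\<lambda>e. e 0 = g (t (\<lambda>i. e (Suc i))))"
    by (rule absolute_subst[OF absolute_fun_rename[OF assms(2)], where P = "\<lambda>y e. e 0 = g y"])
qed

lemma absolute_fun_comp2:
  assumes "absolute_fun (\<lambda>e. g (e 0) (e 1))" "absolute_fun s" "absolute_fun t"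
  shows "absolute_fun (\<lambda>e. g (s e) (t e))"
  unfolding absolute_fun_def
proof (intro conjI allI impI)
  fix v e assume "env v e"
  then have "env v (case_nat (s e) (\<lambda>_. t e))"
    using absolute_fun_in[OF assms(2)] absolute_fun_in[OF assms(3)]
    by (auto simp: env_def split: nat.splits)
  from absolute_fun_in[OF assms(1) this] show "g (s e) (t e) \<in> D v" by simp
next
  have g: "absolute (\<lambda>e. e 2 = g (e 0) (e 1))"
    using absolute_rename[of "\<lambda>e. e 0 = g (e 1) (e (Suc (Suc 0)))" "case_nat 2 (case_nat 0 (\<lambda>_. 1))"] assms(1)
    by (simp add: absolute_fun_def)
  have "absolute (\<lambda>e. e 1 = g (e 0) (t (\<lambda>i. e (Suc (Suc i)))))"
  proof (rule absolute_subst[OF absolute_fun_rename[OF assms(3)], where P = "\<lambda>y e. e 1 = g (e 0) y"])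
    show "absolute (\<lambda>e. e (Suc 1) = g (e (Suc 0)) (e 0))"
      using absolute_rename[OF g, of "case_nat 1 (case_nat 0 (\<lambda>_. 2))"]
      by (simp add: numeral_2_eq_2)
  qed
  then have "absolute (\<lambda>e. e (Suc 0) = g (e 0) (t (\<lambda>i. e (Suc (Suc i)))))" by simp
  then show "absolute (\<lambda>e. e 0 = g (s (\<lambda>i. e (Suc i))) (t (\<lambda>i. e (Suc i))))"
    by (rule absolute_subst[OF absolute_fun_rename[OF assms(2)],
          where P = "\<lambda>y e. e 0 = g y (t (\<lambda>i. e (Suc i)))"])
qed

lemma absolute_funI:
  assumes "\<And>v e. env v e \<Longrightarrow> t e \<in> D v" "absolute P"
    and "\<And>v e. env v e \<Longrightarrow> (e 0 = t (\<lambda>i. e (Suc i))) \<longleftrightarrow> P e"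
  shows "absolute_fun t"
  unfolding absolute_fun_def using assms by (auto intro: absolute_cong)

lemmas absolute_intros =
  absolute_conj absolute_disj absolute_imp absolute_not absolute_iff absolute_const
  absolute_ball absolute_bex absolute_mem absolute_eq absolute_fun_var

lemma finite_in_D: "finite S \<Longrightarrow> v \<in> W \<Longrightarrow> S \<subseteq> D v \<Longrightarrow> mk S \<in> D v"
proof (induction S rule: finite_induct)
  case empty
  then show ?case using D_emp by (simp add: emp_def)
next
  case (insert x S)
  then show ?case using D_adj[of v x "mk S"] by (simp add: countable_finite)
qed

lemma upair_in_D: "v \<in> W \<Longrightarrow> x \<in> D v \<Longrightarrow> y \<in> D v \<Longrightarrow> upair x y \<in> D v"
  unfolding upair_def by (intro finite_in_D) auto

lemma opair_in_D: "v \<in> W \<Longrightarrow> x \<in> D v \<Longrightarrow> y \<in> D v \<Longrightarrow> opair x y \<in> D v"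
  unfolding opair_def by (intro upair_in_D)

lemma opair_components:
  assumes "v \<in> W" "opair x y \<in> D v" shows "x \<in> D v" "y \<in> D v"
proof -
  have "upair x y \<in> D v" using D_trans[OF assms] by (simp add: el_opair)
  then show "x \<in> D v" "y \<in> D v" using D_trans[OF assms(1)] by auto
qed

lemma opair_mem_in_D:
  assumes "opair x y \<in> el s" "s \<in> D v" "v \<in> W" shows "x \<in> D v" "y \<in> D v"
  using opair_components[OF assms(3) D_trans[OF assms(3,2,1)]] by auto

lemma env_opair:
  assumes "e i = opair x y" "v \<in> W" "range e \<subseteq> D v" shows "x \<in> D v" "y \<in> D v"
  using opair_components[of v x y] assms(2,3) range_subsetD[OF assms(3), of i] assms(1) by simp_all

lemma succ_in_D: "v \<in> W \<Longrightarrow> x \<in> D v \<Longrightarrow> succ x \<in> D v"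
  unfolding succ_def by (rule D_adj)

lemma num_in_D: "v \<in> W \<Longrightarrow> num n \<in> D v"
  by (induction n) (auto intro: D_emp succ_in_D)

lemma absolute_fun_emp: "absolute_fun (\<lambda>_. emp)"
proof (rule absolute_funI)
  show "absolute (\<lambda>e. \<forall>x\<in>el (e 0). False)" by (intro absolute_intros)
  show "(e 0 = emp) = (\<forall>x\<in>el (e 0). False)" for e :: "nat \<Rightarrow> hc"
    by (metis el_emp el_inject empty_iff equals0I)
qed (auto simp: env_def D_emp)

lemma absolute_fun_upair:
  assumes "absolute_fun s" "absolute_fun t" shows "absolute_fun (\<lambda>e. upair (s e) (t e))"
proof (rule absolute_fun_comp2[OF _ assms], rule absolute_funI)
  show "absolute (\<lambda>e. e 1 \<in> el (e 0) \<and> e 2 \<in> el (e 0) \<and> (\<forall>x\<in>el (e 0). x = e 1 \<or> x = e 2))"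
    by (intro absolute_intros)
  show "(e 0 = upair (e (Suc 0)) (e (Suc 1))) =
    (e 1 \<in> el (e 0) \<and> e 2 \<in> el (e 0) \<and> (\<forall>x\<in>el (e 0). x = e 1 \<or> x = e 2))" for e :: "nat \<Rightarrow> hc"
    unfolding el_inject[of "e 0", symmetric] by (auto simp: numeral_2_eq_2)
qed (auto simp: env_nth env_def intro!: upair_in_D)

lemma absolute_fun_opair:
  "absolute_fun s \<Longrightarrow> absolute_fun t \<Longrightarrow> absolute_fun (\<lambda>e. opair (s e) (t e))"
  unfolding opair_def by (intro absolute_fun_upair)

lemma absolute_fun_succ:
  assumes "absolute_fun t" shows "absolute_fun (\<lambda>e. succ (t e))"
proof (rule absolute_fun_comp[OF _ assms], rule absolute_funI)
  show "absolute (\<lambda>e. e 1 \<in> el (e 0) \<and> (\<forall>x\<in>el (e 1). x \<in> el (e 0)) \<and>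
      (\<forall>x\<in>el (e 0). x = e 1 \<or> x \<in> el (e 1)))"
    by (intro absolute_intros)
  show "(e 0 = succ (e (Suc 0))) = (e 1 \<in> el (e 0) \<and> (\<forall>x\<in>el (e 1). x \<in> el (e 0)) \<and>
      (\<forall>x\<in>el (e 0). x = e 1 \<or> x \<in> el (e 1)))" for e :: "nat \<Rightarrow> hc"
    unfolding el_inject[of "e 0", symmetric] by auto
qed (auto simp: env_nth env_def intro!: succ_in_D)

lemma absolute_fun_num: "absolute_fun (\<lambda>_. num n)"
  by (induction n) (auto intro: absolute_fun_emp absolute_fun_succ)

lemmas absolute_fun_basic_intros = absolute_fun_emp absolute_fun_upair absolute_fun_opair
  absolute_fun_succ absolute_fun_num

lemma absolute_subst_env:
  assumes "absolute_fun t" "absolute P" shows "absolute (\<lambda>e. P (case_nat (t e) e))"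
proof (rule absolute_subst[OF assms(1), where P = "\<lambda>x e. P (case_nat x e)"])
  have "case_nat (e 0) (\<lambda>i. e (Suc i)) = e" for e :: "nat \<Rightarrow> hc"
    by (auto split: nat.splits)
  then show "absolute (\<lambda>e. P (case_nat (e 0) (\<lambda>i. e (Suc i))))" using assms(2) by simp
qed

lemma absolute_subst3:
  assumes "absolute_fun r" "absolute_fun s" "absolute_fun t" "absolute (\<lambda>e. P (e 0) (e 1) (e 2))"
  shows "absolute (\<lambda>e. P (r e) (s e) (t e))"
proof -
  have "absolute (\<lambda>e. P (e (Suc 0)) (e (Suc (Suc 0))) (e 0))"
    using absolute_rename[OF assms(4), of "case_nat 1 (case_nat 2 (\<lambda>_. 0))"]
    by (simp add: numeral_2_eq_2)
  from absolute_subst_env[OF absolute_fun_rename[OF assms(3), of "\<lambda>i. i + 2"] this]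
  have "absolute (\<lambda>e. P (e 0) (e 1) (t (\<lambda>i. e (i + 2))))" by simp
  then have "absolute (\<lambda>e. P (e (Suc 0)) (e 0) (t (\<lambda>i. e (Suc (Suc i)))))"
    using absolute_rename[of "\<lambda>e. P (e 0) (e 1) (t (\<lambda>i. e (i + 2)))"
        "case_nat 1 (case_nat 0 (\<lambda>i. Suc (Suc i)))"] by simp
  from absolute_subst_env[OF absolute_fun_rename[OF assms(2), of Suc] this]
  have "absolute (\<lambda>e. P (e 0) (s (\<lambda>i. e (Suc i))) (t (\<lambda>i. e (Suc i))))" by simp
  from absolute_subst_env[OF assms(1) this] show ?thesis by simp
qed

end

locale absoluteness_omega = absoluteness W le D C
  for W :: "'w set" and le :: "'w \<Rightarrow> 'w \<Rightarrow> bool" and D :: "'w \<Rightarrow> hc set" and C :: "hc set" +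
  assumes D_omega: "v \<in> W \<Longrightarrow> omega \<in> D v"
begin

lemma absolute_fun_omega: "absolute_fun (\<lambda>_. omega)"
proof (rule absolute_funI)
  show "absolute (\<lambda>e. emp \<in> el (e 0) \<and> (\<forall>y\<in>el (e 0). succ y \<in> el (e 0)) \<and>
    (\<forall>y\<in>el (e 0). y = emp \<or> (\<exists>z\<in>el (e 0). y = succ z)))"
    by (intro absolute_intros absolute_fun_emp absolute_fun_succ)
qed (auto simp: env_def D_omega eq_omega_iff)

lemmas absolute_fun_intros = absolute_fun_basic_intros absolute_fun_omega

text \<open>The recursion is expressed by the existence of a trace. A trace up to a numeral is
  finite, hence in every domain containing its values. \<open>closed\<close> asks for these values
  only when the last one is present, because iterating \<open>pw\<close> can lead out of a
  domain.\<close>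

lemma absolute_iterate:
  assumes graph: "absolute (\<lambda>e. e 0 = G (e 1))"
    and closed: "\<And>v x n i. v \<in> W \<Longrightarrow> x \<in> D v \<Longrightarrow> (G ^^ n) x \<in> D v \<Longrightarrow> i \<le> n \<Longrightarrow> (G ^^ i) x \<in> D v"
    and "absolute_fun m" "absolute_fun z" "absolute_fun x"
  shows "absolute (\<lambda>e. \<exists>n. m e = num n \<and> z e = (G ^^ n) (x e))"
proof (rule absolute_subst3[OF assms(3-5), where P = "\<lambda>m z x. \<exists>n. m = num n \<and> z = (G ^^ n) x"],
       rule absolute_exI)
  \<comment> \<open>\<open>trace\<close> with \<open>G\<close> replaced by its graph, because
    \<open>G y\<close> need not lie in the domain.\<close>
  let ?tr = "\<lambda>x s. \<forall>u\<in>el s. u = opair emp x \<or>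
    (\<exists>i y w. (opair i y \<in> el s \<and> u = opair (succ i) w) \<and> w = G y)"
  have G: "absolute (\<lambda>e. e i = G (e j))" for i j
    using absolute_rename[OF graph, of "case_nat i (\<lambda>_. j)"] by simp
  have "absolute (\<lambda>e. (e 1 \<in> el omega \<and> opair (e 1) (e 2) \<in> el (e 0)) \<and> ?tr (e 3) (e 0))"
    by (intro G absolute_intros absolute_fun_intros absolute_ex)
      (auto simp: env_def dest: D_trans opair_mem_in_D env_opair)
  then show "absolute (\<lambda>e. (e (Suc 0) \<in> el omega \<and> opair (e (Suc 0)) (e (Suc 1)) \<in> el (e 0)) \<and>
      ?tr (e (Suc 2)) (e 0))"
    by (simp add: numeral_2_eq_2 numeral_3_eq_3)
  fix v e assume e: "env v e"
  show "(\<exists>n. e 0 = num n \<and> e 1 = (G ^^ n) (e 2)) \<longleftrightarrow>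
    (\<exists>s\<in>D v. (e 0 \<in> el omega \<and> opair (e 0) (e 1) \<in> el s) \<and> ?tr (e 2) s)"
  proof
    assume "\<exists>n. e 0 = num n \<and> e 1 = (G ^^ n) (e 2)"
    then obtain n where n: "e 0 = num n" "e 1 = (G ^^ n) (e 2)" by blast
    have "v \<in> W" "e 2 \<in> D v" "(G ^^ n) (e 2) \<in> D v" using e n(2)[symmetric] by (auto simp: env_def)
    then have "mk ((\<lambda>i. opair (num i) ((G ^^ i) (e 2))) ` {..n}) \<in> D v"
      using closed by (intro finite_in_D) (auto intro!: opair_in_D num_in_D)
    then show "\<exists>s\<in>D v. (e 0 \<in> el omega \<and> opair (e 0) (e 1) \<in> el s) \<and> ?tr (e 2) s"
      using n trace_of_iterates[of G "e 2" n] unfolding trace_def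
      by (intro bexI[of _ "mk ((\<lambda>i. opair (num i) ((G ^^ i) (e 2))) ` {..n})"])
         (auto simp: countable_finite)
  next
    assume "\<exists>s\<in>D v. (e 0 \<in> el omega \<and> opair (e 0) (e 1) \<in> el s) \<and> ?tr (e 2) s"
    then obtain s n where "e 0 = num n" "opair (num n) (e 1) \<in> el s" "trace G (e 2) s"
      unfolding trace_def by auto
    then show "\<exists>n. e 0 = num n \<and> e 1 = (G ^^ n) (e 2)" using trace_value by blast
  qed
qed

end


section \<open>Set theory inside a countable transitive model\<close>

lemma satisfies_foralls:
  assumes "\<And>e. range e \<subseteq> M \<Longrightarrow> satisfies M e ((Forall ^^ n) \<phi>)" "range e \<subseteq> M"
  shows "satisfies M e \<phi>"
  using assms
proof (induction n arbitrary: e)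
  case (Suc n)
  have "satisfies M e' ((Forall ^^ n) \<phi>)" if e': "range e' \<subseteq> M" for e'
  proof -
    have "range (\<lambda>i. e' (Suc i)) \<subseteq> M" using e' by auto
    from Suc.prems(1)[OF this]
    have "satisfies M (case_nat (e' 0) (\<lambda>i. e' (Suc i))) ((Forall ^^ n) \<phi>)" using e' by auto
    moreover have "case_nat (e' 0) (\<lambda>i. e' (Suc i)) = e'" by (auto split: nat.splits)
    ultimately show ?thesis by simp
  qed
  then show ?case using Suc by blast
qed simp

lemma fv_foralls: "fv ((Forall ^^ n) \<phi>) = {i. i + n \<in> fv \<phi>}"
  by (induction n) auto

lemma well_formed_foralls: "well_formed ar ((Forall ^^ n) \<phi>) = well_formed ar \<phi>"
  by (induction n) auto

lemma sentence_closure: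
  assumes "well_formed ar \<phi>" obtains n where "sentence ar ((Forall ^^ n) \<phi>)"
proof -
  obtain n where "\<forall>i\<in>fv \<phi>. i < n" using finite_fv[of \<phi>] by (meson finite_nat_set_iff_bounded)
  then have "sentence ar ((Forall ^^ n) \<phi>)"
    using assms by (force simp: sentence_def fv_foralls well_formed_foralls)
  then show ?thesis using that by blast
qed

locale ctm =
  fixes M :: "hc set"
  assumes ctm: "ctm_of_ZFC M"
begin

lemma countable_M: "countable M" using ctm by (simp add: ctm_of_ZFC_def)

lemma countable_sub: "S \<subseteq> M \<Longrightarrow> countable S" using countable_M countable_subset by blast

lemma M_trans: "y \<in> M \<Longrightarrow> x \<in> el y \<Longrightarrow> x \<in> M"
  using ctm by (auto simp: ctm_of_ZFC_def hc_mem_iff)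

lemma M_sub: "x \<in> M \<Longrightarrow> el x \<subseteq> M"
  using M_trans by blast

lemma M_eqI: "a \<in> M \<Longrightarrow> el b \<subseteq> M \<Longrightarrow> (\<And>u. u \<in> M \<Longrightarrow> u \<in> el a \<longleftrightarrow> u \<in> el b) \<Longrightarrow> a = b"
  by (rule hc_eqI) (use M_sub in blast)

lemma M_eq_iff: "a \<in> M \<Longrightarrow> el b \<subseteq> M \<Longrightarrow> a = b \<longleftrightarrow> (\<forall>u\<in>M. u \<in> el a \<longleftrightarrow> u \<in> el b)"
  using M_eqI[of a b] by blast

lemma zfc: "\<phi> \<in> ZFC \<Longrightarrow> range e \<subseteq> M \<Longrightarrow> satisfies M e \<phi>"
  using ctm by (auto simp: ctm_of_ZFC_def)

lemma zfc_schema: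
  assumes "\<And>n. sentence set_ar ((Forall ^^ n) \<phi>) \<Longrightarrow> (Forall ^^ n) \<phi> \<in> ZFC"
    and "well_formed set_ar \<phi>" "range e \<subseteq> M"
  shows "satisfies M e \<phi>"
  by (rule sentence_closure[OF assms(2)], rule satisfies_foralls[OF _ assms(3)])
    (use assms(1) zfc in blast)

lemma ex_env: obtains e :: "nat \<Rightarrow> hc" where "range e \<subseteq> M"
  using ctm that[of "\<lambda>_. SOME x. x \<in> M"] by (auto simp: ctm_of_ZFC_def some_in_eq)

lemma emp_in_M: "emp \<in> M"
proof -
  obtain e :: "nat \<Rightarrow> hc" where e: "range e \<subseteq> M" using ex_env .
  have "satisfies M e Empty_Set" by (rule zfc[OF _ e]) (simp add: ZFC_def)
  then obtain a where "a \<in> M" "\<forall>x\<in>M. x \<notin> el a"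
    by (auto simp: Empty_Set_def ForallIn_def hc_mem_iff)
  moreover then have "a = emp" by (intro M_eqI) auto
  ultimately show ?thesis by simp
qed

lemma upair_in_M:
  assumes "x \<in> M" "y \<in> M" shows "upair x y \<in> M"
proof -
  obtain e :: "nat \<Rightarrow> hc" where e: "range e \<subseteq> M" using ex_env .
  have "satisfies M e Pairing" by (rule zfc[OF _ e]) (simp add: ZFC_def)
  then have "\<forall>x\<in>M. \<forall>y\<in>M. \<exists>a\<in>M. \<forall>u\<in>M. u \<in> el a \<longleftrightarrow> u = x \<or> u = y"
    by (simp add: Pairing_def hc_mem_iff numeral_2_eq_2 numeral_3_eq_3 iff_conv_conj_imp)
  then obtain a where "a \<in> M" "\<forall>u\<in>M. u \<in> el a \<longleftrightarrow> u = x \<or> u = y" using assms by blast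
  moreover then have "a = upair x y" using assms by (intro M_eqI) auto
  ultimately show ?thesis by simp
qed

lemma opair_in_M: "x \<in> M \<Longrightarrow> y \<in> M \<Longrightarrow> opair x y \<in> M"
  unfolding opair_def by (intro upair_in_M)

lemma union_in_M:
  assumes "x \<in> M" shows "mk (\<Union>y\<in>el x. el y) \<in> M"
proof -
  obtain e :: "nat \<Rightarrow> hc" where e: "range e \<subseteq> M" using ex_env .
  have "satisfies M e Union_Axiom" by (rule zfc[OF _ e]) (simp add: ZFC_def)
  then have "\<forall>x\<in>M. \<exists>a\<in>M. \<forall>u\<in>M. u \<in> el a \<longleftrightarrow> (\<exists>y\<in>M. y \<in> el x \<and> u \<in> el y)"
    by (simp add: Union_Axiom_def hc_mem_iff numeral_2_eq_2 numeral_3_eq_3 iff_conv_conj_imp)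
  then obtain a where "a \<in> M" "\<forall>u\<in>M. u \<in> el a \<longleftrightarrow> (\<exists>y\<in>M. y \<in> el x \<and> u \<in> el y)"
    using assms by blast
  moreover then have "a = mk (\<Union>y\<in>el x. el y)"
    using M_sub M_sub[OF assms] by (intro M_eqI) auto
  ultimately show ?thesis by simp
qed

definition pw :: "hc \<Rightarrow> hc" where
  "pw x = mk {u \<in> M. el u \<subseteq> el x}"

lemma el_pw: "el (pw x) = {u \<in> M. el u \<subseteq> el x}"
  unfolding pw_def by (rule el_mk) (auto intro: countable_sub)

lemma pw_in_M:
  assumes "x \<in> M" shows "pw x \<in> M"
proof -
  obtain e :: "nat \<Rightarrow> hc" where e: "range e \<subseteq> M" using ex_env .
  have "satisfies M e Powerset" by (rule zfc[OF _ e]) (simp add: ZFC_def)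
  then have "\<forall>x\<in>M. \<exists>a\<in>M. \<forall>u\<in>M. u \<in> el a \<longleftrightarrow> (\<forall>y\<in>M. y \<in> el u \<longrightarrow> y \<in> el x)"
    by (simp add: Powerset_def ForallIn_def hc_mem_iff numeral_2_eq_2 numeral_3_eq_3 iff_conv_conj_imp)
  then obtain a where "a \<in> M" "\<forall>u\<in>M. u \<in> el a \<longleftrightarrow> (\<forall>y\<in>M. y \<in> el u \<longrightarrow> y \<in> el x)"
    using assms by blast
  moreover then have "a = pw x" using M_sub by (intro M_eqI) (auto simp: el_pw)
  ultimately show ?thesis by simp
qed

lemma adj_in_M:
  assumes "x \<in> M" "y \<in> M" shows "mk (insert x (el y)) \<in> M"
proof -
  have "mk (\<Union>z\<in>el (upair y (upair x x)). el z) \<in> M" using assms by (intro union_in_M upair_in_M)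
  moreover have "(\<Union>z\<in>el (upair y (upair x x)). el z) = insert x (el y)" by auto
  ultimately show ?thesis by simp
qed

lemma satisfies_is_empty: "e x \<in> M \<Longrightarrow> satisfies M e (is_empty x) \<longleftrightarrow> e x = emp"
  using M_eqI[of "e x" emp] by (auto simp: is_empty_def ForallIn_def hc_mem_iff)

lemma satisfies_is_succ:
  assumes "e s \<in> M" "e x \<in> M" shows "satisfies M e (is_succ s x) \<longleftrightarrow> e s = succ (e x)"
proof -
  have sub: "el (succ (e x)) \<subseteq> M" using assms M_sub by auto
  show ?thesis
    unfolding M_eq_iff[OF assms(1) sub] by (auto simp: is_succ_def hc_mem_iff)
qed

sublocale M: absoluteness "{()}" "\<lambda>_ _. True" "\<lambda>_. M" M
  by unfold_locales (auto intro: M_trans emp_in_M adj_in_M)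

lemma M_env [simp]: "M.env v e \<longleftrightarrow> range e \<subseteq> M"
  by (simp add: M.env_def)

lemma absolute_M_ball:
  "M.absolute (\<lambda>e. P (e 0) (\<lambda>i. e (Suc i))) \<Longrightarrow> M.absolute (\<lambda>e. \<forall>x\<in>M. P x e)"
  by (erule M.absolute_allI) simp

lemma absolute_M_bex:
  "M.absolute (\<lambda>e. P (e 0) (\<lambda>i. e (Suc i))) \<Longrightarrow> M.absolute (\<lambda>e. \<exists>x\<in>M. P x e)"
  by (erule M.absolute_exI) simp

lemmas definable_basic_intros = M.absolute_intros M.absolute_fun_basic_intros absolute_M_ball absolute_M_bex
  M.absolute_fun_const

lemma absolute_M_satisfies:
  assumes "M.absolute P"
  obtains \<phi> cs where "well_formed set_ar \<phi>" "set cs \<subseteq> M"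
    "\<And>e. range e \<subseteq> M \<Longrightarrow> satisfies M (cs @@ e) \<phi> = P e"
  using M.absoluteE[OF assms] by (metis M_env forces_single)

lemma range_append_env: "set cs \<subseteq> M \<Longrightarrow> range e \<subseteq> M \<Longrightarrow> range (cs @@ e) \<subseteq> M"
  by (auto simp: append_env_def subset_iff)

lemma range_case_nat: "x \<in> M \<Longrightarrow> range e \<subseteq> M \<Longrightarrow> range (case_nat x e) \<subseteq> M"
  using M.env_case[of "()" e x] by simp

lemma satisfies_inst:
  "well_formed set_ar \<phi> \<Longrightarrow>
     satisfies M e (inst xs k \<phi>) \<longleftrightarrow> satisfies M (map e xs @@ (\<lambda>i. e (i + k))) \<phi>"
  using M.frc_inst[of \<phi> "()" e xs k] by (simp add: forces_single)

lemma separation: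
  assumes "M.absolute (\<lambda>e. P (e 0))" "a \<in> M" shows "mk {x \<in> el a. P x} \<in> M"
proof -
  obtain \<phi> cs where \<phi>: "well_formed set_ar \<phi>" "set cs \<subseteq> M"
    "\<And>e. range e \<subseteq> M \<Longrightarrow> satisfies M (cs @@ e) \<phi> = P (e 0)"
    using absolute_M_satisfies[OF assms(1)] by metis
  \<comment> \<open>Place 0 is the element and place 1 the ambient set, as \<open>Separation\<close>
    prescribes; the parameters follow.\<close>
  define \<psi> where "\<psi> = rename (\<lambda>i. if i < length cs then i + 2 else 0) \<phi>"
  define e where "e = cs @@ (\<lambda>_. a)"
  have wf: "well_formed set_ar \<psi>" using \<phi> by (simp add: \<psi>_def)
  have e: "range e \<subseteq> M" using \<phi> assms(2) unfolding e_def by (intro range_append_env) auto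
  have val: "satisfies M (case_nat x (case_nat a e)) \<psi> = P x" if "x \<in> M" for x
  proof -
    have "case_nat x (case_nat a e) \<circ> (\<lambda>i. if i < length cs then i + 2 else 0) = cs @@ (\<lambda>_. x)"
      by (auto simp: e_def append_env_def)
    then show ?thesis using \<phi>(3)[of "\<lambda>_. x"] that by (auto simp: \<psi>_def satisfies_rename \<phi>(1))
  qed
  have "satisfies M e (Separation \<psi>)"
  proof (rule zfc_schema[OF _ _ e])
    show "(Forall ^^ n) (Separation \<psi>) \<in> ZFC" if "sentence set_ar ((Forall ^^ n) (Separation \<psi>))" for n
      using that wf by (auto simp: ZFC_def universal_closures_def)
    show "well_formed set_ar (Separation \<psi>)" using wf by (simp add: Separation_def set_ar_def)
  qed
  then have "\<forall>a\<in>M. \<exists>y\<in>M. \<forall>x\<in>M. x \<in> el y \<longleftrightarrow>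
      x \<in> el a \<and> satisfies M (case_nat x (case_nat y (case_nat a e))) (inst [0, 2] 3 \<psi>)"
    by (simp add: Separation_def hc_mem_iff numeral_2_eq_2 iff_conv_conj_imp)
  then obtain y where y: "y \<in> M" "\<forall>x\<in>M. x \<in> el y \<longleftrightarrow>
      x \<in> el a \<and> satisfies M (case_nat x (case_nat y (case_nat a e))) (inst [0, 2] 3 \<psi>)"
    using assms(2) by blast
  then have "x \<in> el y \<longleftrightarrow> x \<in> el a \<and> P x" if "x \<in> M" for x
    using val[OF that] that by (simp add: satisfies_inst[OF wf] numeral_2_eq_2 numeral_3_eq_3)
  then have "y = mk {x \<in> el a. P x}"
    using y M_sub[OF assms(2)]
    by (intro M_eqI) (auto simp: countable_subset[OF _ countable_el[of a]])
  then show ?thesis using y by simp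
qed

lemma omega_in_M: "omega \<in> M"
proof -
  obtain e :: "nat \<Rightarrow> hc" where e: "range e \<subseteq> M" using ex_env .
  have succ_in_M: "succ x \<in> M" if "x \<in> M" for x using adj_in_M[OF that that] by (simp add: succ_def)
  have "satisfies M e Infinity" by (rule zfc[OF _ e]) (simp add: ZFC_def)
  then have "\<exists>a\<in>M. emp \<in> el a \<and> (\<forall>x\<in>M. x \<in> el a \<longrightarrow> succ x \<in> el a)"
    by (auto simp: Infinity_def is_inductive_def ForallIn_def
       satisfies_is_empty satisfies_is_succ hc_mem_iff)
  then obtain a where a: "a \<in> M" "emp \<in> el a" "\<forall>x\<in>M. x \<in> el a \<longrightarrow> succ x \<in> el a" by blast
  have num: "num n \<in> M \<and> num n \<in> el a" for n
    by (induction n) (use a emp_in_M succ_in_M in auto)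
  \<comment> \<open>Infinity supplies an inductive set \<open>a\<close>; its numerals are separated
    by the bounded condition above.\<close>
  have "mk {y \<in> el a. y \<in> range num} \<in> M"
    unfolding range_num_iff by (intro separation definable_basic_intros a)
  moreover have "{y \<in> el a. y \<in> range num} = range num" using num by auto
  ultimately show ?thesis by (simp add: omega_def)
qed

sublocale M: absoluteness_omega "{()}" "\<lambda>_ _. True" "\<lambda>_. M" M
  by unfold_locales (rule omega_in_M)

lemmas definable_intros = definable_basic_intros M.absolute_fun_omega

end


section \<open>Replacement and choice in \<open>M\<close>; sets whose transitive closure is an image
  of \<open>A\<close>\<close>

context ctm
begin

lemma replacement:
  assumes Q: "M.absolute (\<lambda>e. Q (e 0) (e 1))" and a: "a \<in> M"
    and F: "\<And>x. x \<in> el a \<Longrightarrow> F x \<in> M" "\<And>x y. x \<in> el a \<Longrightarrow> y \<in> M \<Longrightarrow> Q x y \<longleftrightarrow> y = F x"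
  shows "mk (F ` el a) \<in> M"
proof -
  obtain \<phi> cs where \<phi>: "well_formed set_ar \<phi>" "set cs \<subseteq> M"
    "\<And>e. range e \<subseteq> M \<Longrightarrow> satisfies M (cs @@ e) \<phi> = Q (e 0) (e 1)"
    using absolute_M_satisfies[OF Q] by metis
  \<comment> \<open>Places 0, 1 and 2 hold the argument, the value and the domain set; the
    parameters start at 3.\<close>
  define f where "f i = (if i < length cs then i + 3 else if i = length cs then 0 else 1)" for i
  define \<psi> where "\<psi> = rename f \<phi>"
  define e where "e = cs @@ (\<lambda>_. a)"
  have wf: "well_formed set_ar \<psi>" using \<phi> by (simp add: \<psi>_def)
  have e: "range e \<subseteq> M" using \<phi> a unfolding e_def by (intro range_append_env) auto
  have val: "satisfies M (case_nat x (case_nat y (case_nat a e))) \<psi> = Q x y" if "x \<in> M" "y \<in> M" for x y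
  proof -
    have "case_nat x (case_nat y (case_nat a e)) \<circ> f = cs @@ (case_nat x (\<lambda>_. y))"
      by (auto simp: e_def f_def append_env_def fun_eq_iff numeral_3_eq_3 split: nat.split)
    then show ?thesis
      using \<phi>(3)[OF range_case_nat[of x "\<lambda>_. y"]] that by (auto simp: \<psi>_def satisfies_rename \<phi>(1))
  qed
  have "satisfies M e (Replacement \<psi>)"
  proof (rule zfc_schema[OF _ _ e])
    show "(Forall ^^ n) (Replacement \<psi>) \<in> ZFC" if "sentence set_ar ((Forall ^^ n) (Replacement \<psi>))" for n
      using that wf by (auto simp: ZFC_def universal_closures_def)
    show "well_formed set_ar (Replacement \<psi>)"
      using wf by (simp add: Replacement_def ForallIn_def ExistsIn_def set_ar_def)
  qed
  then have "\<forall>a\<in>M. (\<forall>x\<in>M. x \<in> el a \<longrightarrow> (\<exists>y\<in>M. satisfies M (case_nat x (case_nat y (case_nat a e))) \<psi> \<and>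
        (\<forall>z\<in>M. satisfies M (case_nat x (case_nat z (case_nat a e))) \<psi> \<longrightarrow> z = y))) \<longrightarrow>
      (\<exists>b\<in>M. \<forall>y\<in>M. y \<in> el b \<longleftrightarrow>
         (\<exists>x\<in>M. x \<in> el a \<and> satisfies M (case_nat x (case_nat y (case_nat a e))) \<psi>))"
    by (simp add: Replacement_def ForallIn_def ExistsIn_def hc_mem_iff
       satisfies_inst[OF wf] eval_nat_numeral iff_conv_conj_imp)
  from bspec[OF this a] have *: "(\<forall>x\<in>M. x \<in> el a \<longrightarrow> (\<exists>y\<in>M. Q x y \<and> (\<forall>z\<in>M. Q x z \<longrightarrow> z = y))) \<longrightarrow>
      (\<exists>b\<in>M. \<forall>y\<in>M. y \<in> el b \<longleftrightarrow> (\<exists>x\<in>M. x \<in> el a \<and> Q x y))"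
    by (simp add: val cong: ball_cong bex_cong)
  have "\<forall>x\<in>M. x \<in> el a \<longrightarrow> (\<exists>y\<in>M. Q x y \<and> (\<forall>z\<in>M. Q x z \<longrightarrow> z = y))"
    using F by blast
  with * obtain b where b: "b \<in> M" "\<forall>y\<in>M. y \<in> el b \<longleftrightarrow> (\<exists>x\<in>M. x \<in> el a \<and> Q x y)" by blast
  have "b = mk (F ` el a)"
    by (rule M_eqI[OF b(1)]) (use b(2) F M_sub[OF a] in auto)
  then show ?thesis using b by simp
qed

lemma row_in_M:
  assumes "x \<in> M" "b \<in> M" shows "mk (opair x ` el b) \<in> M"
proof (rule replacement[where Q = "\<lambda>y u. u = opair x y"])
  show "M.absolute (\<lambda>e. e 1 = opair x (e 0))" by (intro definable_intros assms)
qed (use assms M_sub opair_in_M in auto)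

text \<open>Rows are collected by Replacement and joined by Union; being the row of \<open>x\<close>
  is a bounded condition on \<open>r\<close>.\<close>

lemma product_in_M:
  assumes "a \<in> M" "b \<in> M" shows "mk ((\<lambda>(x, y). opair x y) ` (el a \<times> el b)) \<in> M"
proof -
  have "mk ((\<lambda>x. mk (opair x ` el b)) ` el a) \<in> M"
  proof (rule replacement[where Q = "\<lambda>x r. (\<forall>u\<in>el r. \<exists>y\<in>el b. u = opair x y) \<and> (\<forall>y\<in>el b. opair x y \<in> el r)"])
    show "M.absolute (\<lambda>e. (\<forall>u\<in>el (e 1). \<exists>y\<in>el b. u = opair (e 0) y) \<and> (\<forall>y\<in>el b. opair (e 0) y \<in> el (e 1)))"
      by (intro definable_intros assms)
    show "((\<forall>u\<in>el r. \<exists>y\<in>el b. u = opair x y) \<and> (\<forall>y\<in>el b. opair x y \<in> el r)) \<longleftrightarrow> r = mk (opair x ` el b)" for x r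
      unfolding el_inject[of r, symmetric] by auto
  qed (use assms M_sub row_in_M in auto)
  from union_in_M[OF this] show ?thesis
    by (rule back_subst[of "\<lambda>S. mk S \<in> M"]) auto
qed

lemma satisfies_AC:
  assumes "a \<in> M" "\<And>x. x \<in> el a \<Longrightarrow> el x \<noteq> {}"
    and "\<And>x y. x \<in> el a \<Longrightarrow> y \<in> el a \<Longrightarrow> x \<noteq> y \<Longrightarrow> el x \<inter> el y = {}"
  shows "\<exists>b\<in>M. \<forall>x\<in>el a. \<exists>z\<in>el b. z \<in> el x \<and> (\<forall>w\<in>el x. w \<in> el b \<longrightarrow> w = z)"
proof -
  obtain e :: "nat \<Rightarrow> hc" where e: "range e \<subseteq> M" using ex_env .
  have "satisfies M e AC \<longleftrightarrow> (\<forall>a\<in>M. (\<forall>x\<in>M. x \<in> el a \<longrightarrow> (\<exists>z\<in>M. z \<in> el x)) \<and>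
      (\<forall>x\<in>M. x \<in> el a \<longrightarrow> (\<forall>y\<in>M. y \<in> el a \<longrightarrow> (x = y \<longrightarrow> False) \<longrightarrow>
          (\<forall>z\<in>M. z \<in> el x \<and> z \<in> el y \<longrightarrow> False))) \<longrightarrow>
      (\<exists>b\<in>M. \<forall>x\<in>M. x \<in> el a \<longrightarrow> (\<exists>z\<in>M. z \<in> el b \<and> z \<in> el x \<and> (\<forall>w\<in>M. w \<in> el b \<longrightarrow> w \<in> el x \<longrightarrow> w = z))))"
    by (simp only: AC_def ForallIn_def ExistsIn_def hc_mem_iff satisfies.simps set_sym.case
        nth_Cons_0 nth_Cons_Suc One_nat_def numeral_2_eq_2 nat.case)
  moreover have "satisfies M e AC" by (rule zfc[OF _ e]) (simp add: ZFC_def)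
  ultimately have "\<forall>a\<in>M. (\<forall>x\<in>M. x \<in> el a \<longrightarrow> (\<exists>z\<in>M. z \<in> el x)) \<and>
      (\<forall>x\<in>M. x \<in> el a \<longrightarrow> (\<forall>y\<in>M. y \<in> el a \<longrightarrow> (x = y \<longrightarrow> False) \<longrightarrow>
          (\<forall>z\<in>M. z \<in> el x \<and> z \<in> el y \<longrightarrow> False))) \<longrightarrow>
      (\<exists>b\<in>M. \<forall>x\<in>M. x \<in> el a \<longrightarrow> (\<exists>z\<in>M. z \<in> el b \<and> z \<in> el x \<and> (\<forall>w\<in>M. w \<in> el b \<longrightarrow> w \<in> el x \<longrightarrow> w = z)))"
    by (rule iffD1)
  note AC = bspec[OF this assms(1)]
  have "\<exists>z\<in>M. z \<in> el x" if "x \<in> el a" for x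
    using assms(2)[OF that] M_sub[OF subsetD[OF M_sub[OF assms(1)] that]] by blast
  moreover have "z \<in> el x \<and> z \<in> el y \<longrightarrow> False" if "x \<in> el a" "y \<in> el a" "x \<noteq> y" for x y z
    using assms(3)[OF that] by blast
  ultimately obtain b where b: "b \<in> M"
    "\<forall>x\<in>M. x \<in> el a \<longrightarrow> (\<exists>z\<in>M. z \<in> el b \<and> z \<in> el x \<and> (\<forall>w\<in>M. w \<in> el b \<longrightarrow> w \<in> el x \<longrightarrow> w = z))"
    using AC by blast
  show ?thesis
  proof (intro bexI[OF _ b(1)] ballI)
    fix x assume x: "x \<in> el a"
    then have "x \<in> M" using M_sub assms(1) by blast
    then obtain z where "z \<in> el b" "z \<in> el x" "\<forall>w\<in>M. w \<in> el b \<longrightarrow> w \<in> el x \<longrightarrow> w = z" using b x by blast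
    then show "\<exists>z\<in>el b. z \<in> el x \<and> (\<forall>w\<in>el x. w \<in> el b \<longrightarrow> w = z)"
      using M_sub[OF \<open>x \<in> M\<close>] by blast
  qed
qed

text \<open>\<open>AC\<close> speaks of disjoint families, so the sets of candidates are made
  disjoint by tagging each candidate with its \<open>x\<close>. \<open>G\<close> lives on the
  metalevel; inside \<open>M\<close> its graph takes its place.\<close>

lemma choice:
  assumes Q: "M.absolute (\<lambda>e. Q (e 0) (e 1))" and a: "a \<in> M" and c: "c \<in> M"
    and ex: "\<And>x. x \<in> el a \<Longrightarrow> \<exists>p\<in>el c. Q x p"
  obtains G where "\<And>x. x \<in> el a \<Longrightarrow> G x \<in> el c \<and> Q x (G x)"
    and "mk ((\<lambda>x. opair x (G x)) ` el a) \<in> M"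
proof -
  note QI = M.absolute_subst2[OF _ _ Q]
  define F where "F x = mk (opair x ` {p \<in> el c. Q x p})" for x
  have el_F: "el (F x) = opair x ` {p \<in> el c. Q x p}" for x
    unfolding F_def by (rule el_mk) (auto intro: countable_image countable_subset[OF _ countable_el[of c]])
  have F_M: "F x \<in> M" if "x \<in> M" for x
  proof -
    have "mk {p \<in> el c. Q x p} \<in> M"
      by (intro separation QI definable_intros c that)
    moreover have "el (mk {p \<in> el c. Q x p}) = {p \<in> el c. Q x p}"
      by (auto intro!: el_mk countable_subset[OF _ countable_el[of c]])
    ultimately have "mk (opair x ` {p \<in> el c. Q x p}) \<in> M" using row_in_M[OF that] by metis
    then show ?thesis by (simp add: F_def)
  qed
  have fam: "mk (F ` el a) \<in> M"
  proof (rule replacement[where Q = "\<lambda>x r. (\<forall>u\<in>el r. \<exists>p\<in>el c. Q x p \<and> u = opair x p) \<and>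
      (\<forall>p\<in>el c. Q x p \<longrightarrow> opair x p \<in> el r)"])
    show "M.absolute (\<lambda>e. (\<forall>u\<in>el (e 1). \<exists>p\<in>el c. Q (e 0) p \<and> u = opair (e 0) p) \<and>
      (\<forall>p\<in>el c. Q (e 0) p \<longrightarrow> opair (e 0) p \<in> el (e 1)))"
      by (intro QI definable_intros c)
    show "((\<forall>u\<in>el r. \<exists>p\<in>el c. Q x p \<and> u = opair x p) \<and> (\<forall>p\<in>el c. Q x p \<longrightarrow> opair x p \<in> el r))
        \<longleftrightarrow> r = F x" for x r
      unfolding el_inject[of r, symmetric] el_F by blast
  qed (use F_M M_sub[OF a] a in auto)
  have ne: "el r \<noteq> {}" if "r \<in> el (mk (F ` el a))" for r using that ex el_F by fastforce
  have disj: "el r \<inter> el s = {}" if "r \<in> el (mk (F ` el a))" "s \<in> el (mk (F ` el a))" "r \<noteq> s" for r s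
    using that el_F by auto
  obtain b where b: "b \<in> M"
    "\<forall>r\<in>el (mk (F ` el a)). \<exists>z\<in>el b. z \<in> el r \<and> (\<forall>w\<in>el r. w \<in> el b \<longrightarrow> w = z)"
    using satisfies_AC[OF fam ne disj] by blast
  have bF: "\<exists>z\<in>el b. z \<in> el (F x) \<and> (\<forall>w\<in>el (F x). w \<in> el b \<longrightarrow> w = z)" if "x \<in> el a" for x
    using b(2) that by simp
  define G where "G x = (SOME p. p \<in> el c \<and> Q x p \<and> opair x p \<in> el b)" for x
  have uniq: "p = p'" if x: "x \<in> el a" and p: "p \<in> el c" "Q x p" "opair x p \<in> el b"
    "p' \<in> el c" "Q x p'" "opair x p' \<in> el b" for x p p'
  proof -
    obtain z where z: "\<forall>w\<in>el (F x). w \<in> el b \<longrightarrow> w = z" using bF[OF x] by blast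
    have "opair x p \<in> el (F x)" "opair x p' \<in> el (F x)" using p by (simp_all add: el_F)
    then have "opair x p = opair x p'" using z p by metis
    then show ?thesis by simp
  qed
  have G: "G x \<in> el c \<and> Q x (G x) \<and> opair x (G x) \<in> el b" if x: "x \<in> el a" for x
  proof -
    obtain z where "z \<in> el b" "z \<in> el (F x)" using bF[OF x] by blast
    then have "\<exists>p. p \<in> el c \<and> Q x p \<and> opair x p \<in> el b" using el_F by auto
    then show ?thesis unfolding G_def by (rule someI_ex)
  qed
  \<comment> \<open>The graph of \<open>G\<close>, described through \<open>b\<close> and
    \<open>Q\<close> alone and hence definable.\<close>
  have "mk {u \<in> el b. \<exists>x\<in>el a. \<exists>p\<in>el c. u = opair x p \<and> Q x p} \<in> M"
    by (intro separation QI definable_intros a b c)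
  moreover have "{u \<in> el b. \<exists>x\<in>el a. \<exists>p\<in>el c. u = opair x p \<and> Q x p} = (\<lambda>x. opair x (G x)) ` el a"
    using G uniq by (auto simp: image_iff)
  ultimately show ?thesis using G that by metis
qed

definition img :: "hc \<Rightarrow> hc \<Rightarrow> hc set" where
  "img f A = {y. \<exists>i\<in>el A. opair i y \<in> el f}"

text \<open>\<open>f\<close> is the graph in \<open>M\<close> of a function on \<open>A\<close>
  whose range is transitive.\<close>

definition cover :: "hc \<Rightarrow> hc \<Rightarrow> bool" where
  "cover f A \<longleftrightarrow> f \<in> M \<and> (\<forall>u\<in>el f. \<exists>i\<in>el A. \<exists>y\<in>M. u = opair i y) \<and>
     (\<forall>i\<in>el A. \<exists>y\<in>M. opair i y \<in> el f \<and> (\<forall>z\<in>M. opair i z \<in> el f \<longrightarrow> z = y)) \<and>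
     (\<forall>i\<in>el A. \<forall>y\<in>M. opair i y \<in> el f \<longrightarrow> (\<forall>w\<in>el y. \<exists>j\<in>el A. opair j w \<in> el f))"

text \<open>The sets whose transitive closure is an image of \<open>A\<close>, as seen in \<open>M\<close>.\<close>

definition N :: "hc \<Rightarrow> hc set" where
  "N A = {x \<in> M. \<exists>f. cover f A \<and> x \<in> img f A}"

text \<open>On \<open>A\<close>, \<open>c\<close> is membership pulled back along \<open>f\<close>.
  Relations on \<open>A\<close> form a set in \<open>M\<close>, so a code can be chosen by
  \<open>choice\<close> where a cover is not given as an element of a set.\<close>

definition codes :: "hc \<Rightarrow> hc \<Rightarrow> hc \<Rightarrow> bool" where
  "codes A c f \<longleftrightarrow> (\<forall>i\<in>el A. \<forall>j\<in>el A. \<forall>y\<in>M. \<forall>z\<in>M.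
     opair i y \<in> el f \<longrightarrow> opair j z \<in> el f \<longrightarrow> (opair i j \<in> el c \<longleftrightarrow> y \<in> el z))"

lemma absolute_cover:
  assumes "A \<in> M" "M.absolute_fun t" shows "M.absolute (\<lambda>e. t e \<in> M \<and> cover (t e) A)"
proof (rule M.absolute_subst[OF assms(2), where P = "\<lambda>x e. x \<in> M \<and> cover x A"])
  have "M.absolute (\<lambda>e. (\<forall>u\<in>el (e 0). \<exists>i\<in>el A. \<exists>y\<in>M. u = opair i y) \<and>
     (\<forall>i\<in>el A. \<exists>y\<in>M. opair i y \<in> el (e 0) \<and> (\<forall>z\<in>M. opair i z \<in> el (e 0) \<longrightarrow> z = y)) \<and>
     (\<forall>i\<in>el A. \<forall>y\<in>M. opair i y \<in> el (e 0) \<longrightarrow> (\<forall>w\<in>el y. \<exists>j\<in>el A. opair j w \<in> el (e 0))))"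
    by (intro definable_intros assms)
  then show "M.absolute (\<lambda>e. e 0 \<in> M \<and> cover (e 0) A)"
    by (rule M.absolute_cong) (auto simp: cover_def)
qed

lemma absolute_codes:
  assumes "A \<in> M" "M.absolute_fun s" "M.absolute_fun t" shows "M.absolute (\<lambda>e. codes A (s e) (t e))"
  unfolding codes_def
  by (rule M.absolute_subst2[OF assms(2,3)]) (intro definable_intros assms)

lemma opair_mem_M: "opair x y \<in> el s \<Longrightarrow> s \<in> M \<Longrightarrow> x \<in> M \<and> y \<in> M"
  using M.opair_mem_in_D[of x y s "()"] by simp

lemma img_sub_M: "cover f A \<Longrightarrow> img f A \<subseteq> M"
  using opair_mem_M unfolding cover_def img_def by blast

lemma img_trans:
  assumes "cover f A" "y \<in> img f A" shows "el y \<subseteq> img f A"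
  using assms img_sub_M[OF assms(1)] unfolding cover_def img_def by blast

lemma N_trans: "y \<in> N A \<Longrightarrow> x \<in> el y \<Longrightarrow> x \<in> N A"
  using img_trans M_trans unfolding N_def by blast

lemma N_sub_M: "N A \<subseteq> M" by (auto simp: N_def)

text \<open>A partial definable map on \<open>A\<close> with transitive range is made total by a default value.\<close>

lemma in_NI:
  assumes R: "M.absolute (\<lambda>e. R (e 0) (e 1))" and A: "A \<in> M"
    and uniq: "\<And>i y z. i \<in> el A \<Longrightarrow> y \<in> M \<Longrightarrow> z \<in> M \<Longrightarrow> R i y \<Longrightarrow> R i z \<Longrightarrow> y = z"
    and trans: "\<And>i y w. i \<in> el A \<Longrightarrow> y \<in> M \<Longrightarrow> R i y \<Longrightarrow> w \<in> el y \<Longrightarrow> \<exists>j\<in>el A. R j w"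
    and x: "k \<in> el A" "x \<in> M" "R k x"
  shows "x \<in> N A"
proof -
  note RI = M.absolute_subst2[OF _ _ R]
  \<comment> \<open>\<open>x\<close> is a harmless default: it is a value of \<open>R\<close>, so
    the range stays the same.\<close>
  define R' where "R' i y \<longleftrightarrow> R i y \<or> (\<not> (\<exists>z\<in>M. R i z)) \<and> y = x" for i y
  have ex1: "\<exists>!y. y \<in> M \<and> R' i y" if "i \<in> el A" for i
    using uniq[OF that] x(2) unfolding R'_def by metis
  define h where "h i = (THE y. y \<in> M \<and> R' i y)" for i
  have h: "h i \<in> M" "R' i y \<longleftrightarrow> y = h i" if "i \<in> el A" "y \<in> M" for i y
    using theI'[OF ex1[OF that(1)]] ex1[OF that(1)] that(2) unfolding h_def[symmetric] by blast+
  define f where "f = mk ((\<lambda>i. opair i (h i)) ` el A)"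
  have hM: "h i \<in> M" if "i \<in> el A" for i using h(1)[OF that x(2)] .
  have iM: "i \<in> M" if "i \<in> el A" for i using that M_sub[OF A] by blast
  have fM: "f \<in> M"
    unfolding f_def
  proof (rule replacement[where Q = "\<lambda>i u. \<exists>y\<in>M. (R i y \<or> (\<not> (\<exists>z\<in>M. R i z)) \<and> y = x) \<and> u = opair i y"])
    show "M.absolute (\<lambda>e. \<exists>y\<in>M. (R (e 0) y \<or> (\<not> (\<exists>z\<in>M. R (e 0) z)) \<and> y = x) \<and> e 1 = opair (e 0) y)"
      by (intro RI definable_intros x)
    fix i u assume i: "i \<in> el A"
    show "opair i (h i) \<in> M" using iM hM i opair_in_M by blast
    show "(\<exists>y\<in>M. (R i y \<or> (\<not> (\<exists>z\<in>M. R i z)) \<and> y = x) \<and> u = opair i y) \<longleftrightarrow> u = opair i (h i)"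
      unfolding R'_def[symmetric] using h[OF i] hM[OF i] by blast
  qed (rule A)
  have mem_f: "opair i y \<in> el f \<longleftrightarrow> i \<in> el A \<and> y = h i" for i y
    by (auto simp: f_def)
  have "el (h i) \<subseteq> h ` el A" if i: "i \<in> el A" for i
  proof
    fix w assume w: "w \<in> el (h i)"
    have wM: "w \<in> M" using w hM[OF i] M_sub by blast
    have "R' i (h i)" using h(2)[OF i hM[OF i]] by simp
    then have "\<exists>j\<in>el A. R j w" using trans w hM[OF i] i x unfolding R'_def by blast
    then show "w \<in> h ` el A" using h(2)[OF _ wM] unfolding R'_def by blast
  qed
  then have "cover f A"
    unfolding cover_def mem_f using fM hM by (auto simp: f_def)
  moreover have "x \<in> img f A"
    using h(2)[OF x(1,2)] x unfolding img_def mem_f R'_def by blast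
  ultimately show ?thesis using x by (auto simp: N_def)
qed

text \<open>Uniqueness of the Mostowski collapse, by membership induction on the value.\<close>

lemma codes_unique:
  assumes f: "cover f A" "codes A c f" and g: "cover g A" "codes A c g"
  shows "f = g"
proof -
  have "opair i y \<in> el g" if "cover f A" "codes A c f" "cover g A" "codes A c g"
    "i \<in> el A" "opair i y \<in> el f" for f g i y
    using that(5,6)
  proof (induction y arbitrary: i rule: hc_induct)
    case (mem y)
    note f = that(1,2) and g = that(3,4)
    obtain z where z: "z \<in> M" "opair i z \<in> el g" using g mem.prems unfolding cover_def by blast
    have y: "y \<in> M" using img_sub_M[OF f(1)] mem.prems unfolding img_def by blast
    have "u \<in> el y \<longleftrightarrow> u \<in> el z" for u
    proof
      assume u: "u \<in> el y"
      then obtain k where k: "k \<in> el A" "opair k u \<in> el f"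
        using f(1) mem.prems y unfolding cover_def by blast
      have uM: "u \<in> M" using u y M_sub by blast
      have "opair k i \<in> el c" using f(2) k mem.prems y u uM unfolding codes_def by blast
      moreover have "opair k u \<in> el g" using mem.IH[OF u k] .
      ultimately show "u \<in> el z" using g(2) k mem.prems z uM unfolding codes_def by blast
    next
      assume u: "u \<in> el z"
      then obtain k where k: "k \<in> el A" "opair k u \<in> el g"
        using g(1) mem.prems z unfolding cover_def by blast
      have uM: "u \<in> M" using u z M_sub by blast
      have ki: "opair k i \<in> el c" using g(2) k mem.prems z u uM unfolding codes_def by blast
      \<comment> \<open>\<open>u\<close> is not known to be a value of \<open>f\<close>. The code
        puts the value \<open>u'\<close> of \<open>f\<close> at \<open>k\<close> into
        \<open>y\<close>, and the induction hypothesis then yields \<open>u' = u\<close>.\<close>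
      obtain u' where u': "u' \<in> M" "opair k u' \<in> el f" using f(1) k unfolding cover_def by blast
      then have "u' \<in> el y" using f(2) k ki mem.prems y unfolding codes_def by blast
      then have "opair k u' \<in> el g" using mem.IH k u' by blast
      then have "u' = u" using g(1) k u' uM unfolding cover_def by blast
      then show "u \<in> el y" using \<open>u' \<in> el y\<close> by simp
    qed
    then have "y = z" by (rule hc_eqI)
    then show ?case using z by simp
  qed
  note sub = this
  have "el f \<subseteq> el g" if f: "cover f A" "codes A c f" and g: "cover g A" "codes A c g" for f g
  proof
    fix u assume u: "u \<in> el f"
    then obtain i y where "i \<in> el A" "u = opair i y" using f unfolding cover_def by blast
    then show "u \<in> el g" using sub[OF f g] u by simp
  qed
  from this[OF f g] this[OF g f] show ?thesis unfolding el_inject[symmetric] by simp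
qed

lemma code_exists:
  assumes f: "cover f A" and A: "A \<in> M"
  shows "\<exists>c\<in>el (pw (mk ((\<lambda>(x, y). opair x y) ` (el A \<times> el A)))). codes A c f"
proof -
  let ?AA = "mk ((\<lambda>(x, y). opair x y) ` (el A \<times> el A))"
  let ?P = "\<lambda>u. \<exists>i\<in>el A. \<exists>j\<in>el A. u = opair i j \<and>
     (\<exists>y\<in>M. \<exists>z\<in>M. opair i y \<in> el f \<and> opair j z \<in> el f \<and> y \<in> el z)"
  have AA: "?AA \<in> M" using A by (rule product_in_M[OF _ A])
  have fM: "f \<in> M" using f by (simp add: cover_def)
  have "mk {u \<in> el ?AA. ?P u} \<in> M" by (intro separation definable_intros AA A fM)
  moreover have el_c: "el (mk {u \<in> el ?AA. ?P u}) = {u \<in> el ?AA. ?P u}"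
    by (auto intro!: el_mk countable_subset[OF _ countable_el[of ?AA]])
  moreover have "codes A (mk {u \<in> el ?AA. ?P u}) f"
    unfolding codes_def el_c
  proof (intro ballI impI)
    fix i j y z assume *: "i \<in> el A" "j \<in> el A" "y \<in> M" "z \<in> M" "opair i y \<in> el f" "opair j z \<in> el f"
    have "y' = y" if "y' \<in> M" "opair i y' \<in> el f" for y'
      using f * that unfolding cover_def by metis
    moreover have "z' = z" if "z' \<in> M" "opair j z' \<in> el f" for z'
      using f * that unfolding cover_def by metis
    ultimately have val: "(\<exists>y\<in>M. \<exists>z\<in>M. opair i y \<in> el f \<and> opair j z \<in> el f \<and> y \<in> el z) \<longleftrightarrow> y \<in> el z"
      using *(3-6) by blast
    have "?P (opair i j) \<longleftrightarrow> y \<in> el z"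
      unfolding opair_inject using *(1,2) val by auto
    then show "opair i j \<in> {u \<in> el ?AA. ?P u} \<longleftrightarrow> y \<in> el z"
      using *(1,2) by (auto simp: image_iff)
  qed
  ultimately show ?thesis by (auto simp: el_pw)
qed

text \<open>A cover on \<open>A\<close> is a partial map on \<open>B\<close>, which
  \<open>in_NI\<close> makes total.\<close>

lemma N_mono:
  assumes "A \<in> M" "B \<in> M" "el A \<subseteq> el B" shows "N A \<subseteq> N B"
proof
  fix x assume "x \<in> N A"
  then obtain f i where f: "cover f A" and i: "i \<in> el A" "opair i x \<in> el f" and x: "x \<in> M"
    by (auto simp: N_def img_def)
  have fM: "f \<in> M" using f by (simp add: cover_def)
  show "x \<in> N B"
  proof (rule in_NI[where R = "\<lambda>i y. i \<in> el A \<and> opair i y \<in> el f" and k = i])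
    show "M.absolute (\<lambda>e. e 0 \<in> el A \<and> opair (e 0) (e 1) \<in> el f)"
      by (intro definable_intros assms fM)
  next
    fix j y z assume "y \<in> M" "z \<in> M" "j \<in> el A \<and> opair j y \<in> el f" "j \<in> el A \<and> opair j z \<in> el f"
    then show "y = z" using f unfolding cover_def by metis
  next
    fix j y w assume "y \<in> M" "j \<in> el A \<and> opair j y \<in> el f" "w \<in> el y"
    then show "\<exists>k\<in>el B. k \<in> el A \<and> opair k w \<in> el f" using f assms(3) unfolding cover_def by blast
  qed (use i x assms in auto)
qed

text \<open>Cantor's diagonal argument: the range of a cover is transitive, so it would contain
  every subset of \<open>A\<close> in \<open>M\<close>, among them the set of those \<open>i\<close>
  that do not belong to the value at \<open>i\<close>.\<close>

lemma pw_notin_N: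
  assumes A: "A \<in> M" shows "pw A \<notin> N A"
proof
  assume "pw A \<in> N A"
  then obtain f where f: "cover f A" "pw A \<in> img f A" by (auto simp: N_def)
  have fM: "f \<in> M" using f by (simp add: cover_def)
  define d where "d = mk {i \<in> el A. \<exists>y\<in>M. opair i y \<in> el f \<and> i \<notin> el y}"
  have el_d: "el d = {i \<in> el A. \<exists>y\<in>M. opair i y \<in> el f \<and> i \<notin> el y}"
    unfolding d_def by (auto intro!: el_mk countable_subset[OF _ countable_el[of A]])
  have dM: "d \<in> M" unfolding d_def by (intro separation definable_intros A fM)
  then have "d \<in> el (pw A)" using el_d by (auto simp: el_pw)
  then have "d \<in> img f A" using img_trans[OF f] by blast
  then obtain i where i: "i \<in> el A" "opair i d \<in> el f" by (auto simp: img_def)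
  have "y = d" if "y \<in> M" "opair i y \<in> el f" for y
    using f(1) i that dM unfolding cover_def by metis
  then have "i \<in> el d \<longleftrightarrow> i \<notin> el d" unfolding el_d using i dM el_d by blast
  then show False by simp
qed

end

section \<open>Closure of \<open>N A\<close> when \<open>A\<close> maps onto its own square\<close>

locale index_set = ctm M for M +
  fixes A g :: hc
  assumes A_M: "A \<in> M" and g_M: "g \<in> M"
    and A_trans: "x \<in> el A \<Longrightarrow> el x \<subseteq> el A"
    and omega_sub: "el omega \<subseteq> el A"
    and g_fun: "opair i u \<in> el g \<Longrightarrow> opair i u' \<in> el g \<Longrightarrow> u = u'"
    and g_surj: "a \<in> el A \<Longrightarrow> b \<in> el A \<Longrightarrow> \<exists>i\<in>el A. opair i (opair a b) \<in> el g"
begin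

text \<open>Every pair over \<open>A\<close> has an index, and an index codes at most one pair. So
  an index in \<open>A\<close> can be decoded, repeatedly if need be, into tuples over
  \<open>A\<close>, with \<open>emp\<close> and \<open>succ emp\<close> as tags for case
  distinctions.\<close>

lemma g_iff:
  "opair i (opair a b) \<in> el g \<Longrightarrow> opair i (opair a' b') \<in> el g \<longleftrightarrow> a' = a \<and> b' = b"
  using g_fun[of i "opair a b" "opair a' b'"] by auto

lemma zero_one: "emp \<in> el A" "succ emp \<in> el A"
proof -
  have "num n \<in> el A" for n using omega_sub by auto
  from this[of 0] this[of 1] show "emp \<in> el A" "succ emp \<in> el A" by simp_all
qed

text \<open>The range of \<open>f\<close> together with \<open>z\<close> is transitive. Tagged
  indices enumerate it: \<open>(emp, b)\<close> stands for the value of \<open>f\<close> at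
  \<open>b\<close>, and \<open>(succ emp, b)\<close> for \<open>z\<close>.\<close>

lemma subset_img_in_N:
  assumes z: "z \<in> M" and f: "cover f A" and sub: "el z \<subseteq> img f A"
  shows "z \<in> N A"
proof -
  have fM: "f \<in> M" using f by (simp add: cover_def)
  obtain k where k: "k \<in> el A" "opair k (opair (succ emp) emp) \<in> el g"
    using g_surj zero_one by blast
  define R where "R i y \<longleftrightarrow> (\<exists>a\<in>el A. \<exists>b\<in>el A. opair i (opair a b) \<in> el g \<and>
    (a = emp \<and> opair b y \<in> el f \<or> a = succ emp \<and> y = z))" for i y
  have R0: "R i y \<longleftrightarrow> opair b y \<in> el f" if "opair i (opair emp b) \<in> el g" "b \<in> el A" for i y b
    unfolding R_def g_iff[OF that(1)] using that(2) zero_one by auto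
  have R1: "R i y \<longleftrightarrow> y = z" if "opair i (opair (succ emp) b) \<in> el g" "b \<in> el A" for i y b
    unfolding R_def g_iff[OF that(1)] using that(2) zero_one by auto
  have hit: "\<exists>j\<in>el A. R j w" if w: "w \<in> img f A" for w
  proof -
    obtain b where b: "b \<in> el A" "opair b w \<in> el f" using w unfolding img_def by blast
    obtain j where "j \<in> el A" "opair j (opair emp b) \<in> el g" using g_surj zero_one b by blast
    then show ?thesis using R0 b by blast
  qed
  show ?thesis
  proof (rule in_NI[where R = R and k = k])
    show "M.absolute (\<lambda>e. R (e 0) (e 1))"
      unfolding R_def by (intro definable_intros A_M g_M fM z)
  next
    fix i y y' assume *: "y \<in> M" "y' \<in> M" "R i y" "R i y'"
    then obtain a b where ab: "opair i (opair a b) \<in> el g" "b \<in> el A" "a = emp \<or> a = succ emp"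
      unfolding R_def by blast
    from ab(3) show "y = y'"
    proof
      assume "a = emp"
      then have "opair i (opair emp b) \<in> el g" using ab(1) by simp
      then have "opair b y \<in> el f" "opair b y' \<in> el f" using * R0[OF _ ab(2)] by simp_all
      then show "y = y'" using * f ab(2) unfolding cover_def by metis
    next
      assume "a = succ emp"
      then have "opair i (opair (succ emp) b) \<in> el g" using ab(1) by simp
      then show "y = y'" using * R1[OF _ ab(2)] by simp
    qed
  next
    fix i y w assume *: "y \<in> M" "R i y" "w \<in> el y"
    then consider b where "opair b y \<in> el f" "b \<in> el A" | "y = z" unfolding R_def by blast
    then have "w \<in> img f A"
    proof cases
      case 1
      then have "y \<in> img f A" unfolding img_def by blast
      then show ?thesis using img_trans[OF f] * by blast
    qed (use sub * in blast)
    then show "\<exists>j\<in>el A. R j w" by (rule hit)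
  next
    show "R k z" using R1[OF k(2) zero_one(1)] by simp
  qed (use A_M k z in auto)
qed

lemma cover_id: "cover (mk ((\<lambda>i. opair i i) ` el A)) A"
proof -
  have "mk ((\<lambda>i. opair i i) ` el A) \<in> M"
    by (rule replacement[where Q = "\<lambda>i u. u = opair i i"])
      (auto intro!: definable_intros A_M opair_in_M intro: subsetD[OF M_sub[OF A_M]])
  then show ?thesis
    using A_trans M_sub[OF A_M] by (auto simp: cover_def image_iff)
qed

lemma img_id: "img (mk ((\<lambda>i. opair i i) ` el A)) A = el A"
  by (auto simp: img_def)

lemma subset_A_in_N: "z \<in> M \<Longrightarrow> el z \<subseteq> el A \<Longrightarrow> z \<in> N A"
  using subset_img_in_N[OF _ cover_id] by (simp add: img_id)

lemma A_in_N: "A \<in> N A"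
  using subset_A_in_N A_M by blast

lemma N_el: "y \<in> N A \<Longrightarrow> \<exists>f. cover f A \<and> el y \<subseteq> img f A"
  using img_trans unfolding N_def by blast

lemma subset_in_N: "z \<in> M \<Longrightarrow> y \<in> N A \<Longrightarrow> el z \<subseteq> el y \<Longrightarrow> z \<in> N A"
  using N_el[of y] subset_img_in_N[of z] by blast

lemma emp_in_N: "emp \<in> N A"
  by (rule subset_A_in_N) (auto intro: emp_in_M)

lemma omega_in_N: "omega \<in> N A"
  by (rule subset_A_in_N[OF omega_in_M omega_sub])

lemma union_in_N:
  assumes "x \<in> N A" shows "mk (\<Union>y\<in>el x. el y) \<in> N A"
proof -
  obtain f where f: "cover f A" "el x \<subseteq> img f A" using N_el[OF assms] by blast
  then have "(\<Union>y\<in>el x. el y) \<subseteq> img f A" using img_trans by blast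
  moreover have "mk (\<Union>y\<in>el x. el y) \<in> M" using assms N_sub_M union_in_M by blast
  ultimately show ?thesis using subset_img_in_N[OF _ f(1)] by simp
qed

text \<open>Each \<open>y\<close> comes with some cover, and one cover per \<open>x\<close> has to
  be chosen inside \<open>M\<close> to bound the transitive closure of the collecting set. Codes
  make this an instance of \<open>choice\<close>, uniqueness of the collapse recovers the cover from
  its code, and \<open>g\<close> merges the chosen covers into one.\<close>

lemma strong_collection:
  assumes a: "a \<in> N A" and Q: "M.absolute (\<lambda>e. Q (e 0) (e 1))"
    and ex: "\<And>x. x \<in> el a \<Longrightarrow> \<exists>y\<in>N A. Q x y"
  shows "\<exists>b\<in>N A. (\<forall>x\<in>el a. \<exists>y\<in>el b. Q x y) \<and> (\<forall>y\<in>el b. \<exists>x\<in>el a. Q x y)"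
proof -
  note QI = M.absolute_subst2[OF _ _ Q]
  have aM: "a \<in> M" using a N_sub_M by blast
  obtain f0 where f0: "cover f0 A" "el a \<subseteq> img f0 A" using N_el[OF a] by blast
  have f0M: "f0 \<in> M" using f0 by (simp add: cover_def)
  \<comment> \<open>Candidates for the choice: a relation on \<open>A\<close> coding a cover, paired
    with the index of the value.\<close>
  let ?PAA = "pw (mk ((\<lambda>(x, y). opair x y) ` (el A \<times> el A)))"
  let ?K = "mk ((\<lambda>(x, y). opair x y) ` (el ?PAA \<times> el A))"
  have PAA: "?PAA \<in> M" by (intro pw_in_M product_in_M A_M)
  have K: "?K \<in> M" by (intro product_in_M PAA A_M)
  define Q' where "Q' x p \<longleftrightarrow> (\<exists>c\<in>M. \<exists>i\<in>el A. \<exists>f\<in>M. \<exists>y\<in>M. p = opair c i \<and> (f \<in> M \<and> cover f A) \<and>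
    codes A c f \<and> opair i y \<in> el f \<and> Q x y)" for x p
  have "\<exists>p\<in>el ?K. Q' x p" if x: "x \<in> el a" for x
  proof -
    obtain y f i where y: "y \<in> M" "Q x y" and f: "cover f A" and i: "i \<in> el A" "opair i y \<in> el f"
      using ex[OF x] unfolding N_def img_def by blast
    obtain c where c: "c \<in> el ?PAA" "codes A c f" using code_exists[OF f A_M] by blast
    then have "c \<in> M" using PAA M_sub by blast
    moreover have "f \<in> M" using f by (simp add: cover_def)
    ultimately have "Q' x (opair c i)" unfolding Q'_def using y f i c by blast
    moreover have "opair c i \<in> el ?K" using c i by (auto simp: image_iff)
    ultimately show ?thesis by blast
  qed
  moreover have "M.absolute (\<lambda>e. Q' (e 0) (e 1))"
    unfolding Q'_def by (intro absolute_cover absolute_codes QI definable_intros A_M)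
  ultimately obtain G where G: "\<And>x. x \<in> el a \<Longrightarrow> G x \<in> el ?K \<and> Q' x (G x)"
    and gg_M: "mk ((\<lambda>x. opair x (G x)) ` el a) \<in> M"
    using choice[OF _ aM K] by blast
  define gg where "gg = mk ((\<lambda>x. opair x (G x)) ` el a)"
  have gg: "gg \<in> M" "opair x p \<in> el gg \<longleftrightarrow> x \<in> el a \<and> p = G x" for x p
    using gg_M by (auto simp: gg_def)
  \<comment> \<open>\<open>f\<close> is the cover decoded from the choice at \<open>x\<close>, and
    \<open>y\<close> its value at the chosen index. As \<open>gg\<close> is a set of
    \<open>M\<close>, this is definable without mentioning \<open>G\<close>.\<close>
  define S where "S x f y \<longleftrightarrow> (\<exists>c\<in>M. \<exists>i\<in>el A. opair x (opair c i) \<in> el gg \<and> (f \<in> M \<and> cover f A) \<and>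
    codes A c f \<and> opair i y \<in> el f)" for x f y
  have S_abs: "M.absolute (\<lambda>e. S (r e) (s e) (t e))"
    if "M.absolute_fun r" "M.absolute_fun s" "M.absolute_fun t" for r s t
  proof (rule M.absolute_subst3[OF that])
    show "M.absolute (\<lambda>e. S (e 0) (e 1) (e 2))"
      unfolding S_def by (intro absolute_cover absolute_codes definable_intros A_M gg)
  qed
  have S_uniq: "f = f' \<and> y = y'" if S: "S x f y" "S x f' y'" for x f f' y y'
  proof -
    obtain c i where 1: "i \<in> el A" "opair x (opair c i) \<in> el gg" "cover f A" "codes A c f" "opair i y \<in> el f"
      using S(1) unfolding S_def by blast
    obtain c' i' where 2: "opair x (opair c' i') \<in> el gg" "cover f' A" "codes A c' f'" "opair i' y' \<in> el f'"
      using S(2) unfolding S_def by blast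
    have eq: "c = c'" "i = i'" using 1 2 gg(2) by (metis opair_inject)+
    then have "f = f'" using codes_unique 1 2 by blast
    moreover have "y \<in> M" "y' \<in> M" using 1 2 img_sub_M eq unfolding img_def by blast+
    ultimately show ?thesis using 1 2 eq unfolding cover_def by metis
  qed
  have "\<exists>f y. S x f y \<and> Q x y \<and> y \<in> M" if x: "x \<in> el a" for x
  proof -
    obtain c i f y where *: "c \<in> M" "i \<in> el A" "f \<in> M" "y \<in> M" "G x = opair c i" "cover f A"
      "codes A c f" "opair i y \<in> el f" "Q x y"
      using G[OF x] unfolding Q'_def by blast
    then have "opair x (opair c i) \<in> el gg" using gg(2) x by metis
    then show ?thesis using * unfolding S_def by blast
  qed
  then obtain F Y where FY: "\<And>x. x \<in> el a \<Longrightarrow> S x (F x) (Y x) \<and> Q x (Y x) \<and> Y x \<in> M" by metis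
  have S_iff: "S x f y \<longleftrightarrow> f = F x \<and> y = Y x" if "x \<in> el a" for x f y
    using FY[OF that] S_uniq by metis
  have F: "F x \<in> M" "cover (F x) A" "\<exists>i\<in>el A. opair i (Y x) \<in> el (F x)" if "x \<in> el a" for x
    using FY[OF that] unfolding S_def by blast+
  define b where "b = mk (Y ` el a)"
  have bM: "b \<in> M"
    unfolding b_def
  proof (rule replacement[where Q = "\<lambda>x y. \<exists>f\<in>M. S x f y"])
    show "M.absolute (\<lambda>e. \<exists>f\<in>M. S (e 0) f (e 1))" by (intro S_abs definable_intros)
  qed (use FY aM S_iff F in auto)
  have el_b: "el b = Y ` el a" by (simp add: b_def)
  obtain k where k: "k \<in> el A" "opair k (opair (succ emp) emp) \<in> el g"
    using g_surj zero_one by blast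
  \<comment> \<open>An index decodes to a tag and \<open>\<beta>\<close>. Under tag
    \<open>emp\<close>, \<open>\<beta>\<close> decodes further to \<open>(p, q)\<close>, where
    \<open>p\<close> names \<open>x\<close> through \<open>f0\<close> and \<open>q\<close> names a
    value of the cover chosen for \<open>x\<close>; tag \<open>succ emp\<close> stands for
    \<open>b\<close> itself.\<close>
  define R where "R i u \<longleftrightarrow> (\<exists>\<alpha>\<in>el A. \<exists>\<beta>\<in>el A. opair i (opair \<alpha> \<beta>) \<in> el g \<and>
    (\<alpha> = emp \<and> (\<exists>p\<in>el A. \<exists>q\<in>el A. opair \<beta> (opair p q) \<in> el g \<and>
        (\<exists>x\<in>el a. opair p x \<in> el f0 \<and> (\<exists>f\<in>M. \<exists>y\<in>M. S x f y \<and> opair q u \<in> el f))) \<or>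
     \<alpha> = succ emp \<and> u = b))" for i u
  have E: "(\<exists>x\<in>el a. opair p x \<in> el f0 \<and> (\<exists>f\<in>M. \<exists>y\<in>M. S x f y \<and> opair q u \<in> el f)) \<longleftrightarrow>
      (\<exists>x\<in>el a. opair p x \<in> el f0 \<and> opair q u \<in> el (F x))" for p q u
    by (rule bex_cong[OF refl]) (use S_iff FY F(1) in auto)
  have R1: "R i u \<longleftrightarrow> u = b" if "opair i (opair (succ emp) \<beta>) \<in> el g" "\<beta> \<in> el A" for i u \<beta>
    unfolding R_def g_iff[OF that(1)] using that(2) zero_one by auto
  have R0: "R i u" if "x \<in> el a" "q \<in> el A" "opair q u \<in> el (F x)" "p \<in> el A" "opair p x \<in> el f0"
    "\<beta> \<in> el A" "opair \<beta> (opair p q) \<in> el g" "opair i (opair emp \<beta>) \<in> el g" for x q u p \<beta> i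
    unfolding R_def using that zero_one FY F(1) by blast
  have hit: "\<exists>j\<in>el A. R j w" if x: "x \<in> el a" and w: "w \<in> img (F x) A" for x w
  proof -
    obtain q where q: "q \<in> el A" "opair q w \<in> el (F x)" using w unfolding img_def by blast
    obtain p where p: "p \<in> el A" "opair p x \<in> el f0" using f0 x unfolding img_def by blast
    obtain \<beta> where \<beta>: "\<beta> \<in> el A" "opair \<beta> (opair p q) \<in> el g" using g_surj p q by blast
    obtain j where "j \<in> el A" "opair j (opair emp \<beta>) \<in> el g" using g_surj zero_one \<beta> by blast
    then show ?thesis using R0 x p q \<beta> by blast
  qed
  have cases: "u = b \<or> (\<exists>x\<in>el a. \<exists>p q \<beta>. opair i (opair emp \<beta>) \<in> el g \<and> opair \<beta> (opair p q) \<in> el g \<and>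
      p \<in> el A \<and> q \<in> el A \<and> opair p x \<in> el f0 \<and> opair q u \<in> el (F x))" if "R i u" for i u
    using that unfolding R_def E by blast
  have "b \<in> N A"
  proof (rule in_NI[where R = R and k = k])
    show "M.absolute (\<lambda>e. R (e 0) (e 1))"
      unfolding R_def by (intro S_abs definable_intros A_M g_M f0M bM aM)
  next
    fix i y z assume yz: "y \<in> M" "z \<in> M" "R i y" "R i z"
    obtain \<alpha> \<beta> where i: "opair i (opair \<alpha> \<beta>) \<in> el g" "\<beta> \<in> el A" "\<alpha> = emp \<or> \<alpha> = succ emp"
      using yz(3) unfolding R_def by blast
    show "y = z"
    proof (cases "\<alpha> = emp")
      case False
      then have "opair i (opair (succ emp) \<beta>) \<in> el g" using i by simp
      then show ?thesis using R1[OF _ i(2)] yz by simp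
    next
      case True
      have c: "\<exists>x\<in>el a. \<exists>p q. opair \<beta> (opair p q) \<in> el g \<and>
          p \<in> el A \<and> q \<in> el A \<and> opair p x \<in> el f0 \<and> opair q u \<in> el (F x)" if "R i u" for u
        using that True unfolding R_def E g_iff[OF i(1)] by auto
      obtain x p q where 1: "x \<in> el a" "opair \<beta> (opair p q) \<in> el g" "p \<in> el A" "q \<in> el A"
        "opair p x \<in> el f0" "opair q y \<in> el (F x)" using c[OF yz(3)] by blast
      obtain x' p' q' where 2: "x' \<in> el a" "opair \<beta> (opair p' q') \<in> el g"
        "opair p' x' \<in> el f0" "opair q' z \<in> el (F x')" using c[OF yz(4)] by blast
      have pq: "p = p'" "q = q'" using g_fun[OF 1(2) 2(2)] by simp_all
      have "x \<in> M" "x' \<in> M" using 1 2 aM M_sub by blast+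
      then have "x = x'" using 1 2 pq f0(1) unfolding cover_def by metis
      then show ?thesis using 1 2 pq yz F(2) unfolding cover_def by metis
    qed
  next
    fix i u w assume u: "u \<in> M" "R i u" "w \<in> el u"
    from cases[OF u(2)] show "\<exists>j\<in>el A. R j w"
    proof
      assume "u = b"
      then obtain x where x: "x \<in> el a" "w = Y x" using u el_b by auto
      then show ?thesis using hit[OF x(1)] F(3)[OF x(1)] unfolding img_def by blast
    next
      assume "\<exists>x\<in>el a. \<exists>p q \<beta>. opair i (opair emp \<beta>) \<in> el g \<and> opair \<beta> (opair p q) \<in> el g \<and>
        p \<in> el A \<and> q \<in> el A \<and> opair p x \<in> el f0 \<and> opair q u \<in> el (F x)"
      then obtain x q where x: "x \<in> el a" "q \<in> el A" "opair q u \<in> el (F x)" by blast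
      then have "u \<in> img (F x) A" unfolding img_def by blast
      then have "w \<in> img (F x) A" using img_trans[OF F(2)[OF x(1)]] u by blast
      then show ?thesis using hit x by blast
    qed
  next
    show "R k b" using R1[OF k(2) zero_one(1)] by simp
  qed (use A_M k bM in auto)
  moreover have "(\<forall>x\<in>el a. \<exists>y\<in>el b. Q x y) \<and> (\<forall>y\<in>el b. \<exists>x\<in>el a. Q x y)"
    using FY el_b by auto
  ultimately show ?thesis by blast
qed

end


context index_set
begin

text \<open>Collection over the two tags gives a set in \<open>N A\<close> containing both points,
  and \<open>N A\<close> is closed under subsets in \<open>M\<close>.\<close>

lemma upair_in_N:
  assumes "x \<in> N A" "y \<in> N A" shows "upair x y \<in> N A"
proof -
  have M: "x \<in> M" "y \<in> M" using assms N_sub_M by auto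
  have "upair emp (succ emp) \<in> N A"
    using zero_one M_sub[OF A_M] by (intro subset_A_in_N upair_in_M) auto
  moreover have "M.absolute (\<lambda>e. e 0 = emp \<and> e 1 = x \<or> e 0 = succ emp \<and> e 1 = y)"
    by (intro definable_intros M)
  ultimately obtain b where b: "b \<in> N A" "\<forall>u\<in>{emp, succ emp}. \<exists>v\<in>el b. u = emp \<and> v = x \<or> u = succ emp \<and> v = y"
    using strong_collection[where Q = "\<lambda>u v. u = emp \<and> v = x \<or> u = succ emp \<and> v = y"
        and a = "upair emp (succ emp)"] assms by auto
  then have "el (upair x y) \<subseteq> el b" by auto
  then show ?thesis using subset_in_N[OF upair_in_M[OF M] b(1)] by blast
qed

lemma adj_in_N:
  assumes "x \<in> N A" "y \<in> N A" shows "mk (insert x (el y)) \<in> N A"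
proof -
  have "mk (\<Union>z\<in>el (upair y (upair x x)). el z) \<in> N A" using assms by (intro union_in_N upair_in_N)
  moreover have "(\<Union>z\<in>el (upair y (upair x x)). el z) = insert x (el y)" by auto
  ultimately show ?thesis by simp
qed

lemma AC_in_N:
  assumes "a \<in> N A" "\<And>x. x \<in> el a \<Longrightarrow> el x \<noteq> {}"
    and "\<And>x y. x \<in> el a \<Longrightarrow> y \<in> el a \<Longrightarrow> x \<noteq> y \<Longrightarrow> el x \<inter> el y = {}"
  shows "\<exists>b\<in>N A. \<forall>x\<in>el a. \<exists>z\<in>el b. z \<in> el x \<and> (\<forall>w\<in>el x. w \<in> el b \<longrightarrow> w = z)"
proof -
  have "a \<in> M" using assms(1) N_sub_M by blast
  then obtain b where b: "b \<in> M" "\<forall>x\<in>el a. \<exists>z\<in>el b. z \<in> el x \<and> (\<forall>w\<in>el x. w \<in> el b \<longrightarrow> w = z)"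
    using satisfies_AC[OF _ assms(2,3)] by blast
  define U where "U = mk (\<Union>x\<in>el a. el x)"
  have U: "U \<in> N A" "el U = (\<Union>x\<in>el a. el x)" using union_in_N[OF assms(1)] by (auto simp: U_def)
  \<comment> \<open>The choice set in \<open>M\<close> need not lie in \<open>N A\<close>; cutting
    it down to the union of \<open>a\<close> brings it there.\<close>
  define b' where "b' = mk {z \<in> el b. z \<in> el U}"
  have el_b': "el b' = el b \<inter> el U"
    unfolding b'_def by (subst el_mk) (auto intro: countable_subset[OF _ countable_el[of b]])
  have "b' \<in> M"
    unfolding b'_def using U N_sub_M by (intro separation definable_intros b) auto
  then have "b' \<in> N A" using subset_in_N U(1) el_b' by blast
  moreover have "\<forall>x\<in>el a. \<exists>z\<in>el b'. z \<in> el x \<and> (\<forall>w\<in>el x. w \<in> el b' \<longrightarrow> w = z)"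
    using b(2) unfolding el_b' U(2) by (meson IntE IntI UN_I)
  ultimately show ?thesis by blast
qed

text \<open>A subset of \<open>A\<close> codes two subsets, namely its sections at the tags
  \<open>emp\<close> and \<open>succ emp\<close> under \<open>g\<close>; so the power set maps onto
  its own square.\<close>

lemma index_set_pw: "\<exists>h. index_set M (pw A) h"
proof -
  have PM: "pw A \<in> M" by (rule pw_in_M[OF A_M])
  have el_sub: "el Z \<subseteq> el A" "Z \<in> M" if "Z \<in> el (pw A)" for Z using that by (auto simp: el_pw)
  define D where "D c Z = mk {x \<in> el A. \<exists>i\<in>el Z. opair i (opair c x) \<in> el g}" for c Z
  have el_D: "el (D c Z) = {x \<in> el A. \<exists>i\<in>el Z. opair i (opair c x) \<in> el g}" for c Z
    unfolding D_def by (auto intro!: el_mk countable_subset[OF _ countable_el[of A]])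
  have DM: "D c Z \<in> M" if "c \<in> M" "Z \<in> M" for c Z
    unfolding D_def using that by (intro separation definable_intros A_M g_M)
  have D_iff: "d = D c Z \<longleftrightarrow> (\<forall>x\<in>el d. x \<in> el A \<and> (\<exists>i\<in>el Z. opair i (opair c x) \<in> el g)) \<and>
      (\<forall>x\<in>el A. \<forall>i\<in>el Z. opair i (opair c x) \<in> el g \<longrightarrow> x \<in> el d)" for d c Z
    unfolding el_inject[of d, symmetric] el_D by blast
  have nums: "emp \<in> M" "succ emp \<in> M" using zero_one M_sub[OF A_M] by auto
  define h where "h = mk ((\<lambda>Z. opair Z (opair (D emp Z) (D (succ emp) Z))) ` el (pw A))"
  have hM: "h \<in> M"
    unfolding h_def
  proof (rule replacement[where Q = "\<lambda>Z u. \<exists>x\<in>M. \<exists>y\<in>M. u = opair Z (opair x y) \<and> x = D emp Z \<and> y = D (succ emp) Z"])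
    show "M.absolute (\<lambda>e. \<exists>x\<in>M. \<exists>y\<in>M. e 1 = opair (e 0) (opair x y) \<and> x = D emp (e 0) \<and> y = D (succ emp) (e 0))"
      unfolding D_iff by (intro definable_intros A_M g_M)
  qed (use PM el_sub DM nums opair_in_M in auto)
  have A_sub: "el A \<subseteq> el (pw A)" using A_trans M_sub[OF A_M] by (auto simp: el_pw)
  have "index_set M (pw A) h"
  proof
    show "el x \<subseteq> el (pw A)" if "x \<in> el (pw A)" for x using el_sub[OF that] A_sub by blast
    show "el omega \<subseteq> el (pw A)" using omega_sub A_sub by blast
    show "u = u'" if "opair i u \<in> el h" "opair i u' \<in> el h" for i u u' using that by (auto simp: h_def)
    fix X Y assume XY: "X \<in> el (pw A)" "Y \<in> el (pw A)"
    \<comment> \<open>The preimage under \<open>g\<close> of the disjoint union of \<open>X\<close>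
      and \<open>Y\<close>.\<close>
    define Z where "Z = mk {i \<in> el A. (\<exists>x\<in>el X. opair i (opair emp x) \<in> el g) \<or>
        (\<exists>y\<in>el Y. opair i (opair (succ emp) y) \<in> el g)}"
    have el_Z: "el Z = {i \<in> el A. (\<exists>x\<in>el X. opair i (opair emp x) \<in> el g) \<or>
        (\<exists>y\<in>el Y. opair i (opair (succ emp) y) \<in> el g)}"
      unfolding Z_def by (auto intro!: el_mk countable_subset[OF _ countable_el[of A]])
    have "Z \<in> M" unfolding Z_def using XY el_sub by (intro separation definable_intros A_M g_M) auto
    then have Z: "Z \<in> el (pw A)" using el_Z by (auto simp: el_pw)
    have X: "(\<exists>i\<in>el Z. opair i (opair emp x) \<in> el g) \<longleftrightarrow> x \<in> el X" if "x \<in> el A" for x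
    proof
      assume "\<exists>i\<in>el Z. opair i (opair emp x) \<in> el g"
      then obtain i where i: "i \<in> el Z" "opair i (opair emp x) \<in> el g" by blast
      then show "x \<in> el X" unfolding el_Z using g_iff[OF i(2)] by simp
    next
      assume "x \<in> el X"
      then show "\<exists>i\<in>el Z. opair i (opair emp x) \<in> el g"
        using g_surj[OF zero_one(1) that] unfolding el_Z by blast
    qed
    have Y: "(\<exists>i\<in>el Z. opair i (opair (succ emp) x) \<in> el g) \<longleftrightarrow> x \<in> el Y" if "x \<in> el A" for x
    proof
      assume "\<exists>i\<in>el Z. opair i (opair (succ emp) x) \<in> el g"
      then obtain i where i: "i \<in> el Z" "opair i (opair (succ emp) x) \<in> el g" by blast
      then show "x \<in> el Y" unfolding el_Z using g_iff[OF i(2)] by simp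
    next
      assume "x \<in> el Y"
      then show "\<exists>i\<in>el Z. opair i (opair (succ emp) x) \<in> el g"
        using g_surj[OF zero_one(2) that] unfolding el_Z by blast
    qed
    have "D emp Z = X" "D (succ emp) Z = Y"
      unfolding el_inject[symmetric] el_D using X Y el_sub(1)[OF XY(1)] el_sub(1)[OF XY(2)] by blast+
    then have "opair Z (opair X Y) \<in> el h" using Z by (auto simp: h_def image_iff)
    then show "\<exists>i\<in>el (pw A). opair i (opair X Y) \<in> el h" using Z by blast
  qed (use PM hM in auto)
  then show ?thesis by blast
qed

end

section \<open>The iterated power sets of \<open>V_omega\<close> and the domains
  \<open>NN n\<close>\<close>

context ctm
begin

lemma absolute_pw: "M.absolute (\<lambda>e. e 0 = pw (e 1))"
proof (rule M.absolute_cong)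
  show "M.absolute (\<lambda>e. \<forall>u\<in>M. u \<in> el (e 0) \<longleftrightarrow> (\<forall>w\<in>el u. w \<in> el (e 1)))"
    by (intro definable_intros)
  show "(e 0 = pw (e 1)) = (\<forall>u\<in>M. u \<in> el (e 0) \<longleftrightarrow> (\<forall>w\<in>el u. w \<in> el (e 1)))"
    if "M.env v e" for v e
  proof -
    have "e 0 \<in> M" "el (pw (e 1)) \<subseteq> M" using that by (auto simp: el_pw)
    then show ?thesis by (simp add: M_eq_iff el_pw subset_iff Ball_def)
  qed
qed

definition vset :: "nat \<Rightarrow> hc" where "vset n = (pw ^^ n) emp"

lemma vset_simps: "vset 0 = emp" "vset (Suc n) = pw (vset n)"
  by (simp_all add: vset_def)

definition V_omega :: hc where "V_omega = mk (\<Union>n. el (vset n))"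

lemma el_V_omega: "el V_omega = (\<Union>n. el (vset n))"
  by (simp add: V_omega_def)

lemma vset_in_M: "vset n \<in> M"
  by (induction n) (auto simp: vset_simps emp_in_M pw_in_M)

lemma V_omega_in_M: "V_omega \<in> M"
proof -
  \<comment> \<open>\<open>THE\<close> merely reads the stage off the numeral; the graph of
    \<open>F\<close> on \<open>omega\<close> is definable by
    \<open>absolute_iterate\<close>.\<close>
  define F where "F x = vset (THE n. x = num n)" for x
  have F: "F (num n) = vset n" for n by (simp add: F_def)
  have "mk (F ` el omega) \<in> M"
  proof (rule replacement[where Q = "\<lambda>x z. \<exists>n. x = num n \<and> z = (pw ^^ n) emp"])
    show "M.absolute (\<lambda>e. \<exists>n. e 0 = num n \<and> e 1 = (pw ^^ n) emp)"
    proof (rule M.absolute_iterate[OF absolute_pw])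
      show "(pw ^^ i) x \<in> M" if "x \<in> M" for x i using that by (induction i) (auto intro: pw_in_M)
    qed (intro definable_intros)+
  qed (use F omega_in_M vset_in_M in \<open>auto simp: vset_def\<close>)
  from union_in_M[OF this] have "mk (\<Union>x\<in>range num. el (F x)) \<in> M" by simp
  moreover have "(\<Union>x\<in>range num. el (F x)) = (\<Union>n. el (vset n))" by (auto simp: F)
  ultimately show ?thesis by (simp add: V_omega_def)
qed

lemma vset_Suc: "el (vset n) \<subseteq> el (vset (Suc n))"
proof (induction n)
  case (Suc n)
  show ?case
  proof
    fix u assume "u \<in> el (vset (Suc n))"
    then have "u \<in> M" "el u \<subseteq> el (vset (Suc n))" using Suc by (auto simp: vset_simps(2) el_pw)
    then show "u \<in> el (vset (Suc (Suc n)))" unfolding vset_simps(2)[of "Suc n"] el_pw by blast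
  qed
qed (simp add: vset_simps)

lemma vset_mono: "m \<le> n \<Longrightarrow> el (vset m) \<subseteq> el (vset n)"
  by (rule lift_Suc_mono_le[of "\<lambda>n. el (vset n)"]) (rule vset_Suc)

lemma vset_subset_V_omega: "u \<in> M \<Longrightarrow> el u \<subseteq> el (vset n) \<Longrightarrow> u \<in> el V_omega"
  unfolding el_V_omega using vset_simps(2)[of n] by (auto simp: el_pw intro!: exI[of _ "Suc n"])

lemma upair_in_V_omega:
  assumes "x \<in> el V_omega" "y \<in> el V_omega" shows "upair x y \<in> el V_omega"
proof -
  obtain m n where mn: "x \<in> el (vset m)" "y \<in> el (vset n)" using assms by (auto simp: el_V_omega)
  then have "x \<in> el (vset (max m n))" "y \<in> el (vset (max m n))"
    using vset_mono[of m "max m n"] vset_mono[of n "max m n"] by auto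
  moreover have "x \<in> M" "y \<in> M" using mn M_sub[OF vset_in_M] by auto
  ultimately show ?thesis by (intro vset_subset_V_omega[of _ "max m n"] upair_in_M) auto
qed

text \<open>\<open>V_omega\<close> is closed under pairing, so every pair can be its own index and
  \<open>g\<close> is the identity. This makes \<open>V_omega\<close> a convenient starting
  point.\<close>

lemma V_omega_index: "\<exists>g. index_set M V_omega g"
proof -
  let ?g = "mk ((\<lambda>i. opair i i) ` el V_omega)"
  have sub: "el V_omega \<subseteq> M" by (rule M_sub[OF V_omega_in_M])
  have "index_set M V_omega ?g"
  proof
    show "?g \<in> M"
      by (rule replacement[where Q = "\<lambda>i u. u = opair i i"])
        (use sub in \<open>auto intro!: definable_intros V_omega_in_M opair_in_M\<close>)
    show "el x \<subseteq> el V_omega" if x: "x \<in> el V_omega" for x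
    proof -
      obtain n where "x \<in> el (vset n)" using x by (auto simp: el_V_omega)
      then obtain k where "x \<in> el (vset (Suc k))" by (cases n) (auto simp: vset_simps(1))
      then show ?thesis by (auto simp: vset_simps(2) el_pw el_V_omega)
    qed
    have "num n \<in> el (vset (Suc n)) \<and> num n \<in> M" for n
    proof (induction n rule: less_induct)
      case (less n)
      have "num n \<in> M" using M.num_in_D by simp
      moreover have "el (num n) \<subseteq> el (vset n)"
      proof -
        have "num k \<in> el (vset n)" if "k < n" for k
          using less[OF that] vset_mono[of "Suc k" n] that by auto
        then show ?thesis by (auto simp: el_num)
      qed
      ultimately show ?case by (simp add: vset_simps(2) el_pw)
    qed
    then show "el omega \<subseteq> el V_omega" unfolding el_V_omega el_omega by blast
    show "\<exists>i\<in>el V_omega. opair i (opair a b) \<in> el ?g" if "a \<in> el V_omega" "b \<in> el V_omega" for a b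
    proof (rule bexI)
      show "opair a b \<in> el V_omega" unfolding opair_def by (intro upair_in_V_omega that)
      then show "opair (opair a b) (opair a b) \<in> el ?g" by simp
    qed
  qed (auto simp: V_omega_in_M)
  then show ?thesis by blast
qed

definition kap :: "nat \<Rightarrow> hc" where "kap n = (pw ^^ n) V_omega"

lemma kap_simps: "kap 0 = V_omega" "kap (Suc n) = pw (kap n)"
  by (simp_all add: kap_def)

lemma kap_index: "\<exists>g. index_set M (kap n) g"
proof (induction n)
  case 0 then show ?case using V_omega_index by (simp add: kap_simps)
next
  case (Suc n) then show ?case using index_set.index_set_pw by (auto simp: kap_simps)
qed

lemma kap_in_M: "kap n \<in> M"
  using kap_index[of n] by (auto dest: index_set.A_M)

lemma kap_mono: "m \<le> n \<Longrightarrow> el (kap m) \<subseteq> el (kap n)"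
proof (rule lift_Suc_mono_le[of "\<lambda>n. el (kap n)"])
  fix n
  obtain g where "index_set M (kap n) g" using kap_index by blast
  then show "el (kap n) \<subseteq> el (kap (Suc n))"
    using index_set.A_trans M_sub[OF kap_in_M[of n]] unfolding kap_simps el_pw by blast
qed

definition NN :: "nat \<Rightarrow> hc set" where "NN n = N (kap n)"

lemma NN_mono: "m \<le> n \<Longrightarrow> NN m \<subseteq> NN n"
  unfolding NN_def by (intro N_mono kap_in_M kap_mono)

lemma kap_mem: "m < n \<Longrightarrow> kap m \<in> el (kap n)"
proof -
  assume "m < n"
  have "kap m \<in> el (kap (Suc m))" using kap_in_M by (simp add: kap_simps(2) el_pw)
  then show ?thesis using kap_mono[of "Suc m" n] \<open>m < n\<close> by auto
qed

lemma kap_in_NN_iff: "kap m \<in> NN n \<longleftrightarrow> m \<le> n"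
proof
  assume "m \<le> n"
  obtain g where "index_set M (kap m) g" using kap_index by blast
  then have "kap m \<in> NN m" unfolding NN_def by (rule index_set.A_in_N)
  then show "kap m \<in> NN n" using NN_mono \<open>m \<le> n\<close> by blast
next
  assume m: "kap m \<in> NN n"
  show "m \<le> n"
  proof (rule ccontr)
    assume "\<not> m \<le> n"
    \<comment> \<open>\<open>kap (Suc n)\<close> is \<open>kap m\<close> or one of its elements,
      hence in the transitive \<open>NN n\<close>; but it is the power set of
      \<open>kap n\<close>.\<close>
    then have "m = Suc n \<or> Suc n < m" by auto
    then have "kap (Suc n) \<in> NN n"
      using m N_trans[OF m[unfolded NN_def] kap_mem] by (auto simp: NN_def)
    then show False using pw_notin_N[OF kap_in_M[of n]] by (simp add: NN_def kap_simps)
  qed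
qed

lemma kap_inject [simp]: "kap m = kap n \<longleftrightarrow> m = n"
  using kap_mem mem_irrefl by (metis nat_neq_iff)

lemma NN_sub_M: "NN n \<subseteq> M"
  by (simp add: NN_def N_sub_M)

lemma NN_trans: "y \<in> NN n \<Longrightarrow> x \<in> el y \<Longrightarrow> x \<in> NN n"
  unfolding NN_def by (rule N_trans)

lemma
  shows NN_emp: "emp \<in> NN n" and NN_omega: "omega \<in> NN n"
    and NN_adj: "x \<in> NN n \<Longrightarrow> y \<in> NN n \<Longrightarrow> mk (insert x (el y)) \<in> NN n"
    and NN_upair: "x \<in> NN n \<Longrightarrow> y \<in> NN n \<Longrightarrow> upair x y \<in> NN n"
    and NN_union: "x \<in> NN n \<Longrightarrow> mk (\<Union>y\<in>el x. el y) \<in> NN n"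
    and NN_subset: "z \<in> M \<Longrightarrow> y \<in> NN n \<Longrightarrow> el z \<subseteq> el y \<Longrightarrow> z \<in> NN n"
proof -
  obtain g where "index_set M (kap n) g" using kap_index by blast
  then interpret index_set M "kap n" g .
  show "emp \<in> NN n" "omega \<in> NN n"
    "x \<in> NN n \<Longrightarrow> y \<in> NN n \<Longrightarrow> mk (insert x (el y)) \<in> NN n"
    "x \<in> NN n \<Longrightarrow> y \<in> NN n \<Longrightarrow> upair x y \<in> NN n"
    "x \<in> NN n \<Longrightarrow> mk (\<Union>y\<in>el x. el y) \<in> NN n"
    "z \<in> M \<Longrightarrow> y \<in> NN n \<Longrightarrow> el z \<subseteq> el y \<Longrightarrow> z \<in> NN n"
    unfolding NN_def
    by (fact emp_in_N omega_in_N adj_in_N upair_in_N union_in_N subset_in_N)+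
qed

lemma NN_strong_collection:
  assumes "a \<in> NN n" "M.absolute (\<lambda>e. Q (e 0) (e 1))" "\<And>x. x \<in> el a \<Longrightarrow> \<exists>y\<in>NN n. Q x y"
  shows "\<exists>b\<in>NN n. (\<forall>x\<in>el a. \<exists>y\<in>el b. Q x y) \<and> (\<forall>y\<in>el b. \<exists>x\<in>el a. Q x y)"
proof -
  obtain g where "index_set M (kap n) g" using kap_index by blast
  from index_set.strong_collection[OF this assms[unfolded NN_def]] show ?thesis
    unfolding NN_def .
qed

lemma NN_AC:
  assumes "a \<in> NN n" "\<And>x. x \<in> el a \<Longrightarrow> el x \<noteq> {}"
    and "\<And>x y. x \<in> el a \<Longrightarrow> y \<in> el a \<Longrightarrow> x \<noteq> y \<Longrightarrow> el x \<inter> el y = {}"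
  shows "\<exists>b\<in>NN n. \<forall>x\<in>el a. \<exists>z\<in>el b. z \<in> el x \<and> (\<forall>w\<in>el x. w \<in> el b \<longrightarrow> w = z)"
proof -
  obtain g where "index_set M (kap n) g" using kap_index by blast
  from index_set.AC_in_N[OF this assms[unfolded NN_def]] show ?thesis unfolding NN_def .
qed

lemma satisfies_cong:
  "well_formed set_ar \<phi> \<Longrightarrow> (\<And>i. i \<in> fv \<phi> \<Longrightarrow> e i = e' i) \<Longrightarrow> satisfies M e \<phi> = satisfies M e' \<phi>"
proof (induction \<phi> arbitrary: e e')
  case (Rel R xs)
  then show ?case by (auto simp: set_ar_def dest!: length_2D split: set_sym.split)
next
  case (Forall \<phi>)
  have "satisfies M (case_nat a e) \<phi> = satisfies M (case_nat a e') \<phi>" for a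
    by (rule Forall.IH) (use Forall.prems in \<open>auto split: nat.split\<close>)
  then show ?case by simp
next
  case (Exists \<phi>)
  have "satisfies M (case_nat a e) \<phi> = satisfies M (case_nat a e') \<phi>" for a
    by (rule Exists.IH) (use Exists.prems in \<open>auto split: nat.split\<close>)
  then show ?case by simp
next
  case (Conj \<phi> \<psi>)
  show ?case using Conj.IH[of e e'] Conj.prems by simp
next
  case (Disj \<phi> \<psi>)
  show ?case using Disj.IH[of e e'] Disj.prems by simp
next
  case (Impl \<phi> \<psi>)
  show ?case using Impl.IH[of e e'] Impl.prems by simp
qed simp

text \<open>The finitely many values of \<open>e\<close> that the free variables can reach become
  parameters.\<close>

lemma absolute_satisfies:
  assumes wf: "well_formed set_ar \<phi>" and e: "range e \<subseteq> M"
  shows "M.absolute (\<lambda>e'. satisfies M (map e' is @@ e) \<phi>)"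
proof -
  obtain n where n: "\<forall>i\<in>fv \<phi>. i < n" using finite_fv[of \<phi>] by (meson finite_nat_set_iff_bounded)
  let ?cs = "map e [0..<n]"
  let ?f = "\<lambda>i. if i < length is then n + is ! i else i - length is"
  have "satisfies M (?cs @@ e') (rename ?f \<phi>) = satisfies M (map e' is @@ e) \<phi>" for e'
    unfolding satisfies_rename[OF wf]
    by (rule satisfies_cong[OF wf]) (use n in \<open>auto simp: append_env_def less_imp_diff_less\<close>)
  then show ?thesis
    using wf e by (intro M.absoluteI[of "rename ?f \<phi>" ?cs]) (auto simp: forces_single)
qed

end

lemma delta0_well_formed: "delta0 \<phi> \<Longrightarrow> well_formed set_ar \<phi>"
  by (induction rule: delta0.induct) (auto simp: set_ar_def ForallIn_def ExistsIn_def)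

section \<open>Kripke models with domains \<open>NN n\<close>: bounded formulas and defined
  notions\<close>

locale height_model = ctm M for M +
  fixes W :: "'w set" and le :: "'w \<Rightarrow> 'w \<Rightarrow> bool" and ht :: "'w \<Rightarrow> nat"
  assumes w_refl: "v \<in> W \<Longrightarrow> le v v"
    and w_trans: "u \<in> W \<Longrightarrow> v \<in> W \<Longrightarrow> w \<in> W \<Longrightarrow> le u v \<Longrightarrow> le v w \<Longrightarrow> le u w"
    and ht_mono: "v \<in> W \<Longrightarrow> w \<in> W \<Longrightarrow> le v w \<Longrightarrow> ht v \<le> ht w"
begin

abbreviation D :: "'w \<Rightarrow> hc set" where "D v \<equiv> NN (ht v)"

text \<open>\<open>C\<close> is empty because the translation of an atom has to be a formula without
  parameters.\<close>

sublocale K: absoluteness_omega W le D "{}"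
  by unfold_locales (auto intro: w_refl w_trans NN_emp NN_omega NN_adj NN_trans
      dest: NN_mono[OF ht_mono])

lemma D_el: "a \<in> D v \<Longrightarrow> el a \<subseteq> D v"
  using NN_trans by blast

lemma env_D: "K.env v e \<Longrightarrow> e i \<in> D v"
  by (rule K.env_nth)

lemma env_M: "K.env v e \<Longrightarrow> range e \<subseteq> M"
  using NN_sub_M by (auto simp: K.env_def)

lemma frc_ForallIn:
  assumes "K.env v e"
  shows "K.frc v e (ForallIn a \<phi>) \<longleftrightarrow> (\<forall>w\<in>W. le v w \<longrightarrow> (\<forall>x\<in>el (e a). K.frc w (case_nat x e) \<phi>))"
    (is "?L \<longleftrightarrow> ?R")
proof
  assume L: ?L
  show ?R
  proof (intro ballI impI)
    fix w x assume w: "w \<in> W" "le v w" "x \<in> el (e a)"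
    have "x \<in> D w" using D_el[OF env_D[OF K.env_mono[OF assms w(1,2)]]] w(3) by blast
    then show "K.frc w (case_nat x e) \<phi>"
      using L w w_refl[OF w(1)] by (auto simp: ForallIn_def)
  qed
next
  assume R: ?R
  show ?L
    unfolding ForallIn_def forces.simps
  proof (intro ballI impI)
    fix w x w' assume *: "w \<in> W" "le v w" "w' \<in> W" "le w w'"
      and "case In of In \<Rightarrow> case_nat x e ([0, Suc a] ! 0) \<in> el (case_nat x e ([0, Suc a] ! 1)) |
        Eq \<Rightarrow> case_nat x e ([0, Suc a] ! 0) = case_nat x e ([0, Suc a] ! 1)"
    then show "K.frc w' (case_nat x e) \<phi>"
      using R w_trans[of v w w'] assms by (auto simp: K.env_def)
  qed
qed

lemma frc_ExistsIn:
  assumes "K.env v e"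
  shows "K.frc v e (ExistsIn a \<phi>) \<longleftrightarrow> (\<exists>x\<in>el (e a). K.frc v (case_nat x e) \<phi>)"
  using D_el[OF env_D[OF assms, of a]] by (auto simp: ExistsIn_def)

lemma frc_not:
  "K.frc v e (\<^bold>\<not> \<phi>) \<longleftrightarrow> (\<forall>w\<in>W. le v w \<longrightarrow> \<not> K.frc w e \<phi>)"
  by auto

text \<open>The members of \<open>e a\<close> lie in the current domain and no later world adds any,
  so bounded quantifiers range over the same set at all later worlds and in
  \<open>M\<close>.\<close>

lemma frc_delta0: "delta0 \<phi> \<Longrightarrow> K.env v e \<Longrightarrow> K.frc v e \<phi> \<longleftrightarrow> satisfies M e \<phi>"
proof (induction arbitrary: v e rule: delta0.induct)
  case (6 \<phi> \<psi>)
  then show ?case using K.env_mono[OF 6(5)] w_refl[of v] by (auto simp: K.env_def)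
next
  case (7 \<phi> a)
  have v: "v \<in> W" "le v v" using 7 w_refl by (auto simp: K.env_def)
  have "K.frc w (case_nat x e) \<phi> \<longleftrightarrow> satisfies M (case_nat x e) \<phi>"
    if "w \<in> W" "le v w" "x \<in> el (e a)" for w x
  proof (rule 7(2), rule K.env_case)
    show "K.env w e" using K.env_mono 7(3) that by blast
    then show "x \<in> D w" using D_el[OF env_D, of w e a] that by blast
  qed
  then have "K.frc v e (ForallIn a \<phi>) \<longleftrightarrow> (\<forall>x\<in>el (e a). satisfies M (case_nat x e) \<phi>)"
    unfolding frc_ForallIn[OF 7(3)] using v by blast
  moreover have "el (e a) \<subseteq> M" using D_el[OF env_D[OF 7(3)]] NN_sub_M by blast
  ultimately show ?case by (auto simp: ForallIn_def hc_mem_iff)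
next
  case (8 \<phi> a)
  have "K.frc v (case_nat x e) \<phi> \<longleftrightarrow> satisfies M (case_nat x e) \<phi>" if "x \<in> el (e a)" for x
    using D_el[OF env_D[OF 8(3)]] that by (intro 8(2) K.env_case[OF 8(3)]) blast
  then have "K.frc v e (ExistsIn a \<phi>) \<longleftrightarrow> (\<exists>x\<in>el (e a). satisfies M (case_nat x e) \<phi>)"
    unfolding frc_ExistsIn[OF 8(3)] by blast
  moreover have "el (e a) \<subseteq> M" using D_el[OF env_D[OF 8(3)]] NN_sub_M by blast
  ultimately show ?case by (auto simp: ExistsIn_def hc_mem_iff)
qed (auto simp: hc_mem_iff)

text \<open>Notions such as \<open>is_succ\<close> are written with an unbounded quantifier. Later
  domains offer new candidates for it, but the elements of both sides are all in the current
  domain.\<close>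

lemma frc_set_eq:
  assumes e: "K.env v e"
    and \<phi>: "\<And>w a. K.env w (case_nat a e) \<Longrightarrow> K.frc w (case_nat a e) \<phi> \<longleftrightarrow> a \<in> S" and S: "S \<subseteq> D v"
  shows "K.frc v e (Forall (0 \<^bold>\<in> Suc p \<^bold>\<longleftrightarrow> \<phi>)) \<longleftrightarrow> el (e p) = S"
proof -
  have v: "v \<in> W" "le v v" using e w_refl by (auto simp: K.env_def)
  have \<phi>': "K.frc w (case_nat a e) \<phi> \<longleftrightarrow> a \<in> S"
    if "u \<in> W" "le v u" "a \<in> D u" "w \<in> W" "le u w" for u w a
  proof (rule \<phi>)
    have "K.env u (case_nat a e)" using K.env_case[OF K.env_mono[OF e]] that by blast
    then show "K.env w (case_nat a e)" using K.env_mono that by blast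
  qed
  have "K.frc v e (Forall (0 \<^bold>\<in> Suc p \<^bold>\<longleftrightarrow> \<phi>)) \<longleftrightarrow>
      (\<forall>u\<in>W. le v u \<longrightarrow> (\<forall>a\<in>D u. \<forall>w\<in>W. le u w \<longrightarrow> (a \<in> el (e p) \<longleftrightarrow> a \<in> S)))"
    using \<phi>' by (simp cong: ball_cong) blast
  also have "\<dots> \<longleftrightarrow> (\<forall>a\<in>D v. a \<in> el (e p) \<longleftrightarrow> a \<in> S)"
  proof
    assume "\<forall>a\<in>D v. a \<in> el (e p) \<longleftrightarrow> a \<in> S"
    then have "el (e p) = S" using D_el[OF env_D[OF e]] S by blast
    then show "\<forall>u\<in>W. le v u \<longrightarrow> (\<forall>a\<in>D u. \<forall>w\<in>W. le u w \<longrightarrow> (a \<in> el (e p) \<longleftrightarrow> a \<in> S))" by blast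
  qed (use v in blast)
  also have "\<dots> \<longleftrightarrow> el (e p) = S" using D_el[OF env_D[OF e], of p] S by blast
  finally show ?thesis .
qed

lemma env_caseD: "K.env w (case_nat a e) \<Longrightarrow> a \<in> D w \<and> w \<in> W \<and> K.env w e"
  unfolding K.env_def by (auto simp: image_subset_iff) (metis nat.case)+

lemma frc_is_empty:
  assumes "K.env v e" shows "K.frc v e (is_empty x) \<longleftrightarrow> e x = emp"
proof -
  have "K.frc v e (is_empty x) \<longleftrightarrow> el (e x) = {}"
    using assms w_refl unfolding is_empty_def frc_ForallIn[OF assms] by (auto simp: K.env_def)
  then show ?thesis by (metis el_emp el_inject)
qed

lemma frc_is_succ: "K.env v e \<Longrightarrow> K.frc v e (is_succ s x) \<longleftrightarrow> e s = succ (e x)"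
  unfolding is_succ_def el_inject[of "e s", symmetric] el_succ
  by (rule frc_set_eq) (use D_el[OF env_D, of v e x] env_D[of v e x] in auto)

lemma frc_is_upair: "K.env v e \<Longrightarrow> K.frc v e (is_upair p x y) \<longleftrightarrow> e p = upair (e x) (e y)"
  unfolding is_upair_def el_inject[of "e p", symmetric] el_upair
  by (rule frc_set_eq) (use env_D[of v e] in auto)

lemma frc_is_pair: "K.env v e \<Longrightarrow> K.frc v e (is_pair p x y) \<longleftrightarrow> e p = opair (e x) (e y)"
  unfolding is_pair_def el_inject[of "e p", symmetric] el_opair
  by (rule frc_set_eq) (use env_D[of v e] in \<open>auto simp: frc_is_upair intro: NN_upair\<close>)

lemma frc_is_one: "K.env v e \<Longrightarrow> K.frc v e (is_one x) \<longleftrightarrow> e x = succ emp"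
  unfolding is_one_def el_inject[of "e x", symmetric] el_succ
  by (rule frc_set_eq) (auto simp: frc_is_empty intro: NN_emp)

lemma frc_maps_to: "K.env v e \<Longrightarrow> K.frc v e (maps_to f x y) \<longleftrightarrow> opair (e x) (e y) \<in> el (e f)"
  unfolding maps_to_def frc_ExistsIn
  using D_el[OF env_D, of v e f] by (auto simp: frc_is_pair K.env_case subset_iff)

end


section \<open>The axioms of IKP and strong collection are forced\<close>

context height_model
begin

lemma frc_ForallI:
  assumes "K.env v e" "\<And>w a. K.env w (case_nat a e) \<Longrightarrow> K.frc w (case_nat a e) \<phi>"
  shows "K.frc v e (Forall \<phi>)"
  using assms(2) K.env_case[OF K.env_mono[OF assms(1)]] by auto

lemma frc_ImplI:
  assumes "K.env v e" "\<And>w. K.env w e \<Longrightarrow> K.frc w e \<phi> \<Longrightarrow> K.frc w e \<psi>"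
  shows "K.frc v e (\<phi> \<^bold>\<longrightarrow> \<psi>)"
  using assms(2) K.env_mono[OF assms(1)] by auto

lemma frc_ForallInI:
  assumes "K.env v e" "\<And>w x. K.env w (case_nat x e) \<Longrightarrow> x \<in> el (e a) \<Longrightarrow> K.frc w (case_nat x e) \<phi>"
  shows "K.frc v e (ForallIn a \<phi>)"
  unfolding frc_ForallIn[OF assms(1)]
proof (intro ballI impI)
  fix w x assume w: "w \<in> W" "le v w" "x \<in> el (e a)"
  then have "K.env w e" using K.env_mono assms(1) by blast
  then show "K.frc w (case_nat x e) \<phi>" using assms(2) K.env_case w(3) D_el[OF env_D] by blast
qed

lemma frc_ForallInD:
  assumes "K.env v e" "K.frc v e (ForallIn a \<phi>)" "x \<in> el (e a)"
  shows "K.env v (case_nat x e)" "K.frc v (case_nat x e) \<phi>"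
proof -
  have v: "v \<in> W" "le v v" using assms(1) w_refl by (auto simp: K.env_def)
  show "K.env v (case_nat x e)" using K.env_case D_el[OF env_D] assms by blast
  show "K.frc v (case_nat x e) \<phi>" using assms(2,3) v unfolding frc_ForallIn[OF assms(1)] by blast
qed

lemma frc_ExistsInI:
  assumes "K.env v e" "x \<in> el (e a)" "K.env v (case_nat x e) \<Longrightarrow> K.frc v (case_nat x e) \<phi>"
  shows "K.frc v e (ExistsIn a \<phi>)"
  unfolding frc_ExistsIn[OF assms(1)]
  using assms K.env_case[OF assms(1)] D_el[OF env_D[OF assms(1)]] by blast

lemma frc_ExistsI:
  assumes "K.env v e" "a \<in> D v" "K.env v (case_nat a e) \<Longrightarrow> K.frc v (case_nat a e) \<phi>"
  shows "K.frc v e (Exists \<phi>)"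
  using assms K.env_case[OF assms(1)] by auto

definition forced :: "set_sym fm \<Rightarrow> bool" where
  "forced \<phi> \<longleftrightarrow> (\<forall>v e. K.env v e \<longrightarrow> K.frc v e \<phi>)"

lemma forced_closure: "forced \<phi> \<Longrightarrow> forced ((Forall ^^ n) \<phi>)"
proof (induction n)
  case (Suc n)
  have "K.frc v e (Forall ((Forall ^^ n) \<phi>))" if "K.env v e" for v e
    by (rule frc_ForallI[OF that]) (use Suc.IH[OF Suc.prems] in \<open>simp add: forced_def\<close>)
  then show ?case by (simp add: forced_def)
qed simp

lemma forced_universal_closures:
  "(\<And>\<phi>. \<phi> \<in> S \<Longrightarrow> forced \<phi>) \<Longrightarrow> \<psi> \<in> universal_closures ar S \<Longrightarrow> forced \<psi>"
  by (auto simp: universal_closures_def intro: forced_closure)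

lemma forced_Empty_Set: "forced Empty_Set"
  unfolding forced_def Empty_Set_def
  by (auto intro!: frc_ExistsI[where a = emp] frc_ForallInI NN_emp simp del: forces.simps)

lemma forced_Pairing: "forced Pairing"
  unfolding forced_def Pairing_def
proof (intro allI impI frc_ForallI)
  fix v e w a u b assume *: "K.env u (case_nat b (case_nat a e))"
  let ?e = "case_nat b (case_nat a e)"
  have ab: "a \<in> D u" "b \<in> D u" using env_D[OF *, of 0] env_D[OF *, of 1] by auto
  show "K.frc u ?e (Exists (Forall (0 \<^bold>\<in> 1 \<^bold>\<longleftrightarrow> (0 \<^bold>= 3 \<^bold>\<or> 0 \<^bold>= 2))))"
  proof (rule frc_ExistsI[OF *])
    show "upair a b \<in> D u" using ab by (rule NN_upair)
    assume E: "K.env u (case_nat (upair a b) ?e)"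
    have "K.frc u (case_nat (upair a b) ?e) (Forall (0 \<^bold>\<in> Suc 0 \<^bold>\<longleftrightarrow> (0 \<^bold>= 3 \<^bold>\<or> 0 \<^bold>= 2)))
        \<longleftrightarrow> el (case_nat (upair a b) ?e 0) = {a, b}"
      by (rule frc_set_eq[OF E]) (use ab in \<open>auto simp: eval_nat_numeral\<close>)
    then show "K.frc u (case_nat (upair a b) ?e) (Forall (0 \<^bold>\<in> 1 \<^bold>\<longleftrightarrow> (0 \<^bold>= 3 \<^bold>\<or> 0 \<^bold>= 2)))"
      unfolding One_nat_def by simp
  qed
qed

lemma forced_Union: "forced Union_Axiom"
  unfolding forced_def Union_Axiom_def
proof (intro allI impI frc_ForallI)
  fix v e u a assume *: "K.env u (case_nat a e)"
  let ?y = "mk (\<Union>y\<in>el a. el y)"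
  have a: "a \<in> D u" using env_D[OF *, of 0] by auto
  then have y: "?y \<in> D u" by (rule NN_union)
  show "K.frc u (case_nat a e) (Exists (Forall (0 \<^bold>\<in> 1 \<^bold>\<longleftrightarrow> Exists (0 \<^bold>\<in> 3 \<^bold>\<and> 1 \<^bold>\<in> 0))))"
  proof (rule frc_ExistsI[OF * y])
    assume E: "K.env u (case_nat ?y (case_nat a e))"
    have "K.frc u (case_nat ?y (case_nat a e)) (Forall (0 \<^bold>\<in> Suc 0 \<^bold>\<longleftrightarrow> Exists (0 \<^bold>\<in> 3 \<^bold>\<and> 1 \<^bold>\<in> 0)))
        \<longleftrightarrow> el (case_nat ?y (case_nat a e) 0) = (\<Union>y\<in>el a. el y)"
    proof (rule frc_set_eq[OF E])
      fix w x assume w: "K.env w (case_nat x (case_nat ?y (case_nat a e)))"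
      have "el a \<subseteq> D w" using D_el[OF env_D[OF w, of 2]] by (simp add: numeral_2_eq_2)
      then show "K.frc w (case_nat x (case_nat ?y (case_nat a e))) (Exists (0 \<^bold>\<in> 3 \<^bold>\<and> 1 \<^bold>\<in> 0))
          \<longleftrightarrow> x \<in> (\<Union>y\<in>el a. el y)"
        by (auto simp: eval_nat_numeral)
    next
      show "(\<Union>y\<in>el a. el y) \<subseteq> D u" using D_el[OF y] by simp
    qed
    then show "K.frc u (case_nat ?y (case_nat a e)) (Forall (0 \<^bold>\<in> 1 \<^bold>\<longleftrightarrow> Exists (0 \<^bold>\<in> 3 \<^bold>\<and> 1 \<^bold>\<in> 0)))"
      unfolding One_nat_def by simp
  qed
qed

lemma forced_Extensionality: "forced Extensionality"
  unfolding forced_def Extensionality_def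
proof (intro allI impI frc_ForallI frc_ImplI)
  fix v e a b w
  assume E: "K.env w (case_nat b (case_nat a e))"
    and *: "K.frc w (case_nat b (case_nat a e)) (Forall (0 \<^bold>\<in> 2 \<^bold>\<longleftrightarrow> 0 \<^bold>\<in> 1))"
  have "K.frc w (case_nat b (case_nat a e)) (Forall (0 \<^bold>\<in> Suc 1 \<^bold>\<longleftrightarrow> 0 \<^bold>\<in> 1)) \<longleftrightarrow>
      el (case_nat b (case_nat a e) 1) = el b"
    by (rule frc_set_eq[OF E]) (use D_el[OF env_D[OF E, of 0]] in auto)
  then have "a = b" using * by (simp add: numeral_2_eq_2 el_inject)
  then show "K.frc w (case_nat b (case_nat a e)) (1 \<^bold>= 0)" by simp
qed

lemma frc_is_inductive_omega:
  assumes e: "K.env v e" "e x = omega" shows "K.frc v e (is_inductive x)"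
  unfolding is_inductive_def forces.simps(3)
proof
  show "K.frc v e (Exists (is_empty 0 \<^bold>\<and> 0 \<^bold>\<in> Suc x))"
    by (rule frc_ExistsI[OF e(1), of emp]) (use e in \<open>auto simp: NN_emp frc_is_empty intro: range_eqI[of _ _ 0]\<close>)
  show "K.frc v e (ForallIn x (Exists (is_succ 0 1 \<^bold>\<and> 0 \<^bold>\<in> Suc (Suc x))))"
  proof (rule frc_ForallInI[OF e(1)])
    fix w n assume w: "K.env w (case_nat n e)" "n \<in> el (e x)"
    then obtain m where m: "n = num m" using e by auto
    have "num (Suc m) \<in> D w" using K.num_in_D w(1) unfolding K.env_def by blast
    then show "K.frc w (case_nat n e) (Exists (is_succ 0 1 \<^bold>\<and> 0 \<^bold>\<in> Suc (Suc x)))"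
      by (rule frc_ExistsI[OF w(1)])
        (use e m in \<open>auto simp: frc_is_succ intro: range_eqI[of _ _ "Suc m"]\<close>)
  qed
qed

lemma forced_Infinity: "forced Infinity"
  unfolding forced_def Infinity_def
proof (intro allI impI)
  fix v e assume e: "K.env v e"
  show "K.frc v e (Exists (is_inductive 0 \<^bold>\<and> ForallIn 0 (is_empty 0 \<^bold>\<or> ExistsIn 0 (is_succ 1 0))))"
  proof (rule frc_ExistsI[OF e, of omega])
    assume E: "K.env v (case_nat omega e)"
    have "K.frc v (case_nat omega e) (ForallIn 0 (is_empty 0 \<^bold>\<or> ExistsIn 0 (is_succ 1 0)))"
    proof (rule frc_ForallInI[OF E])
      fix w n assume w: "K.env w (case_nat n (case_nat omega e))" "n \<in> el (case_nat omega e 0)"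
      then obtain m where m: "n = num m" by auto
      show "K.frc w (case_nat n (case_nat omega e)) (is_empty 0 \<^bold>\<or> ExistsIn 0 (is_succ 1 0))"
      proof (cases m)
        case 0
        then show ?thesis unfolding forces.simps(4) frc_is_empty[OF w(1)] using m by simp
      next
        case (Suc k)
        have "K.frc w (case_nat n (case_nat omega e)) (ExistsIn 0 (is_succ 1 0))"
          by (rule frc_ExistsInI[OF w(1), of "num k"]) (use m Suc in \<open>auto simp: frc_is_succ\<close>)
        then show ?thesis by simp
      qed
    qed
    then show "K.frc v (case_nat omega e)
        (is_inductive 0 \<^bold>\<and> ForallIn 0 (is_empty 0 \<^bold>\<or> ExistsIn 0 (is_succ 1 0)))"
      using frc_is_inductive_omega[OF E, of 0] by simp
  qed (rule NN_omega)
qed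

text \<open>Membership induction on \<open>a\<close>, for all later worlds at once.\<close>

lemma forced_Set_Induction:
  assumes wf: "well_formed set_ar \<phi>" shows "forced (Set_Induction \<phi>)"
  unfolding forced_def Set_Induction_def
proof (intro allI impI frc_ImplI)
  fix v e w
  assume e: "K.env w e"
    and step: "K.frc w e (Forall (ForallIn 0 (inst [0] 2 \<phi>) \<^bold>\<longrightarrow> inst [0] 1 \<phi>))"
  have "K.frc u (case_nat a e) (inst [0] 1 \<phi>)" if "u \<in> W" "le w u" "a \<in> D u" for u a
    using that
  proof (induction a arbitrary: u rule: hc_induct)
    case (mem a)
    have E: "K.env u (case_nat a e)" using K.env_case[OF K.env_mono[OF e]] mem.prems by blast
    have "K.frc u (case_nat a e) (ForallIn 0 (inst [0] 2 \<phi>))"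
      unfolding frc_ForallIn[OF E]
    proof (intro ballI impI)
      fix u' x assume u': "u' \<in> W" "le u u'" "x \<in> el (case_nat a e 0)"
      then have x: "x \<in> el a" by simp
      have "x \<in> D u'" using x u' mem.prems D_el K.D_mono by blast
      moreover have "w \<in> W" using e by (simp add: K.env_def)
      ultimately have "K.frc u' (case_nat x e) (inst [0] 1 \<phi>)"
        using mem.IH[OF x u'(1)] w_trans[of w u u'] mem.prems u' by blast
      then show "K.frc u' (case_nat x (case_nat a e)) (inst [0] 2 \<phi>)"
        by (simp add: K.frc_inst[OF wf] numeral_2_eq_2)
    qed
    then show ?case using step mem.prems w_refl[of u] by (simp only: forces.simps)
  qed
  then show "K.frc w e (Forall (inst [0] 1 \<phi>))" by simp
qed

lemma frc_inst_delta0: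
  assumes "delta0 \<phi>" "K.env v e"
  shows "K.frc v e (inst xs k \<phi>) \<longleftrightarrow> satisfies M (map e xs @@ (\<lambda>i. e (i + k))) \<phi>"
proof -
  have "K.env v (map e xs @@ (\<lambda>i. e (i + k)))"
    using assms(2) by (auto simp: K.env_def append_env_def)
  then show ?thesis using assms by (simp add: K.frc_inst delta0_well_formed frc_delta0)
qed

text \<open>Truth of \<open>\<phi>\<close> in \<open>M\<close> is definable there, so the set exists
  in \<open>M\<close>; being a subset of an element of the domain, it belongs to the domain.\<close>

lemma forced_Separation:
  assumes \<phi>: "delta0 \<phi>" shows "forced (Separation \<phi>)"
  unfolding forced_def Separation_def
proof (intro allI impI frc_ForallI)
  fix v e w a assume E: "K.env w (case_nat a e)"
  let ?P = "\<lambda>x. satisfies M (case_nat x (case_nat a e)) \<phi>"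
  define y where "y = mk {x \<in> el a. ?P x}"
  have el_y: "el y = {x \<in> el a. ?P x}"
    unfolding y_def by (auto intro!: el_mk countable_subset[OF _ countable_el[of a]])
  have a: "a \<in> D w" using env_D[OF E, of 0] by simp
  have "M.absolute (\<lambda>e'. ?P (e' 0))"
    using absolute_satisfies[OF delta0_well_formed[OF \<phi>] env_M[OF E], of "[0]"] by simp
  then have "y \<in> M" unfolding y_def using a NN_sub_M by (intro separation) auto
  then have y: "y \<in> D w" using NN_subset[OF _ a] el_y by blast
  show "K.frc w (case_nat a e) (Exists (Forall (0 \<^bold>\<in> 1 \<^bold>\<longleftrightarrow> (0 \<^bold>\<in> 2 \<^bold>\<and> inst [0, 2] 3 \<phi>))))"
  proof (rule frc_ExistsI[OF E y])
    assume E': "K.env w (case_nat y (case_nat a e))"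
    have "K.frc w (case_nat y (case_nat a e)) (Forall (0 \<^bold>\<in> Suc 0 \<^bold>\<longleftrightarrow> (0 \<^bold>\<in> 2 \<^bold>\<and> inst [0, 2] 3 \<phi>)))
       \<longleftrightarrow> el (case_nat y (case_nat a e) 0) = {x \<in> el a. ?P x}"
    proof (rule frc_set_eq[OF E'])
      fix u x assume "K.env u (case_nat x (case_nat y (case_nat a e)))"
      then show "K.frc u (case_nat x (case_nat y (case_nat a e))) (0 \<^bold>\<in> 2 \<^bold>\<and> inst [0, 2] 3 \<phi>)
          \<longleftrightarrow> x \<in> {x \<in> el a. ?P x}"
        by (simp add: frc_inst_delta0[OF \<phi>] eval_nat_numeral)
    qed (use D_el[OF a] in auto)
    then show "K.frc w (case_nat y (case_nat a e)) (Forall (0 \<^bold>\<in> 1 \<^bold>\<longleftrightarrow> (0 \<^bold>\<in> 2 \<^bold>\<and> inst [0, 2] 3 \<phi>)))"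
      unfolding One_nat_def using el_y by simp
  qed
qed

text \<open>The premise forced at \<open>w\<close> yields witnesses in the domain of
  \<open>w\<close> itself, so collection inside this domain applies. The result stays correct at
  later worlds because \<open>\<phi>\<close> is bounded.\<close>

lemma forced_Strong_Collection:
  assumes \<phi>: "delta0 \<phi>" shows "forced (Strong_Collection \<phi>)"
  unfolding forced_def Strong_Collection_def
proof (intro allI impI frc_ForallI frc_ImplI)
  fix v e w a
  assume E: "K.env w (case_nat a e)"
    and ant: "K.frc w (case_nat a e) (ForallIn 0 (Exists (inst [1, 0, 2] 3 \<phi>)))"
  let ?Q = "\<lambda>x y. satisfies M (case_nat x (case_nat y (case_nat a e))) \<phi>"
  have a: "a \<in> D w" using env_D[OF E, of 0] by simp
  have "\<exists>y\<in>D w. ?Q x y" if "x \<in> el a" for x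
  proof -
    have E': "K.env w (case_nat x (case_nat a e))"
      and "K.frc w (case_nat x (case_nat a e)) (Exists (inst [1, 0, 2] 3 \<phi>))"
      using frc_ForallInD[OF E ant, of x] that by auto
    then obtain y where y: "y \<in> D w" "K.frc w (case_nat y (case_nat x (case_nat a e))) (inst [1, 0, 2] 3 \<phi>)"
      by auto
    then show ?thesis
      unfolding frc_inst_delta0[OF \<phi> K.env_case[OF E' y(1)]]
      by (auto simp: eval_nat_numeral intro!: bexI[of _ y])
  qed
  moreover have "M.absolute (\<lambda>e'. ?Q (e' 0) (e' 1))"
    using absolute_satisfies[OF delta0_well_formed[OF \<phi>] env_M[OF E], of "[0, 1]"] by simp
  ultimately obtain b where b: "b \<in> D w" "\<forall>x\<in>el a. \<exists>y\<in>el b. ?Q x y" "\<forall>y\<in>el b. \<exists>x\<in>el a. ?Q x y"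
    using NN_strong_collection[OF a, of ?Q] by blast
  show "K.frc w (case_nat a e) (Exists (ForallIn 1 (ExistsIn 1 (inst [1, 0, 3] 4 \<phi>)) \<^bold>\<and>
              ForallIn 0 (ExistsIn 2 (inst [0, 1, 3] 4 \<phi>))))"
  proof (rule frc_ExistsI[OF E b(1)])
    let ?e = "case_nat b (case_nat a e)"
    assume E': "K.env w ?e"
    have "K.frc w ?e (ForallIn 1 (ExistsIn 1 (inst [1, 0, 3] 4 \<phi>)))"
    proof (rule frc_ForallInI[OF E'])
      fix u x assume u: "K.env u (case_nat x ?e)" "x \<in> el (?e 1)"
      then obtain y where y: "y \<in> el b" "?Q x y" using b(2) by auto
      show "K.frc u (case_nat x ?e) (ExistsIn 1 (inst [1, 0, 3] 4 \<phi>))"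
        by (rule frc_ExistsInI[OF u(1), of y])
          (use y in \<open>auto simp: frc_inst_delta0[OF \<phi>] eval_nat_numeral\<close>)
    qed
    moreover have "K.frc w ?e (ForallIn 0 (ExistsIn 2 (inst [0, 1, 3] 4 \<phi>)))"
    proof (rule frc_ForallInI[OF E'])
      fix u y assume u: "K.env u (case_nat y ?e)" "y \<in> el (?e 0)"
      then obtain x where x: "x \<in> el a" "?Q x y" using b(3) by auto
      show "K.frc u (case_nat y ?e) (ExistsIn 2 (inst [0, 1, 3] 4 \<phi>))"
        by (rule frc_ExistsInI[OF u(1), of x])
          (use x in \<open>auto simp: frc_inst_delta0[OF \<phi>] eval_nat_numeral\<close>)
    qed
    ultimately show "K.frc w ?e (ForallIn 1 (ExistsIn 1 (inst [1, 0, 3] 4 \<phi>)) \<^bold>\<and>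
              ForallIn 0 (ExistsIn 2 (inst [0, 1, 3] 4 \<phi>)))" by simp
  qed
qed

lemma forced_Collection:
  assumes \<phi>: "delta0 \<phi>" shows "forced (Collection \<phi>)"
  unfolding forced_def Collection_def
proof (intro allI impI frc_ForallI frc_ImplI)
  fix v e w a
  assume E: "K.env w (case_nat a e)"
    and ant: "K.frc w (case_nat a e) (ForallIn 0 (Exists (inst [1, 0, 2] 3 \<phi>)))"
  have e: "K.env w e" "a \<in> D w" "w \<in> W" "le w w" using env_caseD[OF E] w_refl by auto
  then have "K.frc w e (Strong_Collection \<phi>)"
    using forced_Strong_Collection[OF \<phi>] by (simp add: forced_def)
  then have "K.frc w (case_nat a e) (ForallIn 0 (Exists (inst [1, 0, 2] 3 \<phi>)) \<^bold>\<longrightarrow>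
      Exists (ForallIn 1 (ExistsIn 1 (inst [1, 0, 3] 4 \<phi>)) \<^bold>\<and> ForallIn 0 (ExistsIn 2 (inst [0, 1, 3] 4 \<phi>))))"
    using e unfolding Strong_Collection_def by (simp only: forces.simps(6))
  then have "K.frc w (case_nat a e) (Exists (ForallIn 1 (ExistsIn 1 (inst [1, 0, 3] 4 \<phi>)) \<^bold>\<and>
      ForallIn 0 (ExistsIn 2 (inst [0, 1, 3] 4 \<phi>))))"
    using e ant by (simp only: forces.simps(5))
  then show "K.frc w (case_nat a e) (Exists (ForallIn 1 (ExistsIn 1 (inst [1, 0, 3] 4 \<phi>))))"
    by (simp only: forces.simps(7) forces.simps(3)) blast
qed

end


section \<open>Equality, subset collection, Markov's principle and choice are forced\<close>

context kripke
begin

lemma frc_foralls: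
  assumes "\<And>v e. env v e \<Longrightarrow> v, e \<tturnstile> \<phi>" shows "env v e \<Longrightarrow> v, e \<tturnstile> (Forall ^^ n) \<phi>"
proof (induction n arbitrary: v e)
  case (Suc n)
  have "w, case_nat a e \<tturnstile> (Forall ^^ n) \<phi>" if "w \<in> W" "le v w" "a \<in> D w" for w a
    using Suc that env_case env_mono by blast
  then show ?case by simp
qed (simp add: assms)

lemma frc_equality_axioms:
  assumes "\<phi> \<in> equality_axioms" "env v e" shows "v, e \<tturnstile> \<phi>"
proof -
  have leibniz: "v, e \<tturnstile> (x \<^bold>= y \<^bold>\<longrightarrow> inst [x] 0 \<phi> \<^bold>\<longrightarrow> inst [y] 0 \<phi>)" if "well_formed set_ar \<phi>" for v e x y \<phi>
    by (simp add: frc_inst_one[OF that])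
  from assms(1) consider "\<phi> = Forall (0 \<^bold>= 0)"
    | n \<psi> x y where "\<phi> = (Forall ^^ n) (x \<^bold>= y \<^bold>\<longrightarrow> inst [x] 0 \<psi> \<^bold>\<longrightarrow> inst [y] 0 \<psi>)" "well_formed set_ar \<psi>"
    unfolding equality_axioms_def universal_closures_def by blast
  then show ?thesis
  proof cases
    case 2
    then show ?thesis using frc_foralls[OF leibniz[OF 2(2)] assms(2)] by simp
  qed simp
qed

lemma soundness_eq:
  assumes "T \<turnstile> \<phi>" "env v e" "\<And>\<psi>. \<psi> \<in> T \<Longrightarrow> v, e \<tturnstile> \<psi>" shows "v, e \<tturnstile> \<phi>"
  using assms soundness[of "equality_axioms \<union> T" \<phi> v e] frc_equality_axioms
  unfolding proves_eq_def by blast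

end

context height_model
begin

lemma frc_ant_delta0:
  assumes "delta0 \<psi>" "K.env w e" "K.frc w e (ForallIn i (ExistsIn j (inst xs k \<psi>)))" "x \<in> el (e i)"
  shows "\<exists>y\<in>el (case_nat x e j). satisfies M (map (case_nat y (case_nat x e)) xs @@ (\<lambda>i. case_nat y (case_nat x e) (i + k))) \<psi>"
proof -
  note E = frc_ForallInD[OF assms(2-4)]
  obtain y where y: "y \<in> el (case_nat x e j)" "K.frc w (case_nat y (case_nat x e)) (inst xs k \<psi>)"
    using E(2) unfolding frc_ExistsIn[OF E(1)] by blast
  have "K.env w (case_nat y (case_nat x e))"
    using K.env_case[OF E(1)] D_el[OF env_D[OF E(1)]] y(1) by blast
  then show ?thesis using y frc_inst_delta0[OF assms(1)] by blast
qed

text \<open>Soundness in the one-world model turns derivability of the bound into its truth in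
  \<open>M\<close>.\<close>

lemma set_bounded_satisfies:
  assumes "set_bounded z \<psi>"
  obtains t where "\<And>e. range e \<subseteq> M \<Longrightarrow> satisfies M e \<psi> \<Longrightarrow> e z \<in> el (e t)"
proof -
  obtain t where t: "{\<psi>} \<turnstile> z \<^bold>\<in> t" using assms by (auto simp: set_bounded_def)
  have "e z \<in> el (e t)" if "range e \<subseteq> M" "satisfies M e \<psi>" for e
    using M.soundness_eq[OF t, of "()" e] that by (simp add: forces_single hc_mem_iff)
  then show ?thesis using that by blast
qed

text \<open>Set-boundedness confines \<open>z\<close> to a set \<open>s\<close>, unless \<open>a\<close> is empty, when \<open>d = \<emptyset>\<close> will do.\<close>

lemma forced_Subset_Collection:
  assumes \<psi>: "delta0 \<psi>" and bd: "set_bounded 2 \<psi>" shows "forced (Subset_Collection \<psi>)"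
  unfolding forced_def Subset_Collection_def
proof (intro allI impI frc_ForallI)
  fix v e0 v' w a b assume E: "K.env w (case_nat b (case_nat a e0))"
  have ab: "a \<in> D w" "b \<in> D w" and e0: "K.env w e0"
    using env_caseD[OF E] env_caseD[of w a e0] by auto
  let ?P = "\<lambda>x y z. satisfies M (case_nat x (case_nat y (case_nat z (case_nat a (case_nat b e0))))) \<psi>"
  have abM: "a \<in> M" "b \<in> M" using ab NN_sub_M by auto
  have rng: "range (case_nat a (case_nat b e0)) \<subseteq> M"
    by (intro range_case_nat abM env_M[OF e0])
  obtain t where t: "\<And>e. range e \<subseteq> M \<Longrightarrow> satisfies M e \<psi> \<Longrightarrow> e 2 \<in> el (e t)"
    using set_bounded_satisfies[OF bd] by blast
  have P_t: "z \<in> el (case_nat x (case_nat y (case_nat z (case_nat a (case_nat b e0)))) t)"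
    if "?P x y z" "x \<in> M" "y \<in> M" "z \<in> M" for x y z
    using t[OF _ that(1)] range_case_nat rng that by (simp add: numeral_2_eq_2)
  have "\<exists>s\<in>D w. \<forall>x\<in>el a. \<forall>y\<in>el b. \<forall>z\<in>M. ?P x y z \<longrightarrow> z \<in> el s"
  proof -
    have xM: "x \<in> M" if "x \<in> el a" for x using that M_sub[OF abM(1)] by blast
    have yM: "y \<in> M" if "y \<in> el b" for y using that M_sub[OF abM(2)] by blast
    \<comment> \<open>The bounding variable is \<open>x\<close>, \<open>y\<close>, \<open>z\<close>
      or a parameter, where \<open>a\<close> and \<open>b\<close> count as parameters. In the case
      of \<open>z\<close>, irreflexivity of membership makes \<open>?P\<close> false
      throughout.\<close>
    consider "t = 0" | "t = 1" | "t = 2" | k where "t = Suc (Suc (Suc k))"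
      by (metis One_nat_def numeral_2_eq_2 old.nat.exhaust)
    then show ?thesis
    proof cases
      case 1
      have "\<forall>x\<in>el a. \<forall>y\<in>el b. \<forall>z\<in>M. ?P x y z \<longrightarrow> z \<in> (\<Union>x\<in>el a. el x)"
        using P_t xM yM 1 by fastforce
      then show ?thesis using NN_union[OF ab(1)] by (intro bexI[of _ "mk (\<Union>x\<in>el a. el x)"]) auto
    next
      case 2
      have "\<forall>x\<in>el a. \<forall>y\<in>el b. \<forall>z\<in>M. ?P x y z \<longrightarrow> z \<in> (\<Union>y\<in>el b. el y)"
        using P_t xM yM 2 by fastforce
      then show ?thesis using NN_union[OF ab(2)] by (intro bexI[of _ "mk (\<Union>y\<in>el b. el y)"]) auto
    next
      case 3
      have "\<not> ?P x y z" if "x \<in> el a" "y \<in> el b" "z \<in> M" for x y z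
        using P_t[of x y z] xM yM 3 that mem_irrefl by (auto simp: numeral_2_eq_2)
      then show ?thesis using NN_emp by blast
    next
      case 4
      have "case_nat a (case_nat b e0) k \<in> D w"
        using ab env_D[OF e0] by (auto split: nat.split)
      moreover have "\<forall>x\<in>el a. \<forall>y\<in>el b. \<forall>z\<in>M. ?P x y z \<longrightarrow> z \<in> el (case_nat a (case_nat b e0) k)"
        using P_t xM yM 4 by fastforce
      ultimately show ?thesis by blast
    qed
  qed
  then obtain s where s: "s \<in> D w" "\<And>x y z. x \<in> el a \<Longrightarrow> y \<in> el b \<Longrightarrow> z \<in> M \<Longrightarrow> ?P x y z \<Longrightarrow> z \<in> el s"
    by blast
  have P_abs: "M.absolute (\<lambda>e. ?P (e i) (e j) (e k))" for i j k
    using absolute_satisfies[OF delta0_well_formed[OF \<psi>] rng, of "[i, j, k]"] by simp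
  \<comment> \<open>The full set of related elements of \<open>b\<close>; under the premise it
    matches \<open>a\<close> in both directions.\<close>
  define d where "d z = mk {y \<in> el b. \<exists>x\<in>el a. ?P x y z}" for z
  have el_d: "el (d z) = {y \<in> el b. \<exists>x\<in>el a. ?P x y z}" for z
    unfolding d_def by (auto intro!: el_mk countable_subset[OF _ countable_el[of b]])
  let ?Q = "\<lambda>z u. (\<forall>y\<in>el u. y \<in> el b \<and> (\<exists>x\<in>el a. ?P x y z)) \<and> (\<forall>y\<in>el b. (\<exists>x\<in>el a. ?P x y z) \<longrightarrow> y \<in> el u)"
  have Q_iff: "?Q z u \<longleftrightarrow> u = d z" for z u
    unfolding el_inject[of u, symmetric] el_d by blast
  have Q_abs: "M.absolute (\<lambda>e. ?Q (e 0) (e 1))"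
    by (intro P_abs definable_intros abM)
  have dD: "d z \<in> D w" if "z \<in> M" for z
  proof -
    have "M.absolute (\<lambda>e. \<exists>x\<in>el a. ?P x (e 0) z)"
    proof (rule M.absolute_subst[where t = "\<lambda>_. z" and P = "\<lambda>z e. \<exists>x\<in>el a. ?P x (e 0) z"])
      show "M.absolute (\<lambda>e. \<exists>x\<in>el a. ?P x (e (Suc 0)) (e 0))" by (intro P_abs definable_intros abM)
    qed (intro definable_intros that)
    then have "d z \<in> M" unfolding d_def using abM by (intro separation)
    then show ?thesis using NN_subset[OF _ ab(2)] el_d by blast
  qed
  have "\<exists>u\<in>D w. ?Q z u" if "z \<in> el s" for z
  proof -
    have "z \<in> M" using D_el[OF s(1)] NN_sub_M that by blast
    then show ?thesis using dD Q_iff by blast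
  qed
  then obtain c0 where c0: "c0 \<in> D w" "\<forall>z\<in>el s. \<exists>u\<in>el c0. ?Q z u"
    using NN_strong_collection[OF s(1) Q_abs] by blast
  define c where "c = mk (insert emp (el c0))"
  have c: "c \<in> D w" "emp \<in> el c" "\<And>z. z \<in> el s \<Longrightarrow> d z \<in> el c"
    using NN_adj[OF NN_emp c0(1)] c0(2) Q_iff by (auto simp: c_def)
  show "K.frc w (case_nat b (case_nat a e0)) (Exists (Forall
     (ForallIn 3 (ExistsIn 3 (inst [1, 0, 2, 5, 4] 6 \<psi>)) \<^bold>\<longrightarrow>
      ExistsIn 1 (ForallIn 4 (ExistsIn 1 (inst [1, 0, 3, 6, 5] 7 \<psi>)) \<^bold>\<and>
                  ForallIn 0 (ExistsIn 5 (inst [0, 1, 3, 6, 5] 7 \<psi>))))))"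
  proof (rule frc_ExistsI[OF E c(1)], intro frc_ForallI frc_ImplI)
    fix u z w'
    let ?e = "case_nat z (case_nat c (case_nat b (case_nat a e0)))"
    assume E': "K.env w' ?e" and ant: "K.frc w' ?e (ForallIn 3 (ExistsIn 3 (inst [1, 0, 2, 5, 4] 6 \<psi>)))"
    \<comment> \<open>\<open>z\<close> may first appear at a later world. The bound \<open>s\<close>
      applies to it nevertheless, having been established for all \<open>z\<close> in
      \<open>M\<close>.\<close>
    have zM: "z \<in> M" using env_D[OF E', of 0] NN_sub_M by auto
    have ant': "\<exists>y\<in>el b. ?P x y z" if "x \<in> el a" for x
      using frc_ant_delta0[OF \<psi> E' ant, of x] that by (simp add: eval_nat_numeral)
    obtain d' where d': "d' \<in> el c" "\<forall>x\<in>el a. \<exists>y\<in>el d'. ?P x y z" "\<forall>y\<in>el d'. \<exists>x\<in>el a. ?P x y z"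
    proof (cases "el a = {}")
      case True
      then show ?thesis using that[of emp] c(2) by simp
    next
      case False
      then have "z \<in> el s" using ant' s(2) zM by blast
      then show ?thesis using that[of "d z"] c(3) el_d ant' by blast
    qed
    show "K.frc w' ?e (ExistsIn 1 (ForallIn 4 (ExistsIn 1 (inst [1, 0, 3, 6, 5] 7 \<psi>)) \<^bold>\<and>
                  ForallIn 0 (ExistsIn 5 (inst [0, 1, 3, 6, 5] 7 \<psi>))))"
    proof (rule frc_ExistsInI[OF E', of d'])
      let ?e' = "case_nat d' ?e"
      assume E2: "K.env w' ?e'"
      have "K.frc w' ?e' (ForallIn 4 (ExistsIn 1 (inst [1, 0, 3, 6, 5] 7 \<psi>)))"
      proof (rule frc_ForallInI[OF E2])
        fix u x assume u: "K.env u (case_nat x ?e')" "x \<in> el (?e' 4)"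
        then obtain y where y: "y \<in> el d'" "?P x y z" using d'(2) by (auto simp: eval_nat_numeral)
        show "K.frc u (case_nat x ?e') (ExistsIn 1 (inst [1, 0, 3, 6, 5] 7 \<psi>))"
          by (rule frc_ExistsInI[OF u(1), of y])
            (use y in \<open>auto simp: frc_inst_delta0[OF \<psi>] eval_nat_numeral\<close>)
      qed
      moreover have "K.frc w' ?e' (ForallIn 0 (ExistsIn 5 (inst [0, 1, 3, 6, 5] 7 \<psi>)))"
      proof (rule frc_ForallInI[OF E2])
        fix u y assume u: "K.env u (case_nat y ?e')" "y \<in> el (?e' 0)"
        then obtain x where x: "x \<in> el a" "?P x y z" using d'(3) by auto
        show "K.frc u (case_nat y ?e') (ExistsIn 5 (inst [0, 1, 3, 6, 5] 7 \<psi>))"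
          by (rule frc_ExistsInI[OF u(1), of x])
            (use x in \<open>auto simp: frc_inst_delta0[OF \<psi>] eval_nat_numeral\<close>)
      qed
      ultimately show "K.frc w' ?e' (ForallIn 4 (ExistsIn 1 (inst [1, 0, 3, 6, 5] 7 \<psi>)) \<^bold>\<and>
                  ForallIn 0 (ExistsIn 5 (inst [0, 1, 3, 6, 5] 7 \<psi>)))" by simp
    qed (use d' in simp)
  qed
qed

lemma frc_is_binary_function:
  assumes "K.env v e" "K.frc v e (is_binary_function f d)" "n \<in> el (e d)"
  shows "opair n emp \<in> el (e f) \<or> opair n (succ emp) \<in> el (e f)"
proof -
  have f1: "K.frc v e (ForallIn f (ExistsIn (Suc d) (Exists ((is_empty 0 \<^bold>\<or> is_one 0) \<^bold>\<and> is_pair 2 1 0))))"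
    and f2: "K.frc v e (ForallIn d (Exists (maps_to (f + 2) 1 0 \<^bold>\<and> Forall (maps_to (f + 3) 2 0 \<^bold>\<longrightarrow> 0 \<^bold>= 1))))"
    using assms(2) by (simp_all add: is_binary_function_def)
  note E = frc_ForallInD[OF assms(1) f2 assms(3)]
  obtain y where y: "y \<in> D v" "K.frc v (case_nat y (case_nat n e)) (maps_to (f + 2) 1 0)"
    using E(2) by auto
  then have p: "opair n y \<in> el (e f)" using frc_maps_to[OF K.env_case[OF E(1) y(1)]] by simp
  note E' = frc_ForallInD[OF assms(1) f1 p]
  obtain m where m: "m \<in> el (case_nat (opair n y) e (Suc d))"
    "K.frc v (case_nat m (case_nat (opair n y) e)) (Exists ((is_empty 0 \<^bold>\<or> is_one 0) \<^bold>\<and> is_pair 2 1 0))"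
    using E'(2) unfolding frc_ExistsIn[OF E'(1)] by blast
  have E2: "K.env v (case_nat m (case_nat (opair n y) e))"
    using K.env_case[OF E'(1)] D_el[OF env_D[OF E'(1)]] m(1) by blast
  obtain z where "z \<in> D v"
    "K.frc v (case_nat z (case_nat m (case_nat (opair n y) e))) ((is_empty 0 \<^bold>\<or> is_one 0) \<^bold>\<and> is_pair 2 1 0)"
    using m(2) by auto
  then have "(z = emp \<or> z = succ emp) \<and> opair n y = opair m z"
    using K.env_case[OF E2, of z] by (simp add: frc_is_empty frc_is_one frc_is_pair numeral_2_eq_2)
  then show ?thesis using p by auto
qed

lemma frc_ImplI2:
  assumes e: "K.env v e"
    and *: "\<And>w. K.env w e \<Longrightarrow> K.frc w e \<phi> \<Longrightarrow> K.frc w e \<psi> \<Longrightarrow> K.frc w e \<chi>"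
  shows "K.frc v e (\<phi> \<^bold>\<longrightarrow> \<psi> \<^bold>\<longrightarrow> \<chi>)"
  unfolding forces.simps
proof (intro ballI impI)
  fix u w assume u: "u \<in> W" "le v u" "K.frc u e \<phi>" and w: "w \<in> W" "le u w" "K.frc w e \<psi>"
  have "K.env w e" using K.env_mono e u w by blast
  then show "K.frc w e \<chi>" using * K.frc_mono[OF u(3)] u w by blast
qed

text \<open>A refuted bounded universal statement has a counterexample at a later world. It is an
  element of the same set \<open>p\<close>, and the values of \<open>f\<close> do not change, so it
  is a witness at the present world already.\<close>

lemma forced_MP: "forced MP"
  unfolding forced_def MP_def
proof (intro allI impI, intro frc_ForallI frc_ImplI2 frc_ImplI[of _ _ "is_omega 0"])
  fix v and e :: "nat \<Rightarrow> hc" and w and p :: hc and u and f :: hc and s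
  let ?e = "case_nat f (case_nat p e)"
  assume bin: "K.frc s ?e (is_binary_function 0 1)"
    and E: "K.env s ?e" and neg: "K.frc s ?e (\<^bold>\<not> ForallIn 1 (Exists (is_empty 0 \<^bold>\<and> maps_to 2 1 0)))"
  show "K.frc s ?e (ExistsIn 1 (Exists (is_one 0 \<^bold>\<and> maps_to 2 1 0)))"
  proof -
    have s: "s \<in> W" "le s s" using E w_refl by (auto simp: K.env_def)
    have "\<not> K.frc s ?e (ForallIn 1 (Exists (is_empty 0 \<^bold>\<and> maps_to 2 1 0)))"
      using neg s unfolding frc_not by blast
    then obtain t n where t: "t \<in> W" "le s t" "n \<in> el p"
      "\<not> K.frc t (case_nat n ?e) (Exists (is_empty 0 \<^bold>\<and> maps_to 2 1 0))"
      unfolding frc_ForallIn[OF E] by auto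
    have Et: "K.env t (case_nat n ?e)"
      using K.env_case[OF K.env_mono[OF E t(1,2)]] D_el[OF env_D[OF K.env_mono[OF E t(1,2)], of 1]] t(3) by auto
    have "opair n emp \<notin> el f"
    proof
      assume "opair n emp \<in> el f"
      then have "K.frc t (case_nat n ?e) (Exists (is_empty 0 \<^bold>\<and> maps_to 2 1 0))"
        by (intro frc_ExistsI[OF Et NN_emp]) (simp add: frc_is_empty frc_maps_to numeral_2_eq_2)
      then show False using t(4) by simp
    qed
    then have n: "opair n (succ emp) \<in> el f"
      using frc_is_binary_function[OF E bin, of n] t(3) by simp
    show ?thesis
    proof (rule frc_ExistsInI[OF E, of n])
      assume En: "K.env s (case_nat n ?e)"
      have "succ emp \<in> D s" using K.succ_in_D[OF s(1) NN_emp] .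
      then show "K.frc s (case_nat n ?e) (Exists (is_one 0 \<^bold>\<and> maps_to 2 1 0))"
        by (rule frc_ExistsI[OF En]) (use n in \<open>simp add: frc_is_one frc_maps_to numeral_2_eq_2\<close>)
    qed (use t in simp)
  qed
qed

lemma forced_AC: "forced AC"
  unfolding forced_def AC_def
proof (intro allI impI frc_ForallI frc_ImplI)
  fix v e w a u
  assume E: "K.env u (case_nat a e)" and ant: "K.frc u (case_nat a e)
     (ForallIn 0 (Exists (0 \<^bold>\<in> 1)) \<^bold>\<and>
      ForallIn 0 (ForallIn 1 ((\<^bold>\<not> 1 \<^bold>= 0) \<^bold>\<longrightarrow> Forall (\<^bold>\<not> (0 \<^bold>\<in> 2 \<^bold>\<and> 0 \<^bold>\<in> 1)))))"
  have u: "u \<in> W" "le u u" using E w_refl by (auto simp: K.env_def)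
  have a: "a \<in> D u" using env_D[OF E, of 0] by simp
  have "el x \<noteq> {}" if "x \<in> el a" for x
    using frc_ForallInD(2)[OF E, of 0 "Exists (0 \<^bold>\<in> 1)" x] ant that by auto
  moreover have "el x \<inter> el y = {}" if xy: "x \<in> el a" "y \<in> el a" "x \<noteq> y" for x y
  proof -
    have x: "K.env u (case_nat x (case_nat a e))"
      "K.frc u (case_nat x (case_nat a e)) (ForallIn 1 ((\<^bold>\<not> 1 \<^bold>= 0) \<^bold>\<longrightarrow> Forall (\<^bold>\<not> (0 \<^bold>\<in> 2 \<^bold>\<and> 0 \<^bold>\<in> 1))))"
      using frc_ForallInD[OF E, of 0 _ x] ant xy(1) by auto
    have y: "K.frc u (case_nat y (case_nat x (case_nat a e))) ((\<^bold>\<not> 1 \<^bold>= 0) \<^bold>\<longrightarrow> Forall (\<^bold>\<not> (0 \<^bold>\<in> 2 \<^bold>\<and> 0 \<^bold>\<in> 1)))"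
      using frc_ForallInD(2)[OF x, of y] xy(2) by simp
    moreover have "K.frc u (case_nat y (case_nat x (case_nat a e))) (\<^bold>\<not> 1 \<^bold>= 0)"
      using xy(3) by auto
    ultimately have "K.frc u (case_nat y (case_nat x (case_nat a e))) (Forall (\<^bold>\<not> (0 \<^bold>\<in> 2 \<^bold>\<and> 0 \<^bold>\<in> 1)))"
      using u by (simp only: forces.simps(5))
    then have "z \<notin> el x \<or> z \<notin> el y" if "z \<in> D u" for z
      using u that by (auto simp: numeral_2_eq_2)
    moreover have "el x \<subseteq> D u" using D_el[OF a] xy(1) D_el by blast
    ultimately show ?thesis by blast
  qed
  ultimately obtain b where b: "b \<in> D u" "\<forall>x\<in>el a. \<exists>z\<in>el b. z \<in> el x \<and> (\<forall>w\<in>el x. w \<in> el b \<longrightarrow> w = z)"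
    using NN_AC[OF a] by blast
  show "K.frc u (case_nat a e) (Exists (ForallIn 1 (ExistsIn 1 (0 \<^bold>\<in> 1 \<^bold>\<and> ForallIn 2 (0 \<^bold>\<in> 2 \<^bold>\<longrightarrow> 0 \<^bold>= 1)))))"
  proof (rule frc_ExistsI[OF E b(1)], rule frc_ForallInI)
    fix v x assume E': "K.env v (case_nat x (case_nat b (case_nat a e)))"
      and "x \<in> el (case_nat b (case_nat a e) 1)"
    then obtain z where z: "z \<in> el b" "z \<in> el x" "\<forall>w\<in>el x. w \<in> el b \<longrightarrow> w = z" using b(2) by auto
    show "K.frc v (case_nat x (case_nat b (case_nat a e)))
        (ExistsIn 1 (0 \<^bold>\<in> 1 \<^bold>\<and> ForallIn 2 (0 \<^bold>\<in> 2 \<^bold>\<longrightarrow> 0 \<^bold>= 1)))"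
    proof (rule frc_ExistsInI[OF E', of z])
      assume E2: "K.env v (case_nat z (case_nat x (case_nat b (case_nat a e))))"
      have "K.frc v (case_nat z (case_nat x (case_nat b (case_nat a e)))) (ForallIn 2 (0 \<^bold>\<in> 2 \<^bold>\<longrightarrow> 0 \<^bold>= 1))"
      proof (rule frc_ForallInI[OF E2])
        fix t y assume "y \<in> el (case_nat z (case_nat x (case_nat b (case_nat a e))) 2)"
        then have "y \<in> el x \<longrightarrow> y = z" using z(3) by (simp add: numeral_2_eq_2)
        then show "K.frc t (case_nat y (case_nat z (case_nat x (case_nat b (case_nat a e))))) (0 \<^bold>\<in> 2 \<^bold>\<longrightarrow> 0 \<^bold>= 1)"
          by (simp add: numeral_2_eq_2)
      qed
      then show "K.frc v (case_nat z (case_nat x (case_nat b (case_nat a e))))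
          (0 \<^bold>\<in> 1 \<^bold>\<and> ForallIn 2 (0 \<^bold>\<in> 2 \<^bold>\<longrightarrow> 0 \<^bold>= 1))"
        using z(2) by simp
    qed (use z(1) in simp)
  qed
qed

lemma forced_theory:
  assumes "\<phi> \<in> IKP_plus \<union> {MP, AC}" shows "forced \<phi>"
proof -
  have 1: "forced \<psi>" if "\<psi> \<in> {Set_Induction \<phi> |\<phi>. well_formed set_ar \<phi>} \<union>
        {Separation \<phi> |\<phi>. delta0 \<phi>} \<union> {Collection \<phi> |\<phi>. delta0 \<phi>}" for \<psi>
    using that forced_Set_Induction forced_Separation forced_Collection by auto
  have 2: "forced \<psi>" if "\<psi> \<in> {Strong_Collection \<phi> |\<phi>. delta0 \<phi>} \<union>
      {Subset_Collection \<psi> |\<psi>. delta0 \<psi> \<and> set_bounded 2 \<psi>}" for \<psi>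
    using that forced_Strong_Collection forced_Subset_Collection by auto
  show ?thesis
    using assms forced_universal_closures[of _ \<phi> set_ar, OF 1] forced_universal_closures[of _ \<phi> set_ar, OF 2]
      forced_Empty_Set forced_Pairing forced_Union forced_Extensionality forced_Infinity forced_MP forced_AC
    unfolding IKP_plus_def IKP_def by blast
qed

end


section \<open>Coding tuples of names by heights\<close>

text \<open>Total, so that the coding functions compose as absolute functions on all sets.\<close>

definition nat_of :: "hc \<Rightarrow> nat" where
  "nat_of x = (if x \<in> range num then THE n. x = num n else 0)"

lemma nat_of_num [simp]: "nat_of (num n) = n"
  by (auto simp: nat_of_def)

text \<open>The step from \<open>prod_decode n\<close> to \<open>prod_decode (Suc n)\<close>, on codes of pairs.\<close>

definition pair_step :: "hc \<Rightarrow> hc" where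
  "pair_step p = (if \<exists>a b. p = opair (num a) (num b)
     then THE z. \<exists>a b. p = opair (num a) (num b) \<and>
       z = (case b of 0 \<Rightarrow> opair emp (num (Suc a)) | Suc c \<Rightarrow> opair (num (Suc a)) (num c))
     else emp)"

lemma pair_step_opair:
  "pair_step (opair (num a) (num b)) =
     (case b of 0 \<Rightarrow> opair emp (num (Suc a)) | Suc c \<Rightarrow> opair (num (Suc a)) (num c))"
  unfolding pair_step_def by auto

lemma pair_step_default: "\<nexists>a b. p = opair (num a) (num b) \<Longrightarrow> pair_step p = emp"
  by (auto simp: pair_step_def)

text \<open>Iterating the step runs through the diagonals of Cantor's enumeration of pairs; thus
  \<open>prod_encode\<close> becomes definable by a single recursion.\<close>

lemma pair_step_iterate:
  "(pair_step ^^ n) (opair emp emp) = opair (num (fst (prod_decode n))) (num (snd (prod_decode n)))"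
proof (induction n)
  case 0
  have "prod_decode 0 = (0, 0)" by (simp add: prod_decode_def prod_decode_aux.simps)
  then show ?case by simp
next
  case (Suc n)
  obtain a b where ab: "prod_decode n = (a, b)" by fastforce
  then have n: "prod_encode (a, b) = n" by (metis prod_decode_inverse)
  show ?case
  proof (cases b)
    case 0
    then have "prod_encode (0, Suc a) = Suc n" using n by (simp add: prod_encode_def)
    then have "prod_decode (Suc n) = (0, Suc a)" by (metis prod_encode_inverse)
    then show ?thesis using Suc ab 0 pair_step_opair[of a 0] by (simp del: num.simps(2))
  next
    case (Suc c)
    then have "prod_encode (Suc a, c) = Suc n" using n by (simp add: prod_encode_def)
    then have "prod_decode (Suc n) = (Suc a, c)" by (metis prod_encode_inverse)
    then show ?thesis using Suc.IH ab Suc by (simp add: pair_step_opair del: num.simps(2))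
  qed
qed

lemma pair_step_iterate_iff:
  "opair (num a) (num b) = (pair_step ^^ n) (opair emp emp) \<longleftrightarrow> n = prod_encode (a, b)"
  unfolding pair_step_iterate opair_inject num_inject
  by (metis prod.collapse prod_decode_inverse prod_encode_inverse fst_conv snd_conv)

text \<open>The padding \<open>k\<close> provides codes of an atom above any given height, and
  \<open>Suc\<close> keeps the numbers \<open>prod_encode (k, 0)\<close> from coding
  anything.\<close>

definition tuple_code :: "nat \<Rightarrow> nat \<Rightarrow> nat list \<Rightarrow> nat" where
  "tuple_code k r ms = prod_encode (k, Suc (prod_encode (r, list_encode ms)))"

lemma tuple_code_inject: "tuple_code k r ms = tuple_code k' r' ms' \<longleftrightarrow> k = k' \<and> r = r' \<and> ms = ms'"
  by (auto simp: tuple_code_def list_encode_eq)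

section \<open>Definability of names and heights\<close>

context ctm
begin

text \<open>A set that is not a name gets the code \<open>0\<close>, so that every set denotes something.\<close>

definition nm :: "hc \<Rightarrow> nat" where
  "nm x = (if \<exists>a b. x = opair (kap a) (num b)
     then THE m. \<exists>a b. x = opair (kap a) (num b) \<and> m = Suc (prod_encode (a, b)) else 0)"

lemma nm_name [simp]: "nm (opair (kap a) (num b)) = Suc (prod_encode (a, b))"
  unfolding nm_def by auto

lemma nm_default: "\<nexists>a b. x = opair (kap a) (num b) \<Longrightarrow> nm x = 0"
  by (auto simp: nm_def)

lemma V_omega_trans: "y \<in> el V_omega \<Longrightarrow> el y \<subseteq> el V_omega"
  using V_omega_index index_set.A_trans by blast

lemma vset_in_V_omega: "vset n \<in> el V_omega"
  by (rule vset_subset_V_omega[OF vset_in_M subset_refl])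

text \<open>\<open>V_omega\<close> has to be recognised inside every \<open>NN n\<close> without
  parameters; apart from the recursion for \<open>vset\<close>, the condition has bounded
  quantifiers only.\<close>

lemma eq_V_omega_iff: "x = V_omega \<longleftrightarrow> (\<forall>y\<in>el x. \<forall>z\<in>el y. z \<in> el x) \<and>
    (\<forall>y\<in>el x. \<exists>z\<in>el x. y \<in> el z \<and> (\<exists>i\<in>el omega. \<exists>n. i = num n \<and> z = (pw ^^ n) emp)) \<and>
    (\<forall>i\<in>el omega. \<exists>z\<in>el x. \<exists>n. i = num n \<and> z = (pw ^^ n) emp)"
  (is "_ \<longleftrightarrow> ?R")
proof
  assume x: "x = V_omega"
  have "\<exists>z\<in>el x. y \<in> el z \<and> (\<exists>i\<in>el omega. \<exists>n. i = num n \<and> z = (pw ^^ n) emp)" if "y \<in> el x" for y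
  proof -
    have "y \<in> (\<Union>n. el (vset n))" using that unfolding x el_V_omega .
    then obtain n where "y \<in> el (vset n)" by blast
    then show ?thesis using vset_in_V_omega[of n] unfolding x vset_def by auto
  qed
  moreover have "\<exists>z\<in>el x. \<exists>n. i = num n \<and> z = (pw ^^ n) emp" if "i \<in> el omega" for i
    using that vset_in_V_omega unfolding x vset_def by auto
  ultimately show ?R using V_omega_trans x by blast
next
  assume R: ?R
  have "vset n \<in> el x" for n using R unfolding vset_def by auto
  then have "el (vset n) \<subseteq> el x" for n using R by blast
  moreover have "y \<in> (\<Union>n. el (vset n))" if "y \<in> el x" for y
    using R that unfolding vset_def by blast
  ultimately show "x = V_omega" unfolding el_inject[symmetric] el_V_omega by blast
qed

lemma NN_V_omega: "V_omega \<in> NN n"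
  using kap_in_NN_iff[of 0 n] by (simp add: kap_simps)

lemma NN_pw_subset: "y \<in> NN n \<Longrightarrow> el (pw y) \<subseteq> NN n"
  using NN_subset by (auto simp: el_pw)

lemma pw_iterate_in_M: "x \<in> M \<Longrightarrow> (pw ^^ i) x \<in> M"
  by (induction i) (auto intro: pw_in_M)

text \<open>\<open>pw\<close> can lead out of \<open>NN k\<close>, so the argument descends from the
  last iterate: each iterate is an element of the next.\<close>

lemma pw_iterate_in_NN:
  assumes "x \<in> NN k" "(pw ^^ n) x \<in> NN k" "i \<le> n" shows "(pw ^^ i) x \<in> NN k"
  using assms(3,2)
proof (induction rule: inc_induct)
  case (step i)
  have "(pw ^^ i) x \<in> M" by (rule pw_iterate_in_M) (use assms(1) NN_sub_M in blast)
  then have "(pw ^^ i) x \<in> el ((pw ^^ Suc i) x)" by (simp add: el_pw)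
  then show ?case using NN_trans[OF step.IH[OF step.prems]] by blast
qed

end

context height_model
begin

text \<open>A domain contains all subsets in \<open>M\<close> of its elements, so it recognises
  power sets correctly even though some are missing from it.\<close>

lemma absolute_pw_D: "K.absolute (\<lambda>e. e 0 = pw (e 1))"
proof (rule K.absolute_allI[where P = "\<lambda>u e. u \<in> el (e 0) \<longleftrightarrow> (\<forall>w\<in>el u. w \<in> el (e 1))"])
  show "K.absolute (\<lambda>e. e 0 \<in> el (e (Suc 0)) \<longleftrightarrow> (\<forall>w\<in>el (e 0). w \<in> el (e (Suc 1))))"
    by (intro K.absolute_intros)
  fix v e assume E: "K.env v e"
  have "el (e 0) \<subseteq> D v" "el (pw (e 1)) \<subseteq> D v"
    using D_el[OF env_D[OF E]] NN_pw_subset[OF env_D[OF E]] by auto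
  then have "e 0 = pw (e 1) \<longleftrightarrow> (\<forall>u\<in>D v. u \<in> el (e 0) \<longleftrightarrow> u \<in> el (pw (e 1)))"
    unfolding el_inject[of "e 0", symmetric] by blast
  then show "e 0 = pw (e 1) \<longleftrightarrow> (\<forall>u\<in>D v. u \<in> el (e 0) \<longleftrightarrow> (\<forall>w\<in>el u. w \<in> el (e 1)))"
    using subsetD[OF NN_sub_M, of _ "ht v"] by (auto simp: el_pw)
qed

lemma absolute_pw_iterate:
  assumes "K.absolute_fun m" "K.absolute_fun z" "K.absolute_fun x"
  shows "K.absolute (\<lambda>e. \<exists>n. m e = num n \<and> z e = (pw ^^ n) (x e))"
  by (rule K.absolute_iterate[OF absolute_pw_D _ assms]) (rule pw_iterate_in_NN)

lemma absolute_fun_V_omega: "K.absolute_fun (\<lambda>_. V_omega)"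
proof (rule K.absolute_funI)
  show "K.absolute (\<lambda>e. (\<forall>y\<in>el (e 0). \<forall>z\<in>el y. z \<in> el (e 0)) \<and>
    (\<forall>y\<in>el (e 0). \<exists>z\<in>el (e 0). y \<in> el z \<and> (\<exists>i\<in>el omega. \<exists>n. i = num n \<and> z = (pw ^^ n) emp)) \<and>
    (\<forall>i\<in>el omega. \<exists>z\<in>el (e 0). \<exists>n. i = num n \<and> z = (pw ^^ n) emp))"
    by (intro absolute_pw_iterate K.absolute_intros K.absolute_fun_intros)
qed (simp_all add: NN_V_omega eq_V_omega_iff)

lemma absolute_kap:
  assumes "K.absolute_fun m" "K.absolute_fun z"
  shows "K.absolute (\<lambda>e. \<exists>n. m e = num n \<and> z e = kap n)"
  unfolding kap_def by (intro absolute_pw_iterate assms absolute_fun_V_omega)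

lemma absolute_fun_nat_of:
  assumes "K.absolute_fun t" shows "K.absolute_fun (\<lambda>e. num (nat_of (t e)))"
proof (rule K.absolute_fun_comp[OF _ assms], rule K.absolute_funI)
  show "K.absolute (\<lambda>e. e 1 \<in> el omega \<and> e 0 = e 1 \<or> e 1 \<notin> el omega \<and> e 0 = emp)"
    by (intro K.absolute_intros K.absolute_fun_intros)
  show "(e 0 = num (nat_of (e (Suc 0)))) \<longleftrightarrow> (e 1 \<in> el omega \<and> e 0 = e 1 \<or> e 1 \<notin> el omega \<and> e 0 = emp)"
    for e :: "nat \<Rightarrow> hc"
    by (cases "e 1 \<in> range num") (auto simp: nat_of_def)
qed (auto simp: K.env_def intro: K.num_in_D)

lemma absolute_pair_step: "K.absolute (\<lambda>e. e 0 = pair_step (e 1))"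
proof (rule K.absolute_cong)
  show "K.absolute (\<lambda>e. (\<exists>a\<in>el omega. \<exists>b\<in>el omega. e 1 = opair a b \<and>
      (b = emp \<and> e 0 = opair emp (succ a) \<or> (\<exists>c\<in>el omega. b = succ c \<and> e 0 = opair (succ a) c))) \<or>
    (\<not> (\<exists>a\<in>el omega. \<exists>b\<in>el omega. e 1 = opair a b)) \<and> e 0 = emp)"
    by (intro K.absolute_intros K.absolute_fun_intros)
  fix v e
  show "(e 0 = pair_step (e 1)) \<longleftrightarrow> ((\<exists>a\<in>el omega. \<exists>b\<in>el omega. e 1 = opair a b \<and>
      (b = emp \<and> e 0 = opair emp (succ a) \<or> (\<exists>c\<in>el omega. b = succ c \<and> e 0 = opair (succ a) c))) \<or>
    (\<not> (\<exists>a\<in>el omega. \<exists>b\<in>el omega. e 1 = opair a b)) \<and> e 0 = emp)"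
  proof (cases "\<exists>a b. e 1 = opair (num a) (num b)")
    case True
    then obtain a b where ab: "e 1 = opair (num a) (num b)" by blast
    have ex_num: "\<exists>x. emp = num x" "\<And>k. \<exists>x. succ (num k) = num x"
      by (metis num.simps(1), metis num.simps(2))
    show ?thesis
      unfolding ab pair_step_opair using ex_num by (cases b) (auto simp: image_iff)
  next
    case False
    then show ?thesis using pair_step_default[OF False] by auto
  qed
qed

lemma absolute_fun_prod_encode:
  assumes "K.absolute_fun s" "K.absolute_fun t"
  shows "K.absolute_fun (\<lambda>e. num (prod_encode (nat_of (s e), nat_of (t e))))"
proof (rule K.absolute_fun_comp2[OF _ assms], rule K.absolute_funI)
  show "K.absolute (\<lambda>e. \<exists>n. e 0 = num n \<and>
      opair (num (nat_of (e 1))) (num (nat_of (e 2))) = (pair_step ^^ n) (opair emp emp))"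
  proof (rule K.absolute_iterate[OF absolute_pair_step])
    fix v x n i assume v: "v \<in> W" "x \<in> D v"
    have "pair_step y \<in> D v" for y
    proof (cases "\<exists>a b. y = opair (num a) (num b)")
      case True
      then obtain a b where "y = opair (num a) (num b)" by blast
      then show ?thesis
        using v(1) by (cases b) (auto simp: pair_step_opair simp del: num.simps intro!: K.opair_in_D K.num_in_D NN_emp)
    qed (simp add: pair_step_default NN_emp)
    then show "(pair_step ^^ i) x \<in> D v" using v(2) by (cases i) auto
  qed (intro absolute_fun_nat_of K.absolute_intros K.absolute_fun_intros)+
qed (auto simp: pair_step_iterate_iff numeral_2_eq_2 K.env_def intro: K.num_in_D)

lemma absolute_fun_nm:
  assumes "K.absolute_fun t" shows "K.absolute_fun (\<lambda>e. num (nm (t e)))"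
proof (rule K.absolute_fun_comp[OF _ assms], rule K.absolute_funI)
  let ?N = "\<lambda>x i j. \<exists>y. x = opair y j \<and> (\<exists>n. i = num n \<and> y = kap n)"
  show "K.absolute (\<lambda>e. (\<exists>i\<in>el omega. \<exists>j\<in>el omega. ?N (e 1) i j \<and>
        e 0 = succ (num (prod_encode (nat_of i, nat_of j)))) \<or>
      (\<not> (\<exists>i\<in>el omega. \<exists>j\<in>el omega. ?N (e 1) i j)) \<and> e 0 = emp)"
    by (intro absolute_kap absolute_fun_prod_encode K.absolute_intros K.absolute_fun_intros K.absolute_ex)
      (auto simp: K.env_def dest: K.env_opair)
  show "(e 0 = num (nm (e (Suc 0)))) \<longleftrightarrow> ((\<exists>i\<in>el omega. \<exists>j\<in>el omega. ?N (e 1) i j \<and>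
        e 0 = succ (num (prod_encode (nat_of i, nat_of j)))) \<or>
      (\<not> (\<exists>i\<in>el omega. \<exists>j\<in>el omega. ?N (e 1) i j)) \<and> e 0 = emp)" for e :: "nat \<Rightarrow> hc"
  proof (cases "\<exists>a b. e 1 = opair (kap a) (num b)")
    case True
    then obtain a b where ab: "e 1 = opair (kap a) (num b)" by blast
    then have "num (nm (e (Suc 0))) = succ (num (prod_encode (a, b)))" by simp
    moreover have "?N (e 1) i j \<longleftrightarrow> i = num a \<and> j = num b" for i j using ab by auto
    ultimately show ?thesis by auto
  next
    case False
    then have "num (nm (e (Suc 0))) = emp" using nm_default by simp
    moreover have "\<not> (\<exists>i\<in>el omega. \<exists>j\<in>el omega. ?N (e 1) i j)" using False by auto
    ultimately show ?thesis by auto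
  qed
qed (auto simp: K.env_def intro: K.num_in_D)

lemma absolute_fun_names:
  "K.absolute_fun (\<lambda>e. num (list_encode (map (\<lambda>i. nm (e i)) is)))"
proof (induction "is")
  case Nil
  then show ?case using K.absolute_fun_num[of 0] by simp
next
  case (Cons i "is")
  have "K.absolute_fun (\<lambda>e. succ (num (prod_encode (nat_of (num (nm (e i))),
      nat_of (num (list_encode (map (\<lambda>i. nm (e i)) is)))))))"
    by (intro K.absolute_fun_succ absolute_fun_prod_encode Cons absolute_fun_nm K.absolute_fun_var)
  then show ?case by simp
qed

lemma absolute_tuple_code:
  "K.absolute (\<lambda>e. \<exists>k. e 0 = kap (tuple_code k r (map (\<lambda>i. nm (e (Suc i))) [0..<n])))"
proof -
  let ?l = "\<lambda>e. num (list_encode (map (\<lambda>i. nm (e i)) (map Suc [0..<n])))"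
  have "K.absolute (\<lambda>e. \<exists>i\<in>el omega. \<exists>m. num (prod_encode (nat_of i, nat_of (succ
      (num (prod_encode (nat_of (num r), nat_of (?l (\<lambda>i. e i)))))))) = num m \<and> e 0 = kap m)"
    by (intro absolute_kap absolute_fun_prod_encode K.absolute_intros K.absolute_fun_intros
        K.absolute_fun_rename[OF absolute_fun_names])
  then show ?thesis
  proof (rule K.absolute_cong)
    fix v e
    show "(\<exists>k. e 0 = kap (tuple_code k r (map (\<lambda>i. nm (e (Suc i))) [0..<n]))) \<longleftrightarrow>
      (\<exists>i\<in>el omega. \<exists>m. num (prod_encode (nat_of i, nat_of (succ
        (num (prod_encode (nat_of (num r), nat_of (?l (\<lambda>i. e i)))))))) = num m \<and> e 0 = kap m)"
      by (simp add: tuple_code_def comp_def flip: num.simps(2))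
  qed
qed

lemma forcedI: "(\<And>\<psi>. \<psi> \<in> T \<Longrightarrow> forced \<psi>) \<Longrightarrow> T \<turnstile> \<phi> \<Longrightarrow> forced \<phi>"
  using K.soundness_eq[of T \<phi>] unfolding forced_def by blast

lemma absolute_formula:
  assumes "K.absolute P"
  obtains \<phi> where "well_formed set_ar \<phi>" "\<And>v e. K.env v e \<Longrightarrow> K.frc v e \<phi> = P e"
proof -
  obtain \<phi> cs where \<phi>: "well_formed set_ar \<phi>" "set cs \<subseteq> {}"
    "\<And>v e. K.env v e \<Longrightarrow> K.frc v (cs @@ e) \<phi> = P e"
    using K.absoluteE[OF assms] by metis
  then have "cs = []" by simp
  then show ?thesis using \<phi> that by simp
qed

text \<open>\<open>kap h\<close> belongs to a world \<open>w\<close> and has no power set there iff \<open>h\<close> is the height of \<open>w\<close>; so a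
  formula can exclude heights of a given form above the current world.\<close>

lemma height_formula:
  obtains \<chi> where "well_formed set_ar \<chi>" "fv \<chi> \<subseteq> {..<n}"
    "\<And>v e. K.env v e \<Longrightarrow> K.frc v e \<chi> \<longleftrightarrow>
       (\<forall>w\<in>W. le v w \<longrightarrow> (\<nexists>k. ht w = tuple_code k r (map (\<lambda>i. nm (e i)) [0..<n])))"
proof -
  obtain \<phi> where \<phi>: "well_formed set_ar \<phi>" "\<And>v e. K.env v e \<Longrightarrow> K.frc v e \<phi> =
      (\<exists>k. e 0 = kap (tuple_code k r (map (\<lambda>i. nm (e (Suc i))) [0..<n])))"
    using absolute_formula[OF absolute_tuple_code[of r n]] by metis
  obtain \<psi> where \<psi>: "well_formed set_ar \<psi>" "\<And>v e. K.env v e \<Longrightarrow> K.frc v e \<psi> = (e 0 = pw (e 1))"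
    using absolute_formula[OF absolute_pw_D] by metis
  let ?\<theta> = "Forall (\<phi> \<^bold>\<longrightarrow> Exists \<psi>)"
  let ?c = "\<lambda>k e. tuple_code k r (map (\<lambda>i. nm (e i)) [0..<n])"
  have ex: "K.frc w (case_nat y e) (Exists \<psi>) \<longleftrightarrow> pw y \<in> D w" if "K.env w (case_nat y e)" for w y e
    using K.env_case[OF that] by (auto simp: \<psi>(2))
  have \<theta>: "K.frc v e ?\<theta> \<longleftrightarrow> (\<forall>w\<in>W. le v w \<longrightarrow> (\<nexists>k. ht w = ?c k e))" if e: "K.env v e" for v e
  proof
    assume L: "K.frc v e ?\<theta>"
    show "\<forall>w\<in>W. le v w \<longrightarrow> (\<nexists>k. ht w = ?c k e)"
    proof (intro ballI impI notI)
      fix w assume w: "w \<in> W" "le v w" and "\<exists>k. ht w = ?c k e"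
      let ?y = "kap (ht w)"
      have y: "?y \<in> D w" by (simp add: kap_in_NN_iff)
      have E: "K.env w (case_nat ?y e)" using K.env_case[OF K.env_mono[OF e w] y] .
      have "K.frc w (case_nat ?y e) \<phi>" using \<phi>(2)[OF E] \<open>\<exists>k. ht w = ?c k e\<close> by auto
      then have "K.frc w (case_nat ?y e) (Exists \<psi>)"
        using L w y w_refl[OF w(1)] by (simp only: forces.simps(5,6))
      then have "kap (Suc (ht w)) \<in> D w" using ex[OF E] by (simp add: kap_simps)
      then show False by (simp add: kap_in_NN_iff)
    qed
  next
    assume R: "\<forall>w\<in>W. le v w \<longrightarrow> (\<nexists>k. ht w = ?c k e)"
    show "K.frc v e ?\<theta>"
      unfolding forces.simps(5,6)
    proof (intro ballI impI)
      fix u y w assume u: "u \<in> W" "le v u" "y \<in> D u" and w: "w \<in> W" "le u w" "K.frc w (case_nat y e) \<phi>"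
      have E: "K.env w (case_nat y e)"
        using K.env_mono[OF K.env_case[OF K.env_mono[OF e u(1,2)] u(3)] w(1,2)] .
      then obtain k where k: "y = kap (?c k e)" using \<phi>(2) w(3) by auto
      have "y \<in> D w" using env_D[OF E, of 0] by simp
      then have "?c k e \<le> ht w" using k by (simp add: kap_in_NN_iff)
      moreover have "?c k e \<noteq> ht w"
        using R w w_trans[of v u w] u e by (metis K.env_def)
      ultimately have "kap (Suc (?c k e)) \<in> D w" by (simp add: kap_in_NN_iff)
      then show "K.frc w (case_nat y e) (Exists \<psi>)" using ex[OF E] k by (simp add: kap_simps)
    qed
  qed
  \<comment> \<open>The formulas obtained from absoluteness may have stray free variables. All
    places from \<open>n\<close> on are sent to one dummy variable, bound by an outer existential
    quantifier.\<close>
  let ?f = "\<lambda>i. if i < n then Suc i else 0"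
  have wf: "well_formed set_ar ?\<theta>" using \<phi> \<psi> by simp
  show ?thesis
  proof (rule that)
    show "well_formed set_ar (Exists (rename ?f ?\<theta>))"
      unfolding well_formed.simps(7) well_formed_rename using wf .
    show "fv (Exists (rename ?f ?\<theta>)) \<subseteq> {..<n}"
      unfolding fv.simps(7) fv_rename by (auto split: if_splits)
    fix v e assume e: "K.env v e"
    have "K.frc v (case_nat a e) (rename ?f ?\<theta>) \<longleftrightarrow> (\<forall>w\<in>W. le v w \<longrightarrow> (\<nexists>k. ht w = ?c k e))"
      if a: "a \<in> D v" for a
    proof -
      have E: "K.env v (case_nat a e \<circ> ?f)"
        using K.env_comp[OF K.env_case[OF e a], of ?f] by (simp add: comp_def)
      have eq: "map (\<lambda>i. nm ((case_nat a e \<circ> ?f) i)) [0..<n] = map (\<lambda>i. nm (e i)) [0..<n]" by simp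
      show ?thesis unfolding forces_rename[OF wf] \<theta>[OF E] eq ..
    qed
    then show "K.frc v e (Exists (rename ?f ?\<theta>)) \<longleftrightarrow> (\<forall>w\<in>W. le v w \<longrightarrow> (\<nexists>k. ht w = ?c k e))"
      using NN_emp unfolding forces.simps(7) by blast
  qed
qed

end


section \<open>The Kripke model of saturated theories\<close>

text \<open>The first \<open>l\<close> blocks of variables, where block \<open>j\<close> consists of
  the \<open>prod_encode (j, b)\<close>. A world with \<open>l\<close> heights uses these, and the
  next block supplies infinitely many fresh variables.\<close>

definition vars :: "nat \<Rightarrow> nat set" where
  "vars l = {x. fst (prod_decode x) < l}"

text \<open>\<open>level hs a\<close> is the stage at which the name with marker \<open>kap a\<close> appears on a branch with
  heights \<open>hs\<close> (the latest height first).\<close>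

definition level :: "nat list \<Rightarrow> nat \<Rightarrow> nat" where
  "level hs a = card {h \<in> set hs. h < a}"

text \<open>The default for sets that are not names is a variable of block 0, which is available at
  every world.\<close>

definition denotes :: "nat list \<Rightarrow> nat \<Rightarrow> nat" where
  "denotes hs m = (case m of 0 \<Rightarrow> prod_encode (0, 0)
     | Suc p \<Rightarrow> prod_encode (level hs (fst (prod_decode p)), snd (prod_decode p)))"

lemma denotes_Suc [simp]: "denotes hs (Suc (prod_encode (a, b))) = prod_encode (level hs a, b)"
  by (simp add: denotes_def)

lemma decreasing_hd: "sorted_wrt (>) hs \<Longrightarrow> h \<in> set hs \<Longrightarrow> h \<le> hd (hs :: nat list)"
  by (cases hs) auto

lemma decreasing_distinct: "sorted_wrt (>) hs \<Longrightarrow> distinct (hs :: nat list)"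
  by (induction hs) auto

lemma lang_vars_Suc: "\<phi> \<in> lang ar Sy (vars l) \<Longrightarrow> \<phi> \<in> lang ar Sy (vars (Suc l))"
  by (force simp: lang_def vars_def)

text \<open>Later heights exceed \<open>a\<close> and are not counted, so a name keeps its variable
  from the world where it enters.\<close>

lemma level_append:
  assumes "sorted_wrt (>) (ks @ hs)" "hs \<noteq> []" "a \<le> hd hs" shows "level (ks @ hs) a = level hs a"
proof -
  have "hd hs < k" if "k \<in> set ks" for k using assms(1,2) that by (simp add: sorted_wrt_append)
  then have "{h \<in> set (ks @ hs). h < a} = {h \<in> set hs. h < a}" using assms(3) by fastforce
  then show ?thesis by (simp add: level_def)
qed

lemma level_less: "hs \<noteq> [] \<Longrightarrow> a \<le> hd hs \<Longrightarrow> level hs a < length hs"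
proof -
  assume "hs \<noteq> []" "a \<le> hd hs"
  then have "{h \<in> set hs. h < a} \<subset> set hs" by (metis (no_types, lifting) hd_in_set leD mem_Collect_eq psubsetI subsetI)
  then have "level hs a < card (set hs)" unfolding level_def by (intro psubset_card_mono) auto
  then show ?thesis using card_length[of hs] by simp
qed

text \<open>The height with exactly \<open>l\<close> smaller heights on the branch is a marker of
  level \<open>l\<close>.\<close>

lemma level_surj: "sorted_wrt (>) hs \<Longrightarrow> l < length hs \<Longrightarrow> \<exists>a\<in>set hs. level hs a = l"
proof (induction hs)
  case (Cons h hs)
  show ?case
  proof (cases "l < length hs")
    case True
    then obtain a where a: "a \<in> set hs" "level hs a = l" using Cons by auto
    then have "{x \<in> set (h # hs). x < a} = {x \<in> set hs. x < a}" using Cons.prems(1) by auto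
    then have "level (h # hs) a = l" using a(2) by (simp add: level_def)
    then show ?thesis using a(1) by auto
  next
    case False
    have "{x \<in> set (h # hs). x < h} = set hs" using Cons.prems(1) by auto
    moreover have "distinct hs" using Cons.prems(1) by (auto intro: decreasing_distinct)
    ultimately have "level (h # hs) h = length hs" by (simp add: level_def distinct_card)
    then show ?thesis using False Cons.prems(2) by auto
  qed
qed simp

lemma infinite_new_vars: "infinite (vars (Suc l) - vars l)"
proof -
  have "range (\<lambda>b. prod_encode (l, b)) \<subseteq> vars (Suc l) - vars l" by (auto simp: vars_def)
  moreover have "infinite (range (\<lambda>b. prod_encode (l, b)))"
    by (rule range_inj_infinite) (auto simp: inj_on_def)
  ultimately show ?thesis using finite_subset by blast
qed

lemma vars_mono: "vars l \<subseteq> vars (Suc l)" by (auto simp: vars_def)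

section \<open>Worlds, the translation and the truth lemma\<close>

locale theory_model = ctm M for M +
  fixes ar :: "'r \<Rightarrow> nat" and Sy :: "'r set"
  assumes Sy: "countable Sy"
begin

definition idx :: "'r \<Rightarrow> nat" where "idx = to_nat_on Sy"

text \<open>A world records the heights passed through and its theory. Reaching a height that codes an
  atomic formula refutes the translation of that formula, hence the last condition.\<close>

definition worlds :: "(nat list \<times> 'r fm set) set" where
  "worlds = {(hs, \<Gamma>). hs \<noteq> [] \<and> sorted_wrt (>) hs \<and> saturated ar Sy (vars (length hs)) \<Gamma> \<and>
     (\<forall>R\<in>Sy. \<forall>ms k. hd hs = tuple_code k (idx R) ms \<longrightarrow> Rel R (map (denotes hs) ms) \<notin> \<Gamma>)}"

definition le :: "nat list \<times> 'r fm set \<Rightarrow> nat list \<times> 'r fm set \<Rightarrow> bool" where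
  "le v w \<longleftrightarrow> (\<exists>ks. fst w = ks @ fst v) \<and> snd v \<subseteq> snd w"

definition ht :: "nat list \<times> 'r fm set \<Rightarrow> nat" where "ht v = hd (fst v)"

sublocale height_model M worlds le ht
proof
  fix u v w assume "le u v" "le v w"
  then show "le u w" unfolding le_def by (metis append.assoc subset_trans)
next
  fix v w :: "nat list \<times> 'r fm set" assume *: "v \<in> worlds" "w \<in> worlds" "le v w"
  then have "hd (fst v) \<in> set (fst w)" by (auto simp: le_def worlds_def)
  then show "ht v \<le> ht w" using * unfolding ht_def worlds_def by (auto intro: decreasing_hd)
qed (simp add: le_def)

lemma nm_cases:
  obtains "nm x = 0" | a b where "x = opair (kap a) (num b)" "nm x = Suc (prod_encode (a, b))"
  using nm_default[of x] nm_name by metis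

lemma name_bound: "opair (kap a) y \<in> NN n \<Longrightarrow> a \<le> n"
  using NN_trans[of "opair (kap a) y" n "upair (kap a) y"] NN_trans[of "upair (kap a) y" n "kap a"]
  by (simp add: el_opair kap_in_NN_iff)

lemma denotes_append:
  assumes "sorted_wrt (>) (ks @ hs)" "hs \<noteq> []" "x \<in> NN (hd hs)"
  shows "denotes (ks @ hs) (nm x) = denotes hs (nm x)"
proof (rule nm_cases[of x])
  fix a b assume x: "x = opair (kap a) (num b)" "nm x = Suc (prod_encode (a, b))"
  then have "a \<le> hd hs" using name_bound assms(3) by blast
  then show ?thesis using x level_append[OF assms(1,2)] by simp
qed (simp add: denotes_def)

lemma denotes_in_vars:
  assumes "hs \<noteq> []" "x \<in> NN (hd hs)" shows "denotes hs (nm x) \<in> vars (length hs)"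
proof (rule nm_cases[of x])
  fix a b assume x: "x = opair (kap a) (num b)" "nm x = Suc (prod_encode (a, b))"
  then have "a \<le> hd hs" using name_bound assms(2) by blast
  then show ?thesis using x level_less[OF assms(1)] by (simp add: vars_def)
qed (use assms(1) in \<open>simp add: denotes_def vars_def\<close>)

lemma denotes_surj:
  assumes "sorted_wrt (>) hs" "d \<in> vars (length hs)"
  shows "\<exists>x\<in>NN (hd hs). denotes hs (nm x) = d"
proof -
  obtain l b where d: "d = prod_encode (l, b)" "l < length hs"
    using assms(2) unfolding vars_def by (metis mem_Collect_eq prod.collapse prod_decode_inverse)
  then obtain a where a: "a \<in> set hs" "level hs a = l" using level_surj assms(1) by blast
  have "num b \<in> NN (hd hs)" using NN_trans[OF NN_omega] by simp
  moreover have "kap a \<in> NN (hd hs)" using decreasing_hd[OF assms(1) a(1)] by (simp add: kap_in_NN_iff)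
  ultimately have "opair (kap a) (num b) \<in> NN (hd hs)" unfolding opair_def by (intro NN_upair)
  then show ?thesis using a d by (intro bexI[of _ "opair (kap a) (num b)"]) simp_all
qed

text \<open>The new height brings one new block of variables for witnesses. By the last hypothesis,
  a height that codes an atom codes the omitted \<open>\<beta>\<close>, as the definition of
  \<open>worlds\<close> requires.\<close>

lemma extend_world:
  assumes v: "(hs, \<Gamma>) \<in> worlds" and h: "hd hs < h"
    and \<alpha>: "\<alpha> \<in> lang ar Sy (vars (Suc (length hs)))" and \<beta>: "\<beta> \<in> lang ar Sy (vars (Suc (length hs)))"
    and np: "\<not> proves ar (insert \<alpha> \<Gamma>) \<beta>"
    and code: "\<And>R ms k. R \<in> Sy \<Longrightarrow> h = tuple_code k (idx R) ms \<Longrightarrow> \<beta> = Rel R (map (denotes (h # hs)) ms)"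
  obtains \<Delta> where "(h # hs, \<Delta>) \<in> worlds" "le (hs, \<Gamma>) (h # hs, \<Delta>)" "\<alpha> \<in> \<Delta>" "\<beta> \<notin> \<Delta>"
proof -
  let ?V = "vars (Suc (length hs))"
  have \<Gamma>: "\<Gamma> \<subseteq> lang ar Sy (vars (length hs))" using v by (auto simp: worlds_def saturated_def)
  then have \<Gamma>': "insert \<alpha> \<Gamma> \<subseteq> lang ar Sy ?V" using \<alpha> vars_mono[of "length hs"] by (auto simp: lang_def)
  have "infinite (?V - vars (length hs) - fv \<alpha>)"
    by (intro Diff_infinite_finite finite_fv infinite_new_vars)
  moreover have "?V - vars (length hs) - fv \<alpha> \<subseteq> ?V - (\<Union>\<gamma>\<in>insert \<alpha> \<Gamma>. fv \<gamma>)"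
    using \<Gamma> by (auto simp: lang_def)
  ultimately have "infinite (?V - (\<Union>\<gamma>\<in>insert \<alpha> \<Gamma>. fv \<gamma>))" using finite_subset by blast
  then obtain \<Delta> where \<Delta>: "insert \<alpha> \<Gamma> \<subseteq> \<Delta>" "saturated ar Sy ?V \<Delta>" "\<beta> \<notin> \<Delta>"
    using lindenbaum[OF Sy \<Gamma>' np _ \<beta>] by blast
  have "sorted_wrt (>) (h # hs)"
    using v h decreasing_hd[of hs] by (fastforce simp: worlds_def)
  then have "(h # hs, \<Delta>) \<in> worlds" using \<Delta> code by (auto simp: worlds_def)
  then show ?thesis using \<Delta> that by (auto simp: le_def)
qed

lemma extend_world_neutral:
  assumes "(hs, \<Gamma>) \<in> worlds"
    and "\<alpha> \<in> lang ar Sy (vars (Suc (length hs)))" "\<beta> \<in> lang ar Sy (vars (Suc (length hs)))"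
    and "\<not> proves ar (insert \<alpha> \<Gamma>) \<beta>"
  obtains h \<Delta> where "(h # hs, \<Delta>) \<in> worlds" "le (hs, \<Gamma>) (h # hs, \<Delta>)" "\<alpha> \<in> \<Delta>" "\<beta> \<notin> \<Delta>"
proof -
  \<comment> \<open>The second component 0 distinguishes it from every \<open>tuple_code\<close>;
    the first puts it above the current height.\<close>
  let ?h = "prod_encode (Suc (hd hs), 0)"
  have "hd hs < ?h" using le_prod_encode_1[of "Suc (hd hs)" 0] by simp
  then show ?thesis
    using extend_world[OF assms(1) _ assms(2-4), of ?h] that by (auto simp: tuple_code_def)
qed

lemma world_atom:
  assumes v: "(hs, \<Gamma>) \<in> worlds" and e: "K.env (hs, \<Gamma>) e" and R: "R \<in> Sy"
  shows "(\<forall>w\<in>worlds. le (hs, \<Gamma>) w \<longrightarrow> (\<nexists>k. ht w = tuple_code k (idx R) (map (\<lambda>i. nm (e i)) [0..<ar R])))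
    \<longleftrightarrow> Rel R (map (\<lambda>i. denotes hs (nm (e i))) [0..<ar R]) \<in> \<Gamma>"
    (is "?L \<longleftrightarrow> ?\<beta> \<in> \<Gamma>")
proof
  let ?ms = "map (\<lambda>i. nm (e i)) [0..<ar R]"
  have hs: "hs \<noteq> []" "sorted_wrt (>) hs" and sat: "saturated ar Sy (vars (length hs)) \<Gamma>"
    using v by (auto simp: worlds_def)
  have eD: "e i \<in> NN (hd hs)" for i using env_D[OF e] by (simp add: ht_def)
  {
    assume \<beta>: "?\<beta> \<in> \<Gamma>"
    show ?L
    proof (intro ballI impI notI)
      fix w assume w: "w \<in> worlds" "le (hs, \<Gamma>) w" "\<exists>k. ht w = tuple_code k (idx R) ?ms"
      then obtain ks \<Delta> where w': "w = (ks @ hs, \<Delta>)" "\<Gamma> \<subseteq> \<Delta>" by (cases w) (auto simp: le_def)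
      then have "sorted_wrt (>) (ks @ hs)" using w by (auto simp: worlds_def)
      then have "map (denotes (ks @ hs)) ?ms = map (\<lambda>i. denotes hs (nm (e i))) [0..<ar R]"
        using denotes_append[OF _ hs(1) eD] by simp
      moreover have "Rel R (map (denotes (ks @ hs)) ?ms) \<notin> \<Delta>"
      proof -
        obtain k where "hd (ks @ hs) = tuple_code k (idx R) ?ms" using w(3) by (auto simp: w' ht_def)
        moreover have "\<forall>R\<in>Sy. \<forall>ms k. hd (ks @ hs) = tuple_code k (idx R) ms \<longrightarrow>
            Rel R (map (denotes (ks @ hs)) ms) \<notin> \<Delta>"
          using w(1) unfolding w'(1) worlds_def by simp
        ultimately show ?thesis using R by blast
      qed
      ultimately show False using \<beta> w'(2) by (metis subsetD)
    qed
  }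
  {
    assume L: ?L
    show "?\<beta> \<in> \<Gamma>"
    proof (rule ccontr)
      assume \<beta>: "?\<beta> \<notin> \<Gamma>"
      have \<beta>L: "?\<beta> \<in> lang ar Sy (vars (length hs))"
        using R denotes_in_vars[OF hs(1) eD] by (auto simp: lang_def)
      \<comment> \<open>A trivial formula for the added hypothesis of \<open>extend_world\<close>;
        here the point is to omit \<open>?\<beta>\<close>.\<close>
      let ?\<alpha> = "\<^bold>\<bottom> \<^bold>\<longrightarrow> \<^bold>\<bottom>"
      have "proves ar \<Gamma> ?\<alpha>" by (intro proves.ImplI proves.Assumption) auto
      then have np: "\<not> proves ar (insert ?\<alpha> \<Gamma>) ?\<beta>"
        using \<beta> \<beta>L sat proves_cut unfolding saturated_def by blast
      \<comment> \<open>The padding puts this code of the atom above the current height.\<close>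
      let ?h = "tuple_code (Suc (hd hs)) (idx R) ?ms"
      have h: "hd hs < ?h"
        using le_prod_encode_1[of "Suc (hd hs)"] by (auto simp: tuple_code_def Suc_le_eq)
      have "sorted_wrt (>) ([?h] @ hs)" using h hs decreasing_hd[of hs] by fastforce
      then have same: "map (denotes (?h # hs)) ?ms = map (\<lambda>i. denotes hs (nm (e i))) [0..<ar R]"
        using denotes_append[of "[?h]" hs, OF _ hs(1) eD] by simp
      have code: "?\<beta> = Rel R' (map (denotes (?h # hs)) ms)"
        if "R' \<in> Sy" "?h = tuple_code k (idx R') ms" for R' ms k
      proof -
        have "idx R = idx R'" "ms = ?ms" using that(2) by (auto simp: tuple_code_inject)
        then have "R = R'" using R that(1) Sy by (simp add: idx_def)
        then show ?thesis using same \<open>ms = ?ms\<close> by simp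
      qed
      have L': "?\<alpha> \<in> lang ar Sy (vars (Suc (length hs)))" "?\<beta> \<in> lang ar Sy (vars (Suc (length hs)))"
        using \<beta>L by (simp_all add: lang_vars_Suc) (simp add: lang_def)
      have "\<exists>\<Delta>. (?h # hs, \<Delta>) \<in> worlds \<and> le (hs, \<Gamma>) (?h # hs, \<Delta>)"
        by (rule extend_world[OF v h L' np]) (erule (1) code, blast)
      then obtain \<Delta> where \<Delta>: "(?h # hs, \<Delta>) \<in> worlds" "le (hs, \<Gamma>) (?h # hs, \<Delta>)" by blast
      then have "\<nexists>k. ht (?h # hs, \<Delta>) = tuple_code k (idx R) ?ms" using L by blast
      then show False unfolding ht_def by auto
    qed
  }
qed

definition \<sigma> :: "'r \<Rightarrow> set_sym fm" where
  "\<sigma> R = (SOME \<chi>. well_formed set_ar \<chi> \<and> fv \<chi> \<subseteq> {..<ar R} \<and>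
    (\<forall>v e. K.env v e \<longrightarrow> K.frc v e \<chi> = (\<forall>w\<in>worlds. le v w \<longrightarrow>
       (\<nexists>k. ht w = tuple_code k (idx R) (map (\<lambda>i. nm (e i)) [0..<ar R])))))"

lemma \<sigma>: "well_formed set_ar (\<sigma> R)" "fv (\<sigma> R) \<subseteq> {..<ar R}"
  "K.env v e \<Longrightarrow> K.frc v e (\<sigma> R) \<longleftrightarrow> (\<forall>w\<in>worlds. le v w \<longrightarrow>
     (\<nexists>k. ht w = tuple_code k (idx R) (map (\<lambda>i. nm (e i)) [0..<ar R])))"
proof -
  have "\<exists>\<chi>. well_formed set_ar \<chi> \<and> fv \<chi> \<subseteq> {..<ar R} \<and>
    (\<forall>v e. K.env v e \<longrightarrow> K.frc v e \<chi> = (\<forall>w\<in>worlds. le v w \<longrightarrow>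
       (\<nexists>k. ht w = tuple_code k (idx R) (map (\<lambda>i. nm (e i)) [0..<ar R]))))"
    using height_formula[of "ar R" "idx R"] by metis
  from someI_ex[OF this, folded \<sigma>_def]
  show "well_formed set_ar (\<sigma> R)" "fv (\<sigma> R) \<subseteq> {..<ar R}"
    "K.env v e \<Longrightarrow> K.frc v e (\<sigma> R) \<longleftrightarrow> (\<forall>w\<in>worlds. le v w \<longrightarrow>
      (\<nexists>k. ht w = tuple_code k (idx R) (map (\<lambda>i. nm (e i)) [0..<ar R])))" by blast+
qed

lemma translation_\<sigma>: "translation ar \<sigma>"
  using \<sigma> by (auto simp: translation_def)

lemma world_conv:
  assumes v: "(hs, \<Gamma>) \<in> worlds" and e: "K.env (hs, \<Gamma>) e"
    and \<phi>: "well_formed ar \<phi>" "set_fm \<phi> \<subseteq> Sy"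
  shows "rename (\<lambda>i. denotes hs (nm (e i))) \<phi> \<in> lang ar Sy (vars (length hs))"
proof -
  have "hs \<noteq> []" using v by (simp add: worlds_def)
  then have "denotes hs (nm (e i)) \<in> vars (length hs)" for i
    using denotes_in_vars env_D[OF e] by (simp add: ht_def)
  then show ?thesis using \<phi> by (auto simp: lang_def fv_rename)
qed

lemma rename_body:
  "rename (\<lambda>i. denotes hs (nm (case_nat a e i))) \<phi> =
     inst [denotes hs (nm a)] 0 (rename (case_nat 0 (Suc \<circ> (\<lambda>i. denotes hs (nm (e i))))) \<phi>)"
  unfolding inst_one rename_rename
  by (rule arg_cong[where f = "\<lambda>f. rename f \<phi>"]) (auto split: nat.split)

lemma world_closed:
  "(hs, \<Gamma>) \<in> worlds \<Longrightarrow> proves ar \<Gamma> \<phi> \<Longrightarrow> \<phi> \<in> lang ar Sy (vars (length hs)) \<Longrightarrow> \<phi> \<in> \<Gamma>"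
  by (simp add: worlds_def saturated_def)

lemma world_lang: "(hs, \<Gamma>) \<in> worlds \<Longrightarrow> \<phi> \<in> \<Gamma> \<Longrightarrow> \<phi> \<in> lang ar Sy (vars (length hs))"
  by (auto simp: worlds_def saturated_def)

lemma world_proves: "(hs, \<Gamma>) \<in> worlds \<Longrightarrow> \<phi> \<in> \<Gamma> \<Longrightarrow> proves ar \<Gamma> \<phi>"
  using world_lang by (auto simp: lang_def intro: proves.Assumption)

lemma world_denotes:
  assumes "(hs, \<Gamma>) \<in> worlds" "(hs', \<Delta>) \<in> worlds" "le (hs, \<Gamma>) (hs', \<Delta>)" "K.env (hs, \<Gamma>) e"
  shows "denotes hs' (nm (e i)) = denotes hs (nm (e i))"
proof -
  obtain ks where "hs' = ks @ hs" using assms(3) by (auto simp: le_def)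
  then show ?thesis
    using denotes_append[of ks hs "e i"] env_D[OF assms(4), of i] assms(1,2) by (simp add: worlds_def ht_def)
qed

text \<open>The formula to be omitted for an implication or a universal quantifier need not be an
  atom, so the extension is made at a neutral height, which codes nothing. Atoms are the matter of
  \<open>world_atom\<close>.\<close>

lemma truth:
  assumes "well_formed ar \<phi>" "set_fm \<phi> \<subseteq> Sy" "(hs, \<Gamma>) \<in> worlds" "K.env (hs, \<Gamma>) e"
  shows "K.frc (hs, \<Gamma>) e (translate \<sigma> \<phi>) \<longleftrightarrow> rename (\<lambda>i. denotes hs (nm (e i))) \<phi> \<in> \<Gamma>"
  using assms
proof (induction \<phi> arbitrary: hs \<Gamma> e)
  case (Rel R xs)
  have E: "K.env (hs, \<Gamma>) (map e xs @@ (\<lambda>i. e (i + 0)))"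
    using Rel.prems(4) by (auto simp: K.env_def append_env_def)
  have vals: "map (\<lambda>i. f ((map e xs @@ (\<lambda>i. e (i + 0))) i)) [0..<ar R] = map (\<lambda>i. f (e i)) xs"
    for f :: "hc \<Rightarrow> nat"
    using Rel.prems(1) by (auto simp: append_env_def intro: nth_equalityI)
  have R: "R \<in> Sy" using Rel.prems(2) by simp
  have "K.frc (hs, \<Gamma>) (map e xs @@ (\<lambda>i. e (i + 0))) (\<sigma> R) \<longleftrightarrow>
      Rel R (map (\<lambda>i. denotes hs (nm (e i))) xs) \<in> \<Gamma>"
    unfolding \<sigma>(3)[OF E] world_atom[OF Rel.prems(3) E R] vals[of "\<lambda>x. denotes hs (nm x)"] ..
  then show ?case unfolding translate.simps rename.simps K.frc_inst[OF \<sigma>(1)] .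
next
  case Falsum
  then show ?case by (auto simp: worlds_def saturated_def)
next
  case (Conj \<phi> \<psi>)
  let ?r = "rename (\<lambda>i. denotes hs (nm (e i)))"
  note v = Conj.prems(3)
  have "?r \<phi> \<in> lang ar Sy (vars (length hs))" "?r \<psi> \<in> lang ar Sy (vars (length hs))"
    using world_conv[OF Conj.prems(3,4)] Conj.prems(1,2) by auto
  moreover from this have "(?r \<phi> \<^bold>\<and> ?r \<psi>) \<in> lang ar Sy (vars (length hs))" by (simp add: lang_def)
  ultimately have "(?r \<phi> \<^bold>\<and> ?r \<psi>) \<in> \<Gamma> \<longleftrightarrow> ?r \<phi> \<in> \<Gamma> \<and> ?r \<psi> \<in> \<Gamma>"
    using world_closed[OF v] world_proves[OF v] proves.ConjI proves.ConjE1 proves.ConjE2 by metis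
  then show ?case using Conj by simp
next
  case (Disj \<phi> \<psi>)
  let ?r = "rename (\<lambda>i. denotes hs (nm (e i)))"
  note v = Disj.prems(3)
  have L: "?r \<phi> \<in> lang ar Sy (vars (length hs))" "?r \<psi> \<in> lang ar Sy (vars (length hs))"
    using world_conv[OF Disj.prems(3,4)] Disj.prems(1,2) by auto
  moreover from this have "(?r \<phi> \<^bold>\<or> ?r \<psi>) \<in> lang ar Sy (vars (length hs))" by (simp add: lang_def)
  moreover have "(?r \<phi> \<^bold>\<or> ?r \<psi>) \<in> \<Gamma> \<longrightarrow> ?r \<phi> \<in> \<Gamma> \<or> ?r \<psi> \<in> \<Gamma>"
    using v by (simp add: worlds_def saturated_def)
  moreover have "well_formed ar (?r \<phi>)" "well_formed ar (?r \<psi>)" using L by (auto simp: lang_def)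
  ultimately have "(?r \<phi> \<^bold>\<or> ?r \<psi>) \<in> \<Gamma> \<longleftrightarrow> ?r \<phi> \<in> \<Gamma> \<or> ?r \<psi> \<in> \<Gamma>"
    using world_closed[OF v] world_proves[OF v] proves.DisjI1 proves.DisjI2 by metis
  then show ?case using Disj by simp
next
  case (Impl \<phi> \<psi>)
  let ?r = "\<lambda>hs. rename (\<lambda>i. denotes hs (nm (e i)))"
  note v = Impl.prems(3) and E = Impl.prems(4)
  have L: "?r hs \<phi> \<in> lang ar Sy (vars (length hs))" "?r hs \<psi> \<in> lang ar Sy (vars (length hs))"
    using world_conv[OF v E] Impl.prems(1,2) by auto
  have IH: "K.frc w e (translate \<sigma> \<phi>) \<longleftrightarrow> ?r hs \<phi> \<in> snd w" "K.frc w e (translate \<sigma> \<psi>) \<longleftrightarrow> ?r hs \<psi> \<in> snd w"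
    if w: "w \<in> worlds" "le (hs, \<Gamma>) w" for w
  proof -
    obtain hs' \<Delta> where w': "w = (hs', \<Delta>)" by fastforce
    have "?r hs' \<chi> = ?r hs \<chi>" for \<chi> :: "'r fm"
      by (rule rename_cong) (use world_denotes[OF v _ _ E, of hs' \<Delta>] w w' in simp)
    then show "K.frc w e (translate \<sigma> \<phi>) \<longleftrightarrow> ?r hs \<phi> \<in> snd w" "K.frc w e (translate \<sigma> \<psi>) \<longleftrightarrow> ?r hs \<psi> \<in> snd w"
      using Impl.IH(1)[of hs' \<Delta> e] Impl.IH(2)[of hs' \<Delta> e] Impl.prems(1,2) w w' K.env_mono[OF E] by simp_all
  qed
  have "(?r hs \<phi> \<^bold>\<longrightarrow> ?r hs \<psi>) \<in> \<Gamma> \<longleftrightarrow>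
      (\<forall>w\<in>worlds. le (hs, \<Gamma>) w \<longrightarrow> ?r hs \<phi> \<in> snd w \<longrightarrow> ?r hs \<psi> \<in> snd w)"
  proof
    assume imp: "(?r hs \<phi> \<^bold>\<longrightarrow> ?r hs \<psi>) \<in> \<Gamma>"
    show "\<forall>w\<in>worlds. le (hs, \<Gamma>) w \<longrightarrow> ?r hs \<phi> \<in> snd w \<longrightarrow> ?r hs \<psi> \<in> snd w"
    proof (intro ballI impI)
      fix w assume w: "w \<in> worlds" "le (hs, \<Gamma>) w" "?r hs \<phi> \<in> snd w"
      obtain hs' \<Delta> where w': "w = (hs', \<Delta>)" by fastforce
      have sub: "\<Gamma> \<subseteq> \<Delta>" "length hs \<le> length hs'" using w(2) w' by (auto simp: le_def)
      then have "proves ar \<Delta> (?r hs \<psi>)"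
        using world_proves[of hs' \<Delta>] w w' imp proves.ImplE by (metis snd_conv subsetD)
      moreover have "vars (length hs) \<subseteq> vars (length hs')" using sub by (auto simp: vars_def)
      then have "?r hs \<psi> \<in> lang ar Sy (vars (length hs'))" using L by (auto simp: lang_def)
      ultimately show "?r hs \<psi> \<in> snd w" using world_closed w w' by simp
    qed
  next
    assume R: "\<forall>w\<in>worlds. le (hs, \<Gamma>) w \<longrightarrow> ?r hs \<phi> \<in> snd w \<longrightarrow> ?r hs \<psi> \<in> snd w"
    show "(?r hs \<phi> \<^bold>\<longrightarrow> ?r hs \<psi>) \<in> \<Gamma>"
    proof (rule ccontr)
      assume n: "(?r hs \<phi> \<^bold>\<longrightarrow> ?r hs \<psi>) \<notin> \<Gamma>"
      have "well_formed ar (?r hs \<phi>)" "(?r hs \<phi> \<^bold>\<longrightarrow> ?r hs \<psi>) \<in> lang ar Sy (vars (length hs))"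
        using L by (auto simp: lang_def)
      then have np: "\<not> proves ar (insert (?r hs \<phi>) \<Gamma>) (?r hs \<psi>)"
        using n world_closed[OF v] proves.ImplI by metis
      obtain h \<Delta> where "(h # hs, \<Delta>) \<in> worlds" "le (hs, \<Gamma>) (h # hs, \<Delta>)" "?r hs \<phi> \<in> \<Delta>" "?r hs \<psi> \<notin> \<Delta>"
        using extend_world_neutral[OF v L[THEN lang_vars_Suc] np] by blast
      then show False using R by force
    qed
  qed
  then show ?case using IH by simp
next
  case (Forall \<phi>)
  let ?g = "\<lambda>i. denotes hs (nm (e i))"
  let ?b = "rename (case_nat 0 (Suc \<circ> ?g)) \<phi>"
  note v = Forall.prems(3) and E = Forall.prems(4)
  have L: "Forall ?b \<in> lang ar Sy (vars (length hs))"
    using world_conv[OF v E Forall.prems(1,2)] by simp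
  have IH: "K.frc (hs', \<Delta>) (case_nat a e) (translate \<sigma> \<phi>) \<longleftrightarrow> inst [denotes hs' (nm a)] 0 ?b \<in> \<Delta>"
    if w: "(hs', \<Delta>) \<in> worlds" "le (hs, \<Gamma>) (hs', \<Delta>)" "a \<in> D (hs', \<Delta>)" for hs' \<Delta> a
  proof -
    have "(\<lambda>i. denotes hs' (nm (e i))) = ?g" using world_denotes[OF v w(1,2) E] by blast
    then show ?thesis
      using Forall.IH[OF _ _ w(1), of "case_nat a e"] Forall.prems(1,2)
        K.env_case[OF K.env_mono[OF E w(1,2)] w(3)] by (simp add: rename_body)
  qed
  have "Forall ?b \<in> \<Gamma> \<longleftrightarrow> (\<forall>hs' \<Delta>. (hs', \<Delta>) \<in> worlds \<longrightarrow> le (hs, \<Gamma>) (hs', \<Delta>) \<longrightarrow>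
      (\<forall>a\<in>D (hs', \<Delta>). inst [denotes hs' (nm a)] 0 ?b \<in> \<Delta>))"
  proof
    assume all: "Forall ?b \<in> \<Gamma>"
    show "\<forall>hs' \<Delta>. (hs', \<Delta>) \<in> worlds \<longrightarrow> le (hs, \<Gamma>) (hs', \<Delta>) \<longrightarrow>
      (\<forall>a\<in>D (hs', \<Delta>). inst [denotes hs' (nm a)] 0 ?b \<in> \<Delta>)"
    proof (intro allI impI ballI)
      fix hs' \<Delta> a assume w: "(hs', \<Delta>) \<in> worlds" "le (hs, \<Gamma>) (hs', \<Delta>)" "a \<in> D (hs', \<Delta>)"
      have "Forall ?b \<in> \<Delta>" using all w(2) by (auto simp: le_def)
      then have "proves ar \<Delta> (inst [denotes hs' (nm a)] 0 ?b)"
        using world_proves[OF w(1)] proves.ForallE by blast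
      moreover have "inst [denotes hs' (nm a)] 0 ?b \<in> lang ar Sy (vars (length hs'))"
        using world_conv[OF w(1) K.env_case[OF K.env_mono[OF E w(1,2)] w(3)], of \<phi>]
          world_denotes[OF v w(1,2) E] Forall.prems(1,2) by (simp add: rename_body)
      ultimately show "inst [denotes hs' (nm a)] 0 ?b \<in> \<Delta>" using world_closed[OF w(1)] by blast
    qed
  next
    assume R: "\<forall>hs' \<Delta>. (hs', \<Delta>) \<in> worlds \<longrightarrow> le (hs, \<Gamma>) (hs', \<Delta>) \<longrightarrow>
      (\<forall>a\<in>D (hs', \<Delta>). inst [denotes hs' (nm a)] 0 ?b \<in> \<Delta>)"
    show "Forall ?b \<in> \<Gamma>"
    proof (rule ccontr)
      assume n: "Forall ?b \<notin> \<Gamma>"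
      \<comment> \<open>A variable of the new block: fresh for \<open>\<Gamma>\<close>, and denoted
        by some element of the domain at the extended world.\<close>
      let ?d = "prod_encode (length hs, 0)" and ?\<alpha> = "\<^bold>\<bottom> \<^bold>\<longrightarrow> \<^bold>\<bottom>"
      have d: "?d \<notin> vars (length hs)" "?d \<in> vars (Suc (length hs))" by (simp_all add: vars_def)
      have "\<not> proves ar \<Gamma> (Forall ?b)" using n world_closed[OF v] L by blast
      moreover have "?d \<notin> (\<Union>\<gamma>\<in>\<Gamma>. fv \<gamma>)" "?d \<notin> fv (Forall ?b)"
        using d(1) world_lang[OF v] L by (auto simp: lang_def)
      ultimately have "\<not> proves ar \<Gamma> (inst [?d] 0 ?b)" using proves_Forall_fresh by blast
      moreover have \<alpha>: "?\<alpha> \<in> lang ar Sy (vars (Suc (length hs)))" by (simp add: lang_def)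
      moreover have "proves ar \<Gamma> ?\<alpha>" by (intro proves.ImplI proves.Assumption) auto
      ultimately have np: "\<not> proves ar (insert ?\<alpha> \<Gamma>) (inst [?d] 0 ?b)" using proves_cut by blast
      have "fv (inst [?d] 0 ?b) \<subseteq> insert ?d (fv (Forall ?b))"
        unfolding inst_one fv_rename[of "case_nat ?d (\<lambda>i. i)"] by (auto split: nat.splits)
      then have "inst [?d] 0 ?b \<in> lang ar Sy (vars (Suc (length hs)))"
        using L d(2) vars_mono[of "length hs"] by (auto simp: lang_def inst_def)
      then obtain h \<Delta> where w: "(h # hs, \<Delta>) \<in> worlds" "le (hs, \<Gamma>) (h # hs, \<Delta>)" "inst [?d] 0 ?b \<notin> \<Delta>"
        using extend_world_neutral[OF v \<alpha> _ np] by blast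
      then obtain a where a: "a \<in> D (h # hs, \<Delta>)" "denotes (h # hs) (nm a) = ?d"
        using denotes_surj[of "h # hs" ?d] d(2) by (auto simp: worlds_def ht_def)
      have "inst [denotes (h # hs) (nm a)] 0 ?b \<in> \<Delta>" using R w(1,2) a(1) by blast
      then show False using w(3) a(2) by simp
    qed
  qed
  then show ?case using IH by (auto simp: Ball_def)
next
  case (Exists \<phi>)
  let ?b = "rename (case_nat 0 (Suc \<circ> (\<lambda>i. denotes hs (nm (e i))))) \<phi>"
  note v = Exists.prems(3) and E = Exists.prems(4)
  have L: "Exists ?b \<in> lang ar Sy (vars (length hs))"
    using world_conv[OF v E Exists.prems(1,2)] by simp
  have IH: "K.frc (hs, \<Gamma>) (case_nat a e) (translate \<sigma> \<phi>) \<longleftrightarrow> inst [denotes hs (nm a)] 0 ?b \<in> \<Gamma>"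
    if "a \<in> D (hs, \<Gamma>)" for a
    using Exists.IH[OF _ _ v, of "case_nat a e"] Exists.prems(1,2) K.env_case[OF E that] by (simp add: rename_body)
  have "Exists ?b \<in> \<Gamma> \<longleftrightarrow> (\<exists>a\<in>D (hs, \<Gamma>). inst [denotes hs (nm a)] 0 ?b \<in> \<Gamma>)"
  proof
    assume "Exists ?b \<in> \<Gamma>"
    then obtain d where d: "d \<in> vars (length hs)" "inst [d] 0 ?b \<in> \<Gamma>"
      using v by (auto simp: worlds_def saturated_def)
    then obtain a where "a \<in> NN (hd hs)" "denotes hs (nm a) = d"
      using denotes_surj[of hs d] v by (auto simp: worlds_def)
    then show "\<exists>a\<in>D (hs, \<Gamma>). inst [denotes hs (nm a)] 0 ?b \<in> \<Gamma>" using d by (auto simp: ht_def)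
  next
    assume "\<exists>a\<in>D (hs, \<Gamma>). inst [denotes hs (nm a)] 0 ?b \<in> \<Gamma>"
    then have "proves ar \<Gamma> (Exists ?b)" using world_proves[OF v] proves.ExistsI by blast
    then show "Exists ?b \<in> \<Gamma>" using world_closed[OF v] L by blast
  qed
  then show ?case using IH by simp
qed

lemma countermodel:
  assumes \<phi>: "well_formed ar \<phi>" "set_fm \<phi> \<subseteq> Sy" and np: "\<not> proves ar {} \<phi>"
  shows "\<not> forced (translate \<sigma> \<phi>)"
proof
  assume forced: "forced (translate \<sigma> \<phi>)"
  \<comment> \<open>The free variables of \<open>\<phi>\<close> are moved into block 0, the only one
    available at the root.\<close>
  let ?f = "\<lambda>i. prod_encode (0, i)"
  let ?\<phi> = "rename ?f \<phi>"
  have "rename (\<lambda>x. snd (prod_decode x)) ?\<phi> = \<phi>"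
    by (simp add: rename_rename comp_def rename_id)
  then have np': "\<not> proves ar {} ?\<phi>"
    using np proves_rename[of ar "{}" ?\<phi> "\<lambda>x. snd (prod_decode x)"] by auto
  have L: "?\<phi> \<in> lang ar Sy (vars 1)" using \<phi> by (auto simp: lang_def fv_rename vars_def)
  have "infinite (vars 1)" using infinite_new_vars[of 0] by (auto dest: finite_Diff)
  then obtain \<Gamma> where \<Gamma>: "saturated ar Sy (vars 1) \<Gamma>" "?\<phi> \<notin> \<Gamma>"
    using lindenbaum[OF Sy _ np' _ L] by auto
  \<comment> \<open>Height 0 codes no atom, so it can serve as the height of the root.\<close>
  have "prod_encode (0, 0) = 0" by (simp add: prod_encode_def)
  then have code: "tuple_code k r ms \<noteq> 0" for k r ms
    unfolding tuple_code_def by (metis Pair_inject old.nat.distinct(1) prod_encode_eq)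
  have v: "([0], \<Gamma>) \<in> worlds" using \<Gamma> code by (auto simp: worlds_def) (metis neq0_conv)
  \<comment> \<open>\<open>kap 0\<close> is a marker of level 0, so these sets name the variables of
    block 0.\<close>
  let ?e = "\<lambda>i. opair (kap 0) (num i)"
  have "num i \<in> NN 0" for i using NN_trans[OF NN_omega] by simp
  then have "?e i \<in> NN 0" for i unfolding opair_def by (intro NN_upair) (simp_all add: kap_in_NN_iff)
  then have E: "K.env ([0], \<Gamma>) ?e" using v unfolding K.env_def by (auto simp: ht_def)
  have "denotes [0] (nm (?e i)) = ?f i" for i by (simp add: level_def)
  then have "\<not> K.frc ([0], \<Gamma>) ?e (translate \<sigma> \<phi>)"
    using truth[OF \<phi> v E] \<Gamma>(2) by simp
  then show False using forced E by (simp add: forced_def)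
qed

end

lemma finite_set_fm: "finite (set_fm \<phi>)"
  by (induction \<phi>) auto

lemma QL_subset_IQC:
  fixes ar :: "'r \<Rightarrow> nat"
  assumes M: "ctm_of_ZFC M"
    and T: "\<And>\<psi>. \<psi> \<in> T \<Longrightarrow> \<psi> \<in> IKP_plus \<union> {MP, AC} \<or> IKP_plus \<union> {MP, AC} \<turnstile> \<psi>"
  shows "QL ar T \<subseteq> IQC ar"
proof
  fix \<phi> :: "'r fm" assume \<phi>: "\<phi> \<in> QL ar T"
  \<comment> \<open>Restricting to the finitely many symbols of \<open>\<phi>\<close> gives a
    countable language for any type \<open>'r\<close>.\<close>
  interpret theory_model M ar "set_fm \<phi>"
    by unfold_locales (use M in \<open>auto intro: countable_finite finite_set_fm\<close>)
  have "T \<turnstile> translate \<sigma> \<phi>" using \<phi> translation_\<sigma> by (simp add: QL_def)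
  moreover have "forced \<psi>" if "\<psi> \<in> T" for \<psi>
    using T[OF that] forcedI[of "IKP_plus \<union> {MP, AC}" \<psi>] forced_theory by blast
  ultimately have "forced (translate \<sigma> \<phi>)" using forcedI by blast
  then have "proves ar {} \<phi>" using countermodel \<phi> by (auto simp: QL_def)
  then show "\<phi> \<in> IQC ar" using \<phi> by (simp add: IQC_def QL_def)
qed

theorem corollary59:
  fixes ar :: "'r \<Rightarrow> nat" and T :: "set_sym fm set"
  assumes "\<exists>M. ctm_of_ZFC M"
    and "set_theory T"
    and "T \<subseteq> theorems (IKP_plus \<union> {MP, AC})"
  shows "QL ar T = IQC ar \<and> QL ar IKP = IQC ar"
proof -
  obtain M where M: "ctm_of_ZFC M" using assms(1) by blast
  have "QL ar IKP \<subseteq> IQC ar" by (rule QL_subset_IQC[OF M]) (simp add: IKP_plus_def)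
  moreover have "QL ar T \<subseteq> IQC ar"
    by (rule QL_subset_IQC[OF M]) (use assms(3) in \<open>auto simp: theorems_def\<close>)
  ultimately show ?thesis using IQC_subset_QL by blast
qed

end
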